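(* Let $\lambda=(p,0,r;a,1/2;x)\in\mathcal{I}$ be a non-elementary solution to Problem I. Then: (1) The dual $\lambda'=(p,0,r;a',1/2;x)$, where $a'=1-2p/r-a$, is also a non-elementary solution to Problem I. (2) The ratio $s:=r/p$ is an integer with $s\ge 2$ and $p(s-1)\equiv 0 \pmod 2$, and there exist $j,j'\in\mathbb{Z}_{\ge0}$ such that $a=j/s$, $a'=j'/s$ and $j+j'=s-2$. In particular $a,a'\in\mathbb{Q}$. (3) $x$ is the unique root in $(0,1)$ of $\varphi_s(z):=(s-1)^{s-1}z^s-s^s(1-z)^{s-1}=0$; in particular $x$ is algebraic.
   Context: For $\lambda=(p,q,r;a,b;x)\in\mathbb{R}^6$ with $0<x<1$ put $f(w;\lambda):={}_2F_1(pw+a,\,qw+b;\,rw;\,x)$, where ${}_2F_1$ is the Gauss hypergeometric function, regarded as a meromorphic function of $w\in\mathbb{C}$. Problem I: $\lambda$ is a solution if there are constants $C,d\in\mathbb{C}^\times$ and $u_1,\dots,u_m,v_1,\dots,v_n\in\mathbb{C}$ with $f(w;\lambda)=C\,d^w\prod_{i=1}^m\Gamma(w+u_i)/\prod_{i=1}^n\Gamma(w+v_i)$ identically in $w$ (a gamma product formula, GPF). $\lambda$ is elementary if $f(w;\lambda)$ has at most finitely many poles in $w\in\mathbb{C}$. $\mathcal{I}:=\{(p,q,r;a,b;x)\in\mathbb{R}^6: 0<p<r,\ q=0,\ 0<x<1\}$. The dual of $\lambda=(p,0,r;a,b;x)$ is $\lambda'=(p,0,r;\,1-2p/r-a,\,1-b;\,x)$.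 It is known that every non-elementary solution in $\mathcal{I}$ has $p,r\in\mathbb{Z}$, $p\equiv r\pmod 2$ and $b=1/2$. *)

theory Defs
  imports "HOL-Complex_Analysis.Complex_Analysis" "HOL-Computational_Algebra.Polynomial"
begin

definition hyp2F1 :: "complex \<Rightarrow> complex \<Rightarrow> complex \<Rightarrow> complex \<Rightarrow> complex" where
  "hyp2F1 \<alpha> \<beta> \<gamma> z =
     (\<Sum>n. pochhammer \<alpha> n * pochhammer \<beta> n / (pochhammer \<gamma> n * fact n) * z ^ n)"

text \<open>f(w; lambda) = 2F1(p w + a, q w + b; r w; x), as a function of complex w.
  It is given by the convergent series off the set where r w is a non-positive
  integer; on that (discrete) set the value is irrelevant (set to 0).\<close>
definition hgf :: "real \<Rightarrow> real \<Rightarrow> real \<Rightarrow> real \<Rightarrow> real \<Rightarrow> real \<Rightarrow> complex \<Rightarrow> complex" where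
  "hgf p q r a b x w =
     (if of_real r * w \<in> \<int>\<^sub>\<le>\<^sub>0 then 0
      else hyp2F1 (of_real p * w + of_real a) (of_real q * w + of_real b) (of_real r * w) (of_real x))"

text \<open>Problem I: a gamma product formula
  f(w) = C d^w prod Gamma(w+u_i) / prod Gamma(w+v_i), identically in w.
  d^w is written exp(delta w) with d = exp delta; 1/Gamma is rGamma (entire).
  Identity of meromorphic functions is expressed as equality at every w where
  both sides are given by their holomorphic expressions.\<close>
definition is_GPF_solution :: "real \<Rightarrow> real \<Rightarrow> real \<Rightarrow> real \<Rightarrow> real \<Rightarrow> real \<Rightarrow> bool" where
  "is_GPF_solution p q r a b x \<longleftrightarrow>
     (\<exists>(C::complex) (\<delta>::complex) (us::complex list) (vs::complex list). C \<noteq> 0 \<and>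
        (\<forall>w. of_real r * w \<notin> \<int>\<^sub>\<le>\<^sub>0 \<longrightarrow> (\<forall>u\<in>set us. w + u \<notin> \<int>\<^sub>\<le>\<^sub>0) \<longrightarrow>
           hgf p q r a b x w =
             C * exp (\<delta> * w) * prod_list (map (\<lambda>u. Gamma (w + u)) us)
               * prod_list (map (\<lambda>v. rGamma (w + v)) vs)))"

definition is_elementary :: "real \<Rightarrow> real \<Rightarrow> real \<Rightarrow> real \<Rightarrow> real \<Rightarrow> real \<Rightarrow> bool" where
  "is_elementary p q r a b x \<longleftrightarrow> finite {w. is_pole (hgf p q r a b x) w}"

definition in_class_I :: "real \<Rightarrow> real \<Rightarrow> real \<Rightarrow> real \<Rightarrow> real \<Rightarrow> real \<Rightarrow> bool" where
  "in_class_I p q r a b x \<longleftrightarrow> 0 < p \<and> p < r \<and> q = 0 \<and> 0 < x \<and> x < 1"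

definition phi :: "nat \<Rightarrow> real \<Rightarrow> real" where
  "phi s z = real (s - 1) ^ (s - 1) * z ^ s - real s ^ s * (1 - z) ^ (s - 1)"

end

theory Submission
  imports Defs "HOL-Complex_Analysis.Riemann_Mapping" "HOL-Real_Asymp.Real_Asymp"
    "HOL-Computational_Algebra.Fundamental_Theorem_Algebra"
begin

text \<open>
  Write \<open>f(w) = \<Gamma>(r w) F(w)\<close> with \<open>F\<close> entire. As \<open>w \<rightarrow> +\<infinity>\<close> the function \<open>f\<close> tends to a positive constant
  \<open>L\<close>, so a gamma product formula must be balanced: \<open>m = n\<close>, \<open>\<Sum> u = \<Sum> v\<close>, \<open>d = 1\<close>, \<open>C = L\<close>. To the left, the
  reflection formula turns the gamma quotient into a trigonometric quotient \<open>\<Theta>\<close>, which is periodic up to sign,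
  times a quotient \<open>M(-w)\<close> of Gamma functions with reflected parameters. On the other hand, by Euler's
  transformation, \<open>F(-n/r)\<close> is the value at \<open>(n + 2)/r\<close> of the dual function times an explicit Gamma factor
  \<open>E\<close> and a sine. Infinitely many of these values are nonzero, and comparing their signs and growth along
  progressions gives \<open>r \<in> \<int>\<close>, \<open>p \<equiv> r (mod 2)\<close> and the vanishing of the exponential growth rate of \<open>E\<close>, which
  is the equation \<open>\<phi>\<^sub>s(x) = 0\<close>. Then \<open>E\<close> is itself a balanced gamma product tending to a constant \<open>D > 0\<close>; the bounded
  function \<open>f_dual(w) - const \<cdot> M(w - 2/r) / E(w)\<close> vanishes along a progression and hence identically. So the dual
  is a solution as well.

  By Liouville's theorem \<open>\<Theta>(w) = (L/\<pi>) (sin (\<pi> r w) + D sin (\<pi> (p w + a)))\<close>. Comparison with the dual formula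
  yields a connection formula between \<open>F(w)\<close> and the dual function at \<open>2/r - w\<close>. Evaluating it where the dual
  function terminates forces \<open>s = r/p\<close> and \<open>s a\<close> to be integers. It also says that every zero of \<open>\<Theta>\<close>
  with \<open>sin (\<pi> r w) \<noteq> 0\<close> satisfies \<open>r w \<equiv> p w + a\<close> or \<open>r w \<equiv> 1/2\<close> modulo 1; one zero, produced by solving
  \<open>sin (s y) = \<mp>D sin y\<close>, already gives \<open>1 \<le> D \<le> s\<close>. The same holds for the constant \<open>D'\<close> of the dual, while
  \<open>D'/D = ((s - 1)/(1 - x))\<^bsup>a' - a\<^esup>\<close> with \<open>(s - 1)/(1 - x) > s\<close>. Hence \<open>|a' - a| < 1\<close>, which means
  \<open>0 \<le> s a \<le> s - 2\<close>.
\<close>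

section \<open>Products of reciprocal Gamma functions\<close>

text \<open>Gamma quotients are compared along progressions \<open>w + n\<close> only, where Euler's
  limit governs each factor; \<open>rGamma\<close> is entire, so formulas can be used with their
  denominators cleared. What is found on a progression must then be spread to the plane. This is why
  bounds on a whole half plane are proved for balanced quotients: a bounded holomorphic function
  there cannot vanish on a progression without vanishing identically. Non-elementarity enters as the
  existence of arbitrarily large \<open>n\<close> with \<open>F a (- n / r)\<close> nonzero. One
  such \<open>n\<close> yields a nonzero limit along \<open>n + r k\<close>, from which the parity
  of \<open>p - r\<close> and the vanishing growth rate are read off. The unknown parameters of the
  formula drop out of the connection formula because they enter the reflected formula for
  \<open>a\<close> and the formula for the dual in the same way. Only the quotient
  \<open>D' / D\<close> is known explicitly, so \<open>D\<close> has to be bounded on both sides,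
  and \<open>D'\<close> too. The argument is therefore arranged to be run a second time with
  \<open>dual a\<close> in place of \<open>a\<close>; this requires that the dual be non-elementary
  as well.\<close>

definition rgprod :: "complex list \<Rightarrow> complex \<Rightarrow> complex" where
  "rgprod vs w = prod_list (map (\<lambda>v. rGamma (w + v)) vs)"

definition pprod :: "complex list \<Rightarrow> complex \<Rightarrow> complex" where
  "pprod vs w = prod_list (map (\<lambda>v. w + v) vs)"

lemma rgprod_Nil [simp]: "rgprod [] w = 1"
  and rgprod_Cons [simp]: "rgprod (v # vs) w = rGamma (w + v) * rgprod vs w"
  and rgprod_append: "rgprod (us @ vs) w = rgprod us w * rgprod vs w"
  by (simp_all add: rgprod_def)

lemma pprod_Nil [simp]: "pprod [] w = 1"
  and pprod_Cons [simp]: "pprod (v # vs) w = (w + v) * pprod vs w"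
  by (simp_all add: pprod_def)

lemma not_nonpos_Ints_if_Re_pos: "Re z > 0 \<Longrightarrow> z \<notin> \<int>\<^sub>\<le>\<^sub>0"
  by (metis Re_complex_of_real nonpos_Ints_cases not_le of_int_le_0_iff of_real_of_int_eq)

lemma prod_list_Gamma_eq: "prod_list (map (\<lambda>u. Gamma (w + u)) us) = inverse (rgprod us w)"
  by (induction us) (simp_all add: Gamma_def)

lemma rgprod_eq_0_iff: "rgprod us w = 0 \<longleftrightarrow> (\<exists>u\<in>set us. w + u \<in> \<int>\<^sub>\<le>\<^sub>0)"
  by (induction us) (auto simp: rGamma_eq_zero_iff)

lemma holomorphic_rgprod: "rgprod us holomorphic_on A"
proof -
  have "(\<lambda>w. rgprod us w) holomorphic_on A"
    by (induction us) (auto intro!: holomorphic_intros)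
  thus ?thesis by simp
qed

lemma rgprod_plus1: "rgprod us w = pprod us w * rgprod us (w + 1)"
proof (induction us)
  case (Cons u us)
  have "rGamma (w + u) = (w + u) * rGamma (w + 1 + u)"
    using rGamma_plus1[of "w + u"] by (simp add: add_ac)
  with Cons show ?case by simp
qed simp

lemma norm_le_sum_list_norm: "u \<in> set us \<Longrightarrow> norm (u::complex) \<le> (\<Sum>u\<leftarrow>us. norm u)"
  by (intro member_le_sum_list) auto

lemma rgprod_nonzero_right:
  obtains R where "R > 0" "\<And>w. Re w \<ge> R \<Longrightarrow> rgprod us w \<noteq> 0"
proof
  define R where "R = 1 + (\<Sum>u\<leftarrow>us. norm u)"
  show "R > 0" by (auto simp: R_def intro!: add_pos_nonneg sum_list_nonneg)
  fix w assume w: "Re w \<ge> R"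
  show "rgprod us w \<noteq> 0"
  proof
    assume "rgprod us w = 0"
    then obtain u where u: "u \<in> set us" "w + u \<in> \<int>\<^sub>\<le>\<^sub>0" by (auto simp: rgprod_eq_0_iff)
    have "norm u \<le> (\<Sum>u\<leftarrow>us. norm u)" using u(1) by (rule norm_le_sum_list_norm)
    moreover have "\<bar>Re u\<bar> \<le> norm u" by (rule abs_Re_le_cmod)
    ultimately have "Re (w + u) > 0" using w by (auto simp: R_def)
    thus False using u(2) not_nonpos_Ints_if_Re_pos by blast
  qed
qed

text \<open>The reciprocal growth factor in \<open>1 / \<Gamma>(z + n + 1) \<sim> 1 / (n! n\<^sup>z)\<close>, for a product of \<open>m\<close> Gamma functions.\<close>

definition growth :: "nat \<Rightarrow> complex \<Rightarrow> nat \<Rightarrow> complex" where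
  "growth m z n = fact n ^ m * exp (z * of_real (ln (of_nat n)))"

lemma growth_add: "growth m z n * growth m' z' n = growth (m + m') (z + z') n"
  by (simp add: growth_def power_add ring_distribs exp_add)

lemma growth_nonzero [simp]: "growth m z n \<noteq> 0"
  by (simp add: growth_def)

text \<open>Off the nonpositive integers this is Euler's limit for \<open>rGamma_series\<close>,
  divided by \<open>rGamma z\<close>. At a nonpositive integer that division fails, although the
  shifted values are eventually nonzero; such \<open>z\<close> are reached by descending from some
  \<open>z + k\<close> with positive real part.\<close>

lemma rGamma_shift_asymp:
  fixes z :: complex
  shows "(\<lambda>n. rGamma (z + of_nat (Suc n)) * growth 1 z n) \<longlonglongrightarrow> 1"
proof -
  define P where "P = (\<lambda>z::complex. (\<lambda>n. rGamma (z + of_nat (Suc n)) * growth 1 z n) \<longlonglongrightarrow> 1)"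
  have main: "P z" if "z \<notin> \<int>\<^sub>\<le>\<^sub>0" for z
  proof -
    have nz: "rGamma z \<noteq> 0" using that by (simp add: rGamma_eq_zero_iff)
    have "(\<lambda>n. rGamma z / rGamma_series z n) \<longlonglongrightarrow> rGamma z / rGamma z"
      by (intro tendsto_intros nz)
    moreover have "rGamma z / rGamma_series z n = rGamma (z + of_nat (Suc n)) * growth 1 z n" for n
    proof -
      have "pochhammer z (Suc n) \<noteq> 0"
        using that by (metis pochhammer_eq_0_imp_nonpos_Int)
      thus ?thesis
        by (subst pochhammer_rGamma[of z "Suc n"]) (simp add: rGamma_series_def growth_def)
    qed
    ultimately show ?thesis using nz by (simp add: P_def del: of_nat_Suc)
  qed
  have step: "P z" if "P (z + 1)" for z
  proof -
    have "(\<lambda>n. (z + 1) * (1 / of_nat n) + 1 :: complex) \<longlonglongrightarrow> (z + 1) * 0 + 1"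
      by (intro tendsto_intros lim_1_over_n)
    from tendsto_mult[OF that[unfolded P_def] this]
    have "(\<lambda>n. rGamma (z + 1 + of_nat (Suc n)) * growth 1 (z + 1) n * ((z + 1) * (1 / of_nat n) + 1)) \<longlonglongrightarrow> 1" by simp
    moreover have "eventually (\<lambda>n. rGamma (z + 1 + of_nat (Suc n)) * growth 1 (z + 1) n * ((z + 1) * (1 / of_nat n) + 1) =
        rGamma (z + of_nat (Suc n)) * growth 1 z n) sequentially"
      using eventually_gt_at_top[of 0]
    proof eventually_elim
      case (elim n)
      have 1: "rGamma (z + of_nat (Suc n)) = (z + 1 + of_nat n) * rGamma (z + 1 + of_nat (Suc n))"
        using rGamma_plus1[of "z + of_nat (Suc n)"] by (simp add: add_ac)
      have 2: "growth 1 (z + 1) n = growth 1 z n * of_nat n"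
        using elim by (simp add: growth_def ring_distribs exp_add exp_of_real)
      show ?case unfolding 1 2 using elim by (simp add: field_simps)
    qed
    ultimately show ?thesis unfolding P_def by (rule Lim_transform_eventually)
  qed
  have *: "P z" if "z + of_nat k \<notin> \<int>\<^sub>\<le>\<^sub>0" for k z
    using that
  proof (induction k arbitrary: z)
    case 0
    thus ?case using main[of z] by simp
  next
    case (Suc k)
    have "z + 1 + of_nat k \<notin> \<int>\<^sub>\<le>\<^sub>0" using Suc.prems by (simp add: add_ac)
    from step[OF Suc.IH[OF this]] show ?case .
  qed
  have "Re (z + of_nat (nat \<lceil>\<bar>Re z\<bar>\<rceil> + 1)) > 0" by (simp add: of_nat_nat) linarith
  hence "z + of_nat (nat \<lceil>\<bar>Re z\<bar>\<rceil> + 1) \<notin> \<int>\<^sub>\<le>\<^sub>0" by (rule not_nonpos_Ints_if_Re_pos)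
  from *[OF this] show ?thesis by (simp only: P_def)
qed

lemma rgprod_shift_asymp:
  "(\<lambda>n. rgprod vs (w + of_nat (Suc n)) * growth (length vs) (of_nat (length vs) * w + sum_list vs) n) \<longlonglongrightarrow> 1"
proof (induction vs)
  case Nil
  show ?case by (simp add: growth_def)
next
  case (Cons v vs)
  have "rGamma (w + v + of_nat (Suc n)) * growth 1 (w + v) n *
      (rgprod vs (w + of_nat (Suc n)) * growth (length vs) (of_nat (length vs) * w + sum_list vs) n) =
     rgprod (v # vs) (w + of_nat (Suc n)) *
       growth (length (v # vs)) (of_nat (length (v # vs)) * w + sum_list (v # vs)) n" for n
  proof -
    have "growth (length (v # vs)) (of_nat (length (v # vs)) * w + sum_list (v # vs)) n =
        growth 1 (w + v) n * growth (length vs) (of_nat (length vs) * w + sum_list vs) n"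
      unfolding growth_add by (simp add: algebra_simps)
    moreover have "w + v + of_nat (Suc n) = w + of_nat (Suc n) + v" by simp
    ultimately show ?thesis by (simp only: rgprod_Cons mult_ac)
  qed
  with tendsto_mult[OF rGamma_shift_asymp[of "w + v"] Cons]
  show ?case by (simp only: mult_1_right)
qed

text \<open>The sequence is \<open>n\<close> to the power \<zeta>. Passing from \<open>n\<close> to
  \<open>m n\<close> does not change the limit, so \<open>m\<close> to the power \<zeta> is 1 for
  every \<open>m > 0\<close>. For \<open>m = 2\<close> and \<open>m = 3\<close> a nonzero \<zeta>
  would make \<open>ln 2 / ln 3\<close> rational, hence a power of 2 equal to a nontrivial power of
  3.\<close>

lemma exp_times_ln_limit_imp_0:
  fixes \<zeta> :: complex
  assumes lim: "(\<lambda>n. exp (\<zeta> * of_real (ln (of_nat n)))) \<longlonglongrightarrow> l" and "l \<noteq> 0"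
  shows "\<zeta> = 0"
proof (rule ccontr)
  assume nz: "\<zeta> \<noteq> 0"
  have *: "exp (\<zeta> * of_real (ln (of_nat m))) = 1" if "m > 0" for m :: nat
  proof -
    have 1: "(\<lambda>n. exp (\<zeta> * of_real (ln (of_nat (m * n))))) \<longlonglongrightarrow> l"
      using lim by (rule filterlim_compose) (use that mult_nat_left_at_top in auto)
    have "(\<lambda>n. exp (\<zeta> * of_real (ln (of_nat m))) * exp (\<zeta> * of_real (ln (of_nat n)))) \<longlonglongrightarrow>
         exp (\<zeta> * of_real (ln (of_nat m))) * l"
      by (intro tendsto_intros lim)
    moreover have "eventually (\<lambda>n. exp (\<zeta> * of_real (ln (of_nat m))) * exp (\<zeta> * of_real (ln (of_nat n))) =
        exp (\<zeta> * of_real (ln (of_nat (m * n))))) sequentially"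
      using eventually_gt_at_top[of 0]
      by eventually_elim (use that in \<open>simp add: ln_mult ring_distribs exp_add\<close>)
    ultimately have "(\<lambda>n. exp (\<zeta> * of_real (ln (of_nat (m * n))))) \<longlonglongrightarrow> exp (\<zeta> * of_real (ln (of_nat m))) * l"
      by (rule Lim_transform_eventually)
    from LIMSEQ_unique[OF this 1]
    have "exp (\<zeta> * of_real (ln (of_nat m))) * l = l" .
    thus ?thesis using \<open>l \<noteq> 0\<close> by simp
  qed
  have **: "\<exists>k::int. z = of_int (2 * k) * of_real pi * \<i>" if "exp z = 1" for z :: complex
    using that unfolding exp_eq_1 by (auto simp: complex_eq_iff)
  from **[OF *[of 2]] obtain k :: int where k: "\<zeta> * of_real (ln 2) = of_int (2 * k) * of_real pi * \<i>"
    by auto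
  from **[OF *[of 3]] obtain j :: int where j: "\<zeta> * of_real (ln 3) = of_int (2 * j) * of_real pi * \<i>"
    by auto
  have "k \<noteq> 0" using k nz by auto
  have "\<zeta> * (of_real (ln 2) * of_int j) = (\<zeta> * of_real (ln 2)) * of_int j" by simp
  also have "\<dots> = (\<zeta> * of_real (ln 3)) * of_int k" unfolding k j by simp
  finally have "\<zeta> * (of_real (ln 2) * of_int j) = \<zeta> * (of_real (ln 3) * of_int k)" by simp
  hence "complex_of_real (ln 2 * of_int j) = complex_of_real (ln 3 * of_int k)" using nz by simp
  hence e: "ln 2 * real_of_int j = ln 3 * real_of_int k" by (simp only: of_real_eq_iff)
  have "ln 2 * real (nat \<bar>j\<bar>) = \<bar>ln 2 * real_of_int j\<bar>" by (simp add: abs_mult)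
  also have "\<dots> = ln 3 * real (nat \<bar>k\<bar>)" unfolding e by (simp add: abs_mult)
  finally have "ln 2 * real (nat \<bar>j\<bar>) = ln 3 * real (nat \<bar>k\<bar>)" .
  hence "ln (2 ^ nat \<bar>j\<bar> :: real) = ln (3 ^ nat \<bar>k\<bar>)"
    by (simp add: ln_realpow mult.commute)
  hence "(2 :: real) ^ nat \<bar>j\<bar> = 3 ^ nat \<bar>k\<bar>" by simp
  hence eq: "(2 :: nat) ^ nat \<bar>j\<bar> = 3 ^ nat \<bar>k\<bar>"
    by (metis of_nat_eq_iff of_nat_numeral of_nat_power)
  have "odd ((3::nat) ^ nat \<bar>k\<bar>)" by simp
  hence "nat \<bar>j\<bar> = 0" using eq by (cases "nat \<bar>j\<bar>") (auto simp flip: eq)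
  hence "(3::nat) ^ nat \<bar>k\<bar> = 1" using eq by simp
  thus False using \<open>k \<noteq> 0\<close> by simp
qed

section \<open>Balance conditions forced on a quotient of Gamma products by a nonzero limit\<close>

lemma Lim_Suc_shift: "(\<lambda>n. f (w + of_nat n)) \<longlonglongrightarrow> l \<longleftrightarrow> (\<lambda>n. f (w + of_nat (Suc n))) \<longlonglongrightarrow> l"
  by (subst filterlim_sequentially_Suc[symmetric]) simp

lemma eventually_rgprod_shift_nonzero: "eventually (\<lambda>n. rgprod us (w + of_nat n) \<noteq> 0) sequentially"
proof -
  obtain R where R: "\<And>w. Re w \<ge> R \<Longrightarrow> rgprod us w \<noteq> 0" using rgprod_nonzero_right by blast
  have "eventually (\<lambda>n. R - Re w \<le> real n) sequentially"
    using filterlim_real_sequentially by (simp add: filterlim_at_top)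
  thus ?thesis by eventually_elim (auto intro!: R)
qed

lemma pprod_ratio_tendsto:
  "(\<lambda>n. pprod us (w + of_nat n) / (w + of_nat n) ^ length us) \<longlonglongrightarrow> 1"
proof (induction us)
  case Nil
  show ?case by simp
next
  case (Cons u us)
  have inv: "(\<lambda>n. inverse (w + of_nat n)) \<longlonglongrightarrow> 0"
    by (intro filterlim_compose[OF tendsto_inverse_0] tendsto_add_filterlim_at_infinity[OF tendsto_const]
       tendsto_of_nat)
  have "(\<lambda>n. 1 + u * inverse (w + of_nat n)) \<longlonglongrightarrow> 1 + u * 0"
    by (intro tendsto_intros inv)
  moreover have "eventually (\<lambda>n. 1 + u * inverse (w + of_nat n) = (w + of_nat n + u) / (w + of_nat n)) sequentially"
    using eventually_rgprod_shift_nonzero[of "[0]" w]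
  proof eventually_elim
    case (elim n)
    hence "w + of_nat n \<noteq> 0" by auto
    thus ?case by (simp add: field_simps)
  qed
  ultimately have "(\<lambda>n. (w + of_nat n + u) / (w + of_nat n)) \<longlonglongrightarrow> 1"
    by (auto dest: Lim_transform_eventually)
  from tendsto_mult[OF this Cons] show ?case by simp
qed

text \<open>The quotient of consecutive values tends to 1, but by the functional equation it also
  behaves like \<open>exp \<delta>\<close> times \<open>z\<close> to the power
  \<open>length us - length vs\<close>. This gives the first two claims. The exponential is then
  constant along the progression, and what remains behaves like \<open>n\<close> to the power
  \<open>sum_list us - sum_list vs\<close>, which has a nonzero limit only for exponent 0.\<close>

lemma rgprod_ratio_balance:
  fixes us vs :: "complex list" and \<delta> w0 l :: complex
  defines "q \<equiv> (\<lambda>w. exp (\<delta> * w) * (rgprod vs w / rgprod us w))"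
  assumes lim: "(\<lambda>n. q (w0 + of_nat n)) \<longlonglongrightarrow> l" and l: "l \<noteq> 0"
  shows "length us = length vs" "exp \<delta> = 1" "sum_list us = sum_list vs"
proof -
  define z where "z = (\<lambda>n. w0 + of_nat n :: complex)"
  have zinf: "filterlim z at_infinity sequentially" unfolding z_def
    by (intro tendsto_add_filterlim_at_infinity[OF tendsto_const] tendsto_of_nat)
  have ev: "eventually (\<lambda>n. rgprod us (z n) \<noteq> 0 \<and> rgprod vs (z n) \<noteq> 0 \<and> z n \<noteq> 0) sequentially"
    using eventually_rgprod_shift_nonzero[of us w0] eventually_rgprod_shift_nonzero[of vs w0]
      eventually_rgprod_shift_nonzero[of "[0]" w0]
    unfolding z_def by eventually_elim auto
  have "(\<lambda>n. q (z (Suc n)) / q (z n)) \<longlonglongrightarrow> l / l"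
    using lim l unfolding z_def by (intro tendsto_divide) (auto simp: filterlim_sequentially_Suc[where f = "\<lambda>n. q (w0 + of_nat n)"] simp del: of_nat_Suc)
  hence lim1: "(\<lambda>n. q (z (Suc n)) / q (z n)) \<longlonglongrightarrow> 1" using l by simp
  have "(\<lambda>n. pprod vs (z n) / z n ^ length vs / (pprod us (z n) / z n ^ length us)) \<longlonglongrightarrow> 1 / 1"
    unfolding z_def by (intro tendsto_divide pprod_ratio_tendsto) auto
  from tendsto_mult[OF lim1 this]
  have "(\<lambda>n. q (z (Suc n)) / q (z n) *
      (pprod vs (z n) / z n ^ length vs / (pprod us (z n) / z n ^ length us))) \<longlonglongrightarrow> 1" by simp
  moreover have "eventually (\<lambda>n. q (z (Suc n)) / q (z n) *
      (pprod vs (z n) / z n ^ length vs / (pprod us (z n) / z n ^ length us)) =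
       exp \<delta> * z n ^ length us / z n ^ length vs) sequentially"
    using ev
  proof eventually_elim
    case (elim n)
    have e: "z (Suc n) = z n + 1" by (simp add: z_def)
    have 1: "rgprod us (z n) = pprod us (z n) * rgprod us (z (Suc n))" for us
      unfolding e by (rule rgprod_plus1)
    have 2: "exp (\<delta> * z (Suc n)) = exp (\<delta> * z n) * exp \<delta>" unfolding e by (simp add: ring_distribs exp_add)
    from elim 1[of us] 1[of vs] have "pprod us (z n) \<noteq> 0" "pprod vs (z n) \<noteq> 0"
       "rgprod us (z (Suc n)) \<noteq> 0" "rgprod vs (z (Suc n)) \<noteq> 0" by auto
    thus ?case using elim unfolding q_def 2 1[of us] 1[of vs] by (simp add: field_simps)
  qed
  ultimately have lim2: "(\<lambda>n. exp \<delta> * z n ^ length us / z n ^ length vs) \<longlonglongrightarrow> 1"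
    by (rule Lim_transform_eventually)
  show len: "length us = length vs"
  proof (rule ccontr)
    assume "length us \<noteq> length vs"
    then consider "length us < length vs" | "length vs < length us" by linarith
    thus False
    proof cases
      case 1
      have "(\<lambda>n. exp \<delta> * inverse (z n ^ (length vs - length us))) \<longlonglongrightarrow> exp \<delta> * 0"
        using 1 by (intro tendsto_mult tendsto_const filterlim_compose[OF tendsto_inverse_0] 
           Limits.filterlim_power_at_infinity zinf) auto
      moreover have "eventually (\<lambda>n. exp \<delta> * inverse (z n ^ (length vs - length us)) =
          exp \<delta> * z n ^ length us / z n ^ length vs) sequentially"
        using ev by eventually_elim (use 1 in \<open>simp add: power_diff field_simps\<close>)
      ultimately have "(\<lambda>n. exp \<delta> * z n ^ length us / z n ^ length vs) \<longlonglongrightarrow> exp \<delta> * 0"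
        by (rule Lim_transform_eventually)
      from LIMSEQ_unique[OF this lim2] show False by simp
    next
      case 2
      have "filterlim (\<lambda>n. exp \<delta> * (z n ^ (length us - length vs))) at_infinity sequentially"
        using 2 by (intro tendsto_mult_filterlim_at_infinity[OF tendsto_const] Limits.filterlim_power_at_infinity zinf) auto
      moreover have ev': "eventually (\<lambda>n. exp \<delta> * (z n ^ (length us - length vs)) =
          exp \<delta> * z n ^ length us / z n ^ length vs) sequentially"
        using ev by eventually_elim (use 2 in \<open>simp add: power_diff field_simps\<close>)
      ultimately have "filterlim (\<lambda>n. exp \<delta> * z n ^ length us / z n ^ length vs) at_infinity sequentially"
        by (simp only: filterlim_cong[OF refl refl ev'])
      thus False using lim2 not_tendsto_and_filterlim_at_infinity[OF sequentially_bot] by blast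
    qed
  qed
  have "(\<lambda>n. exp \<delta>) \<longlonglongrightarrow> 1"
    by (rule Lim_transform_eventually[OF lim2], use ev in eventually_elim) (simp add: len)
  thus e1: "exp \<delta> = 1" by (rule LIMSEQ_unique[OF tendsto_const])
  have eq: "exp (\<delta> * (w0 + of_nat n)) = exp (\<delta> * w0)" for n
    using e1 by (simp add: ring_distribs exp_add exp_of_nat_mult mult.commute[of \<delta> "of_nat n"])
  have limS: "(\<lambda>n. q (w0 + of_nat (Suc n))) \<longlonglongrightarrow> l"
    using lim by (simp add: filterlim_sequentially_Suc[where f = "\<lambda>n. q (w0 + of_nat n)"] del: of_nat_Suc)
  define gu where "gu = growth (length us) (of_nat (length us) * w0 + sum_list us)"
  define gv where "gv = growth (length vs) (of_nat (length vs) * w0 + sum_list vs)"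
  note tendsto_divide[OF tendsto_mult[OF limS rgprod_shift_asymp[of us w0, folded gu_def]] rgprod_shift_asymp[of vs w0, folded gv_def]]
  from tendsto_mult[OF this tendsto_const[of "exp (- \<delta> * w0)"]]
  have "(\<lambda>n. q (w0 + of_nat (Suc n)) * (rgprod us (w0 + of_nat (Suc n)) * gu n) /
         (rgprod vs (w0 + of_nat (Suc n)) * gv n) * exp (- \<delta> * w0)) \<longlonglongrightarrow> l * exp (- \<delta> * w0)" by simp
  moreover have "eventually (\<lambda>n. q (w0 + of_nat (Suc n)) * (rgprod us (w0 + of_nat (Suc n)) * gu n) /
         (rgprod vs (w0 + of_nat (Suc n)) * gv n) * exp (- \<delta> * w0) =
         exp ((sum_list us - sum_list vs) * of_real (ln (of_nat n)))) sequentially"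
    using eventually_sequentially_Suc[THEN iffD2, OF eventually_rgprod_shift_nonzero[of us w0]]
          eventually_sequentially_Suc[THEN iffD2, OF eventually_rgprod_shift_nonzero[of vs w0]]
  proof eventually_elim
    case (elim n)
    have "growth 0 (sum_list us - sum_list vs) n * gv n = gu n"
      unfolding gu_def gv_def growth_add len by (simp add: add_ac)
    hence 1: "gu n = gv n * exp ((sum_list us - sum_list vs) * of_real (ln (of_nat n)))"
      by (simp add: growth_def mult.commute)
    have 2: "exp (\<delta> * w0) * exp (- \<delta> * w0) = 1" by (simp flip: exp_add)
    have *: "E * (V / U) * (U * (A * D)) / (V * A) * E' = D"
      if "E * E' = 1" "U \<noteq> 0" "V \<noteq> 0" "A \<noteq> 0" for E E' U V A D :: complex
      using that by (simp add: field_simps)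
    show ?case unfolding q_def eq 1 using elim 2
      by (intro *) (auto simp: gv_def simp del: of_nat_Suc)
  qed
  ultimately have "(\<lambda>n. exp ((sum_list us - sum_list vs) * of_real (ln (of_nat n)))) \<longlonglongrightarrow> l * exp (- \<delta> * w0)"
    by (rule Lim_transform_eventually)
  hence "sum_list us - sum_list vs = 0" by (rule exp_times_ln_limit_imp_0) (use l in auto)
  thus "sum_list us = sum_list vs" by simp
qed

lemma rgprod_ratio_shift_tendsto_1:
  assumes "length us = length vs" "sum_list us = sum_list vs"
  shows "(\<lambda>n. rgprod vs (w + of_nat n) / rgprod us (w + of_nat n)) \<longlonglongrightarrow> 1"
proof -
  from tendsto_divide[OF rgprod_shift_asymp[of vs w] rgprod_shift_asymp[of us w]]
  have "(\<lambda>n. rgprod vs (w + of_nat (Suc n)) / rgprod us (w + of_nat (Suc n))) \<longlonglongrightarrow> 1"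
    by (simp add: assms)
  thus ?thesis by (subst Lim_Suc_shift[where f = "\<lambda>w. rgprod vs w / rgprod us w"])
qed

section \<open>Uniform bounds for balanced quotients on a half plane\<close>

lemma sum_list_norm_nonneg: "(\<Sum>u\<leftarrow>us. norm (u::complex)) \<ge> 0" "(\<Sum>u\<leftarrow>us. (norm (u::complex))\<^sup>2) \<ge> 0"
  by (induction us) auto

lemma pprod_exp_approx:
  assumes "\<And>u. u \<in> set us \<Longrightarrow> 2 * norm u \<le> norm z" "z \<noteq> 0"
  obtains L where "pprod us z = z ^ length us * exp L"
    "norm (L - sum_list us / z) \<le> 2 * (\<Sum>u\<leftarrow>us. (norm u)\<^sup>2) / (norm z)\<^sup>2"
  using assms(1)
proof (induction us arbitrary: thesis)
  case Nil
  show ?case by (rule Nil.prems(1)[of 0]) auto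
next
  case (Cons u us)
  obtain L where L: "pprod us z = z ^ length us * exp L"
    "norm (L - sum_list us / z) \<le> 2 * (\<Sum>u\<leftarrow>us. (norm u)\<^sup>2) / (norm z)\<^sup>2"
    using Cons.IH Cons.prems(2) by (metis list.set_intros(2))
  define t where "t = u / z"
  have nt: "norm t \<le> 1/2" using Cons.prems(2)[of u] assms(2) by (simp add: t_def norm_divide field_simps)
  have nz: "1 + t \<noteq> 0"
  proof
    assume "1 + t = 0"
    hence "t = -1" by (simp add: eq_neg_iff_add_eq_0 add.commute)
    thus False using nt by simp
  qed
  have "norm (Ln (1 + t) - t) \<le> norm t ^ 2 / (1 - norm t)" using nt by (intro Ln_approx_linear) auto
  also have "\<dots> \<le> norm t ^ 2 / (1/2)" using nt by (intro divide_left_mono) auto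
  also have "\<dots> = 2 * (norm u)\<^sup>2 / (norm z)\<^sup>2" by (simp add: t_def norm_divide power_divide)
  finally have b: "norm (Ln (1 + t) - t) \<le> 2 * (norm u)\<^sup>2 / (norm z)\<^sup>2" .
  show ?case
  proof (rule Cons.prems(1)[of "Ln (1 + t) + L"])
    have "z + u = z * (1 + t)" using assms(2) by (simp add: t_def field_simps)
    thus "pprod (u # us) z = z ^ length (u # us) * exp (Ln (1 + t) + L)"
      using nz by (simp add: L(1) exp_add)
    have "Ln (1 + t) + L - sum_list (u # us) / z = (Ln (1 + t) - t) + (L - sum_list us / z)"
      by (simp add: t_def add_divide_distrib)
    hence "norm (Ln (1 + t) + L - sum_list (u # us) / z) \<le> norm (Ln (1 + t) - t) + norm (L - sum_list us / z)"
      by (simp only: norm_triangle_ineq)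
    also have "\<dots> \<le> 2 * (norm u)\<^sup>2 / (norm z)\<^sup>2 + 2 * (\<Sum>u\<leftarrow>us. (norm u)\<^sup>2) / (norm z)\<^sup>2"
      by (intro add_mono b L)
    finally show "norm (Ln (1 + t) + L - sum_list (u # us) / z) \<le> 2 * (\<Sum>u\<leftarrow>u # us. (norm u)\<^sup>2) / (norm z)\<^sup>2"
      by (simp add: add_divide_distrib ring_distribs)
  qed
qed

text \<open>For balanced lists the leading terms and the terms in \<open>1 / w\<close> cancel, so a
  step from \<open>w\<close> to \<open>w + 1\<close> changes the quotient by a factor
  \<open>exp (O (1 / (norm w)^2))\<close>. Along \<open>w, w + 1, ...\<close> these errors add up to
  at most \<open>M * pi^2 / 6\<close>, uniformly in \<open>w\<close>, and the quotient tends to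
  1.\<close>

lemma rgprod_ratio_bounded:
  assumes len: "length us = length vs" and sum: "sum_list us = sum_list vs"
  obtains R B where "R > 0" "\<And>w. Re w \<ge> R \<Longrightarrow> rgprod us w \<noteq> 0"
    "\<And>w. Re w \<ge> R \<Longrightarrow> norm (rgprod vs w / rgprod us w) \<le> B"
proof -
  obtain R1 where R1: "\<And>w. Re w \<ge> R1 \<Longrightarrow> rgprod us w \<noteq> 0" using rgprod_nonzero_right by blast
  define M where "M = 2 * (\<Sum>u\<leftarrow>us. (norm u)\<^sup>2) + 2 * (\<Sum>u\<leftarrow>vs. (norm u)\<^sup>2)"
  have M0: "M \<ge> 0" using sum_list_norm_nonneg(2)[of us] sum_list_norm_nonneg(2)[of vs] by (simp add: M_def)
  \<comment> \<open>The entry 1 gives \<open>norm (w + n) \<ge> n + 1\<close>, hence a summable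
    error; the last entry makes every parameter at most half of \<open>norm w\<close>, as the
    logarithmic expansion requires.\<close>
  define R where "R = Max {1, R1, 2 * (\<Sum>u\<leftarrow>us. norm u) + 2 * (\<Sum>u\<leftarrow>vs. norm u)}"
  have R: "R \<ge> 1" "R \<ge> R1" "R \<ge> 2 * (\<Sum>u\<leftarrow>us. norm u) + 2 * (\<Sum>u\<leftarrow>vs. norm u)" by (auto simp: R_def)
  note mem = norm_le_sum_list_norm
  define q where "q = (\<lambda>w. rgprod vs w / rgprod us w)"
  have step: "norm (q w) \<le> exp (M / (norm w)\<^sup>2) * norm (q (w + 1))"
    if w: "Re w \<ge> R" for w
  proof -
    have nw: "norm w \<ge> R" using w abs_Re_le_cmod[of w] by linarith
    hence w0: "w \<noteq> 0" using R by auto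
    have *: "2 * norm u \<le> norm w" if "u \<in> set us \<union> set vs" for u
      using that mem[of u us] mem[of u vs] R(3) nw sum_list_norm_nonneg(1)[of us] sum_list_norm_nonneg(1)[of vs] by auto
    obtain L1 where L1: "pprod us w = w ^ length us * exp L1"
      "norm (L1 - sum_list us / w) \<le> 2 * (\<Sum>u\<leftarrow>us. (norm u)\<^sup>2) / (norm w)\<^sup>2"
      using pprod_exp_approx[of us w] * w0 by auto
    obtain L2 where L2: "pprod vs w = w ^ length vs * exp L2"
      "norm (L2 - sum_list vs / w) \<le> 2 * (\<Sum>u\<leftarrow>vs. (norm u)\<^sup>2) / (norm w)\<^sup>2"
      using pprod_exp_approx[of vs w] * w0 by auto
    have "q w = exp (L2 - L1) * (q (w + 1))"
      using w0 by (simp add: q_def rgprod_plus1[of vs w] rgprod_plus1[of us w] L1 L2 len exp_diff)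
    moreover have "norm (exp (L2 - L1)) \<le> exp (M / (norm w)\<^sup>2)"
    proof -
      have "norm (exp (L2 - L1)) \<le> exp (norm (L2 - L1))" by (rule norm_exp)
      also have "norm (L2 - L1) \<le> M / (norm w)\<^sup>2"
      proof -
        have "norm ((L2 - sum_list vs / w) - (L1 - sum_list us / w)) \<le>
           2 * (\<Sum>u\<leftarrow>vs. (norm u)\<^sup>2) / (norm w)\<^sup>2 + 2 * (\<Sum>u\<leftarrow>us. (norm u)\<^sup>2) / (norm w)\<^sup>2"
          by (rule order_trans[OF norm_triangle_ineq4]) (intro add_mono L1 L2)
        also have "(L2 - sum_list vs / w) - (L1 - sum_list us / w) = L2 - L1" by (simp add: sum)
        finally show ?thesis by (simp add: M_def add_divide_distrib)
      qed
      finally show ?thesis by simp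
    qed
    ultimately show ?thesis by (simp only: norm_mult) (intro mult_right_mono, auto)
  qed
  have bound: "norm (q w) \<le>
      exp (M * (\<Sum>k<n. 1 / (real k + 1)\<^sup>2)) * norm (q (w + of_nat n))"
    if w: "Re w \<ge> R" for w n
  proof (induction n)
    case (Suc n)
    have "norm (q (w + of_nat n)) \<le>
       exp (M / (norm (w + of_nat n))\<^sup>2) * norm (q (w + of_nat n + 1))"
      by (rule step) (use w in auto)
    also have "\<dots> \<le> exp (M * (1 / (real n + 1)\<^sup>2)) * norm (q (w + of_nat n + 1))"
    proof (intro mult_right_mono norm_ge_zero)
      have "real n + 1 \<le> norm (w + of_nat n)"
        using w R(1) abs_Re_le_cmod[of "w + of_nat n"] by simp
      hence "M / (norm (w + of_nat n))\<^sup>2 \<le> M / (real n + 1)\<^sup>2"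
        using M0 by (intro divide_left_mono power_mono mult_pos_pos) auto
      thus "exp (M / (norm (w + of_nat n))\<^sup>2) \<le> exp (M * (1 / (real n + 1)\<^sup>2))" by simp
    qed
    finally have "norm (q (w + of_nat n)) \<le>
      exp (M * (1 / (real n + 1)\<^sup>2)) * norm (q (w + of_nat (Suc n)))"
      by (simp add: add_ac)
    hence "exp (M * (\<Sum>k<n. 1 / (real k + 1)\<^sup>2)) * norm (q (w + of_nat n))
       \<le> exp (M * (\<Sum>k<n. 1 / (real k + 1)\<^sup>2)) * (exp (M * (1 / (real n + 1)\<^sup>2)) * norm (q (w + of_nat (Suc n))))"
      by (intro mult_left_mono) auto
    also have "\<dots> = exp (M * (\<Sum>k<Suc n. 1 / (real k + 1)\<^sup>2)) * norm (q (w + of_nat (Suc n)))"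
      by (simp only: sum.lessThan_Suc ring_distribs exp_add mult.assoc)
    finally show ?case using Suc by linarith
  qed simp
  show ?thesis
  proof (rule that)
    show "R > 0" using R by simp
    show "rgprod us w \<noteq> 0" if "Re w \<ge> R" for w using that R R1 by auto
    show "norm (rgprod vs w / rgprod us w) \<le> exp (M * (pi\<^sup>2 / 6))" if w: "Re w \<ge> R" for w
    proof -
      have "(\<lambda>n. exp (M * (pi\<^sup>2 / 6)) * norm (q (w + of_nat n)))
              \<longlonglongrightarrow> exp (M * (pi\<^sup>2 / 6)) * norm (1::complex)"
        unfolding q_def by (intro tendsto_mult tendsto_const tendsto_norm rgprod_ratio_shift_tendsto_1 assms)
      moreover have "norm (q w) \<le>
          exp (M * (pi\<^sup>2 / 6)) * norm (q (w + of_nat n))" for n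
      proof -
        have "(\<Sum>k<n. 1 / (real k + 1)\<^sup>2) \<le> (\<Sum>k. 1 / (real k + 1)\<^sup>2)"
          by (rule sum_le_suminf) (use inverse_squares_sums in \<open>auto simp: sums_iff add_ac\<close>)
        also have "\<dots> = pi\<^sup>2 / 6" using inverse_squares_sums by (simp add: sums_iff add_ac)
        finally have "exp (M * (\<Sum>k<n. 1 / (real k + 1)\<^sup>2)) \<le> exp (M * (pi\<^sup>2 / 6))"
          using M0 by (subst exp_le_cancel_iff, intro mult_left_mono)
        thus ?thesis using bound[OF w, of n] by (meson mult_right_mono norm_ge_zero order_trans)
      qed
      ultimately have "norm (q w) \<le> exp (M * (pi\<^sup>2 / 6)) * norm (1::complex)"
        by (intro LIMSEQ_le_const) auto
      thus ?thesis by (simp add: q_def)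
    qed
  qed
qed

section \<open>Bounded holomorphic functions on a half plane\<close>

text \<open>Removal of one Blaschke factor: after the zero is moved to the origin, the Schwarz lemma
  says that division by the variable does not increase the bound.\<close>

lemma bounded_disc_divide_zero:
  assumes holf: "f holomorphic_on ball 0 1" and B: "\<And>z. norm z < 1 \<Longrightarrow> norm (f z) \<le> B"
    and a: "norm a < 1" "f a = 0"
  obtains g where "g holomorphic_on ball 0 1" "\<And>z. norm z < 1 \<Longrightarrow> norm (g z) \<le> B"
    "\<And>z. norm z < 1 \<Longrightarrow> f z = Moebius_function 0 a z * g z"
proof -
  have inb: "norm (Moebius_function 0 w z) < 1" if "norm w < 1" "norm z < 1" for w z
    using Moebius_function_norm_lt_1 that by blast
  have inv: "Moebius_function 0 w (Moebius_function 0 (-w) z) = z" if "norm w < 1" "norm z < 1" for w z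
    using Moebius_function_compose[of w "-w" z] that by simp
  define F where "F = f \<circ> Moebius_function 0 (-a)"
  have holF: "F holomorphic_on ball 0 1" unfolding F_def
    by (rule holomorphic_on_compose_gen[OF Moebius_function_holomorphic holf]) (use a inb in auto)
  have F0: "F 0 = 0" using a by (simp add: F_def Moebius_function_of_zero)
  obtain h where h: "h holomorphic_on ball 0 1" "\<And>z. norm z < 1 \<Longrightarrow> F z = z * h z" "deriv F 0 = h 0"
    using Schwarz3[OF holF F0] by blast
  have B0: "B \<ge> 0" using order_trans[OF norm_ge_zero B[of 0]] by simp
  have hB: "norm (h z) \<le> B" if z: "norm z < 1" for z
  proof (rule field_le_epsilon)
    fix e :: real assume e: "e > 0"
    \<comment> \<open>The Schwarz lemma wants a strict bound by 1. Scaling by \<open>B + e\<close>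
      provides it, also when \<open>B = 0\<close>; at the end \<open>e\<close> is arbitrary.\<close>
    define B' where "B' = B + e"
    have B': "B' > 0" "B < B'" using B0 e by (auto simp: B'_def)
    define F' where "F' = (\<lambda>z. F z / of_real B')"
    have hol': "F' holomorphic_on ball 0 1" unfolding F'_def by (intro holomorphic_intros holF) (use B' in auto)
    have no: "norm (F' z) < 1" if "norm z < 1" for z
    proof -
      have "norm (F z) \<le> B" unfolding F_def using B inb[of "-a" z] a that by simp
      thus ?thesis using B' by (simp add: F'_def norm_divide)
    qed
    have dF: "deriv F' 0 = h 0 / of_real B'"
    proof -
      have "(F has_field_derivative h 0) (at 0)"
        using holF h(3) by (metis centre_in_ball holomorphic_derivI open_ball zero_less_one)
      hence "(F' has_field_derivative h 0 / of_real B') (at 0)"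
        unfolding F'_def by (rule DERIV_cdivide)
      thus ?thesis by (rule DERIV_imp_deriv)
    qed
    have F'0: "F' 0 = 0" using F0 by (simp add: F'_def)
    have "norm (h z) \<le> B'"
    proof (cases "z = 0")
      case True
      have "norm (deriv F' 0) \<le> 1" by (rule Schwarz_Lemma(2)[OF hol' F'0 no]) (use z in auto)
      thus ?thesis using B' True unfolding dF by (simp add: norm_divide divide_simps)
    next
      case False
      have "norm (F' z) \<le> norm z" by (rule Schwarz_Lemma(1)[OF hol' F'0 no]) (use z in auto)
      thus ?thesis using B' False h(2)[OF z] unfolding F'_def by (simp add: norm_divide norm_mult divide_simps)
    qed
    thus "norm (h z) \<le> B + e" by (simp add: B'_def)
  qed
  show ?thesis
  proof (rule that)
    show "(h \<circ> Moebius_function 0 a) holomorphic_on ball 0 1"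
      by (rule holomorphic_on_compose_gen[OF Moebius_function_holomorphic h(1)]) (use a inb in auto)
    show "norm ((h \<circ> Moebius_function 0 a) z) \<le> B" if "norm z < 1" for z
      using hB inb[of a z] a that by simp
    show "f z = Moebius_function 0 a z * (h \<circ> Moebius_function 0 a) z" if "norm z < 1" for z
    proof -
      have "F (Moebius_function 0 a z) = Moebius_function 0 a z * h (Moebius_function 0 a z)"
        using h(2) inb[of a z] a that by simp
      moreover have "F (Moebius_function 0 a z) = f z"
        using inv[of "-a" z] a that by (simp add: F_def)
      ultimately show ?thesis by simp
    qed
  qed
qed

text \<open>Zeros are divided out one after the other without loss in the bound; at the origin the
  Moebius factor of \<open>a\<close> has modulus \<open>norm a\<close>.\<close>

lemma bounded_disc_norm_0_le_prod:
  assumes "finite A" "f holomorphic_on ball 0 1" "\<And>z. norm z < 1 \<Longrightarrow> norm (f z) \<le> B"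
    "\<And>a. a \<in> A \<Longrightarrow> norm a < 1 \<and> f a = 0"
  shows "norm (f 0) \<le> B * (\<Prod>a\<in>A. norm a)"
  using assms
proof (induction A arbitrary: f rule: finite_induct)
  case empty
  thus ?case by simp
next
  case (insert a A)
  obtain g where g: "g holomorphic_on ball 0 1" "\<And>z. norm z < 1 \<Longrightarrow> norm (g z) \<le> B"
    "\<And>z. norm z < 1 \<Longrightarrow> f z = Moebius_function 0 a z * g z"
    using bounded_disc_divide_zero[of f B a] insert.prems by auto
  have "norm (g 0) \<le> B * (\<Prod>a\<in>A. norm a)"
  proof (rule insert.IH[OF g(1,2)])
    fix c assume c: "c \<in> A"
    have nc: "norm c < 1" "f c = 0" "norm a < 1" using c insert.prems by auto
    have "c \<noteq> a" using c insert.hyps by auto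
    moreover have "1 - cnj a * c \<noteq> 0"
    proof
      assume "1 - cnj a * c = 0"
      hence "norm (cnj a * c) = 1" by (metis diff_eq_diff_eq diff_self norm_one right_minus_eq)
      moreover have "norm a * norm c < 1 * 1"
        using nc by (intro mult_strict_mono') auto
      ultimately show False by (simp add: norm_mult)
    qed
    ultimately have "Moebius_function 0 a c \<noteq> 0" by (simp add: Moebius_function_simple)
    with g(3)[OF nc(1)] nc show "norm c < 1 \<and> g c = 0" by simp
  qed
  hence "norm a * norm (g 0) \<le> norm a * (B * (\<Prod>a\<in>A. norm a))" by (intro mult_left_mono) auto
  moreover have "norm (f 0) = norm a * norm (g 0)"
    using g(3)[of 0] by (simp add: Moebius_function_of_zero norm_mult)
  ultimately show ?case using insert.hyps by (simp add: mult_ac)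
qed

text \<open>Carry the half plane to the disc with \<open>z\<close> going to 0. The zeros \<open>z0 + n\<close> then have moduli at most \<open>1 - c/n\<close>,
  violating the Blaschke condition, so the product bound for \<open>f z\<close> tends to 0.\<close>
lemma bounded_half_plane_eq_0:
  fixes f :: "complex \<Rightarrow> complex"
  assumes hol: "f holomorphic_on {z. Re z > R}" and B: "\<And>z. Re z > R \<Longrightarrow> norm (f z) \<le> B"
    and zeros: "\<And>n::nat. f (z0 + of_nat n) = 0" and z0: "Re z0 > R" and z: "Re z > R"
  shows "f z = 0"
proof -
  define X where "X = Re z - R"
  have X: "X > 0" using z by (simp add: X_def)
  \<comment> \<open>The Moebius map from the disc to the half plane with \<open>m 0 = z\<close>. The
    points \<open>a n\<close> below are its preimages of \<open>z0 + n\<close>.\<close>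
  define m where "m = (\<lambda>\<zeta>. (z + (cnj z - 2 * of_real R) * \<zeta>) / (1 - \<zeta>))"
  have nz1: "1 - \<zeta> \<noteq> 0" if "norm \<zeta> < 1" for \<zeta> :: complex using that by auto
  have m_in: "Re (m \<zeta>) > R" if "norm \<zeta> < 1" for \<zeta>
  proof -
    have "m \<zeta> - of_real R = ((z - of_real R) + cnj (z - of_real R) * \<zeta>) / (1 - \<zeta>)"
      using nz1[OF that] by (simp add: m_def field_simps)
    hence "m \<zeta> - of_real R = ((z - of_real R) + cnj (z - of_real R) * \<zeta>) * cnj (1 - \<zeta>) / of_real ((norm (1 - \<zeta>))\<^sup>2)"
      by (subst (asm) complex_div_cnj) simp
    hence "Re (m \<zeta>) - R = Re (((z - of_real R) + cnj (z - of_real R) * \<zeta>) * cnj (1 - \<zeta>)) / (norm (1 - \<zeta>))\<^sup>2"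
      by (metis Re_complex_of_real Re_divide_of_real minus_complex.simps(1))
    also have "Re (((z - of_real R) + cnj (z - of_real R) * \<zeta>) * cnj (1 - \<zeta>)) = X * (1 - (norm \<zeta>)\<^sup>2)"
      unfolding cmod_power2 X_def by (simp add: algebra_simps power2_eq_square)
    also have "\<dots> / (norm (1 - \<zeta>))\<^sup>2 > 0"
      using X that nz1[OF that] by (intro divide_pos_pos mult_pos_pos) (auto simp: power_less_one_iff abs_square_less_1)
    finally show ?thesis by simp
  qed
  define F where "F = f \<circ> m"
  have "m holomorphic_on ball 0 1" unfolding m_def by (intro holomorphic_intros) auto
  hence holF: "F holomorphic_on ball 0 1" unfolding F_def
    by (rule holomorphic_on_compose_gen[OF _ hol]) (use m_in in auto)
  define a where "a = (\<lambda>n::nat. (z0 + of_nat n - z) / (z0 + of_nat n + cnj z - 2 * of_real R))"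
  define Y where "Y = (\<lambda>n::nat. Re z0 - R + real n)"
  have Y: "Y n > 0" for n using z0 by (simp add: Y_def)
  have den: "z0 + of_nat n + cnj z - 2 * of_real R \<noteq> 0" for n
  proof -
    have "Re (z0 + of_nat n + cnj z - 2 * of_real R) = Y n + X" by (simp add: X_def Y_def)
    thus ?thesis using X Y[of n] by (metis add_pos_pos less_irrefl zero_complex.simps(1))
  qed
  have norm_a: "(norm (a n))\<^sup>2 = 1 - 4 * X * Y n / (norm (z0 + of_nat n + cnj z - 2 * of_real R))\<^sup>2" for n
  proof -
    have "(norm (z0 + of_nat n - z))\<^sup>2 = (norm (z0 + of_nat n + cnj z - 2 * of_real R))\<^sup>2 - 4 * X * Y n"
      unfolding cmod_power2 X_def Y_def by (simp add: algebra_simps power2_eq_square)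
    thus ?thesis unfolding a_def norm_divide power_divide using den[of n]
      by (simp add: diff_divide_distrib[of "_ :: real"])
  qed
  have a1: "norm (a n) < 1" for n
  proof -
    have "4 * X * Y n / (norm (z0 + of_nat n + cnj z - 2 * of_real R))\<^sup>2 > 0"
      using X Y[of n] den[of n] by (intro divide_pos_pos mult_pos_pos) auto
    hence "(norm (a n))\<^sup>2 < 1" using norm_a[of n] by linarith
    thus ?thesis by (simp add: abs_square_less_1)
  qed
  have ma: "m (a n) = z0 + of_nat n" for n
  proof -
    define W where "W = z0 + of_nat n"
    define D where "D = W + cnj z - 2 * of_real R"
    have D: "D \<noteq> 0" using den[of n] by (simp add: D_def W_def)
    have an: "a n = (W - z) / D" by (simp add: a_def W_def D_def)
    have XX: "D - (W - z) \<noteq> 0"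
    proof -
      have "Re (D - (W - z)) = 2 * X" by (simp add: D_def X_def)
      thus ?thesis using X by (metis less_irrefl mult_pos_pos zero_complex.simps(1) zero_less_numeral)
    qed
    have "1 - (W - z) / D = (D - (W - z)) / D"
         "z + (cnj z - 2 * of_real R) * ((W - z) / D) = (z * D + (cnj z - 2 * of_real R) * (W - z)) / D"
      using D by (simp_all add: field_simps)
    hence "m (a n) = (z * D + (cnj z - 2 * of_real R) * (W - z)) / D / ((D - (W - z)) / D)"
      unfolding m_def an by (simp only:)
    also have "\<dots> = (z * D + (cnj z - 2 * of_real R) * (W - z)) / (D - (W - z))"
      using D by simp
    also have "z * D + (cnj z - 2 * of_real R) * (W - z) = W * (D - (W - z))"
      by (simp add: D_def algebra_simps)
    finally show ?thesis using XX by (simp add: W_def)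
  qed
  have inj: "inj a"
  proof (rule injI)
    fix i j assume "a i = a j"
    hence "m (a i) = m (a j)" by simp
    thus "i = j" by (simp add: ma)
  qed
  define K where "K = norm z0 + norm z + 2 * \<bar>R\<bar> + 1"
  have K: "K \<ge> 1" by (simp add: K_def)
  \<comment> \<open>In the formula for \<open>(norm (a n))^2\<close> the factor \<open>Y n\<close>
    is at least \<open>min 1 (Re z0 - R) * (n + 1)\<close> and the denominator at most
    \<open>(K * (n + 1))^2\<close>. So the square falls short of 1 by at least
    \<open>2 * c / (n + 1)\<close>, and these defects sum to a divergent harmonic series.\<close>
  define c where "c = 2 * X * min 1 (Re z0 - R) / K\<^sup>2"
  have c: "c > 0" using X z0 K by (simp add: c_def)
  have a_le: "norm (a n) \<le> exp (- c * inverse (real n + 1))" for n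
  proof -
    have "norm (z0 + of_nat n + cnj z - 2 * of_real R) \<le> norm z0 + real n + norm z + 2 * \<bar>R\<bar>"
      by (rule order_trans[OF norm_triangle_ineq4] order_trans[OF norm_triangle_ineq] add_mono)+ (auto simp: norm_mult)
    also have "\<dots> \<le> K * (real n + 1)" using K by (simp add: K_def algebra_simps)
    finally have nb: "(norm (z0 + of_nat n + cnj z - 2 * of_real R))\<^sup>2 \<le> (K * (real n + 1))\<^sup>2"
      by (intro power_mono) auto
    have Yb: "min 1 (Re z0 - R) * (real n + 1) \<le> Y n"
    proof -
      have "min 1 (Re z0 - R) * (real n + 1) = min 1 (Re z0 - R) * real n + min 1 (Re z0 - R)" by (simp add: algebra_simps)
      also have "\<dots> \<le> 1 * real n + (Re z0 - R)" by (intro add_mono mult_right_mono) auto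
      finally show ?thesis by (simp add: Y_def)
    qed
    have "2 * (c * inverse (real n + 1)) = 4 * X * (min 1 (Re z0 - R) * (real n + 1)) / (K * (real n + 1))\<^sup>2"
    proof -
      have "2 * (2 * X * \<mu> / K\<^sup>2 * inverse t) = 4 * X * (\<mu> * t) / (K * t)\<^sup>2" if "t \<noteq> 0" for \<mu> t :: real
        using K that by (simp add: field_simps power2_eq_square)
      thus ?thesis unfolding c_def by (simp add: add_pos_pos)
    qed
    also have "\<dots> \<le> 4 * X * Y n / (norm (z0 + of_nat n + cnj z - 2 * of_real R))\<^sup>2"
      using X Yb nb Y[of n] den[of n] K z0 by (intro frac_le mult_left_mono) auto
    finally have "(norm (a n))\<^sup>2 \<le> 1 + (- 2 * (c * inverse (real n + 1)))" using norm_a[of n] by simp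
    also have "\<dots> \<le> exp (- 2 * (c * inverse (real n + 1)))" by (rule exp_ge_add_one_self)
    also have "\<dots> = (exp (- c * inverse (real n + 1)))\<^sup>2" by (simp add: power2_eq_square flip: exp_add)
    finally show ?thesis by (rule power2_le_imp_le) simp
  qed
  have "norm (F 0) \<le> B * exp (- c * harm N)" for N
  proof -
    have B0: "B \<ge> 0" using order_trans[OF norm_ge_zero B[OF z]] by simp
    have "norm (F 0) \<le> B * (\<Prod>x\<in>a ` {..<N}. norm x)"
    proof (rule bounded_disc_norm_0_le_prod[OF _ holF])
      show "norm (F z) \<le> B" if "norm z < 1" for z using B m_in that by (simp add: F_def)
      fix x assume "x \<in> a ` {..<N}"
      thus "norm x < 1 \<and> F x = 0" using a1 ma zeros by (auto simp: F_def)
    qed simp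
    also have "(\<Prod>x\<in>a ` {..<N}. norm x) = (\<Prod>n<N. norm (a n))"
      by (subst prod.reindex) (use inj in \<open>auto simp: inj_on_def inj_def\<close>)
    also have "B * \<dots> \<le> B * (\<Prod>n<N. exp (- c * inverse (real n + 1)))"
      by (intro mult_left_mono prod_mono B0) (use a_le in auto)
    also have "(\<Prod>n<N. exp (- c * inverse (real n + 1))) = exp (- c * (\<Sum>n<N. inverse (real n + 1)))"
      by (subst exp_sum[symmetric]) (simp_all add: sum_distrib_left)
    also have "(\<Sum>n<N. inverse (real n + 1)) = harm N"
      by (induction N) (simp_all add: harm_Suc add_ac harm_def)
    finally show ?thesis .
  qed
  moreover have "(\<lambda>N. B * exp (- c * harm N)) \<longlonglongrightarrow> B * 0"
  proof (intro tendsto_mult tendsto_const filterlim_compose[OF exp_at_bot])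
    show "filterlim (\<lambda>N. - c * harm N) at_bot sequentially"
      using c by (intro filterlim_tendsto_neg_mult_at_bot[OF tendsto_const] harm_at_top) auto
  qed
  ultimately have "norm (F 0) \<le> B * 0"
    by (intro LIMSEQ_le_const) auto
  thus "f z = 0" by (simp add: F_def m_def)
qed

section \<open>Gauss's multiplication formula\<close>

lemma pprod_map_div:
  fixes e :: complex
  assumes "m > 0"
  shows "pprod (map (\<lambda>i. (e + of_nat i) / of_nat m) [0..<k]) w =
           pochhammer (of_nat m * w + e) k / of_nat m ^ k"
proof (induction k)
  case (Suc k)
  have "pprod (xs @ [y]) w = pprod xs w * (w + y)" for xs y by (induction xs) simp_all
  with Suc assms show ?case
    by (simp add: pochhammer_Suc field_simps)
qed simp

text \<open>Both sides obey the same recurrence under \<open>w\<close> to \<open>w + 1\<close>, so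
  their quotient is unchanged along \<open>w + n\<close>. Its behaviour at infinity is the same for
  all \<open>w\<close>, hence it is a constant. Only the existence of a nonzero \<open>C\<close> is
  asserted, because constants are later determined from limits.\<close>

lemma rGamma_multiplication:
  fixes e :: complex
  assumes m: "m > 0"
  obtains C where "C \<noteq> 0"
    "\<And>w. rGamma (of_nat m * w + e) = C * exp (- of_real (real m * ln (real m)) * w) *
       rgprod (map (\<lambda>i. (e + of_nat i) / of_nat m) [0..<m]) w"
proof -
  define L where "L = map (\<lambda>i. (e + of_nat i) / of_nat m) [0..<m]"
  have lenL: "length L = m" by (simp add: L_def)
  define \<delta> where "\<delta> = - complex_of_real (real m * ln (real m))"
  define X where "X = (\<lambda>w. rGamma (of_nat m * w + e))"
  define Y where "Y = (\<lambda>w. exp (\<delta> * w) * rgprod L w)"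
  have exp\<delta>: "exp \<delta> = inverse (of_nat m ^ m)"
  proof -
    have "exp (- (real m * ln (real m))) = inverse (real m ^ m)"
      using m by (simp add: exp_minus exp_of_nat_mult)
    hence "complex_of_real (exp (- (real m * ln (real m)))) = inverse (of_nat m ^ m)" by simp
    thus ?thesis by (simp add: \<delta>_def exp_of_real[symmetric] del: exp_of_real)
  qed
  define P where "P = (\<lambda>w. pochhammer (of_nat m * w + e) m)"
  have X1: "X w = P w * X (w + 1)" for w
    unfolding X_def P_def by (subst pochhammer_rGamma[of _ m]) (simp add: algebra_simps)
  have Y1: "Y w = P w * Y (w + 1)" for w
    unfolding Y_def P_def using m pprod_map_div[OF m, of e m w] exp\<delta>
    by (subst rgprod_plus1) (simp add: L_def ring_distribs exp_add divide_inverse mult_ac)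
  \<comment> \<open>Cross-multiplied, so that it also holds at zeros of \<open>Y\<close>.\<close>
  have XY: "X w * Y (w + of_nat n) = Y w * X (w + of_nat n)" for w n
  proof (induction n)
    case (Suc n)
    have *: "X w = P' * X (w + of_nat n) \<Longrightarrow> Y w = P' * Y (w + of_nat n) \<Longrightarrow> ?case" for P'
      by (simp add: X1[of "w + of_nat n"] Y1[of "w + of_nat n"] add_ac)
    have "\<exists>P'. X w = P' * X (w + of_nat n) \<and> Y w = P' * Y (w + of_nat n)" for n
    proof (induction n)
      case (Suc n)
      then obtain P' where "X w = P' * X (w + of_nat n)" "Y w = P' * Y (w + of_nat n)" by blast
      hence "X w = (P' * P (w + of_nat n)) * X (w + of_nat (Suc n))" "Y w = (P' * P (w + of_nat n)) * Y (w + of_nat (Suc n))"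
        by (simp_all add: X1[of "w + of_nat n"] Y1[of "w + of_nat n"] add_ac)
      thus ?case by blast
    qed (auto intro: exI[of _ 1])
    thus ?case using * by blast
  qed simp
  have evY: "eventually (\<lambda>n. Y (w + of_nat n) \<noteq> 0) sequentially" for w
    using eventually_rgprod_shift_nonzero[of L w] by eventually_elim (simp add: Y_def)
  \<comment> \<open>A shift of \<open>w\<close> by \<open>n + 1\<close> moves the argument
    \<open>m w + e\<close> by \<open>m (n + 1)\<close>, which has to be
    \<open>n' + 1\<close>.\<close>
  define n' where "n' = (\<lambda>n. m * n + (m - 1))"
  have n': "Suc (n' n) = m * Suc n" for n using m by (simp add: n'_def)
  have n'_lim: "filterlim n' at_top sequentially"
  proof (rule filterlim_at_top_mono[OF filterlim_ident[of at_top]])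
    have "n \<le> n' n" for n
    proof -
      have "1 * n \<le> m * n" using m by (intro mult_le_mono1) simp
      thus ?thesis unfolding n'_def by linarith
    qed
    thus "eventually (\<lambda>n. n \<le> n' n) sequentially" by simp
  qed
  \<comment> \<open>All factors of the two asymptotic formulas that do not involve \<open>w\<close>;
    the limit 1 of the product with \<open>c n\<close> is therefore the same for every
    \<open>w\<close>.\<close>
  define c where "c = (\<lambda>n. growth 1 e (n' n) * exp (\<delta> * of_nat (Suc n)) / growth m (sum_list L) n)"
  have lim: "(\<lambda>n. X (w + of_nat (Suc n)) / Y (w + of_nat (Suc n)) * c n) \<longlonglongrightarrow> 1" for w
  proof -
    define u where "u = of_nat m * w"
    have 1: "(\<lambda>n. rGamma (u + e + of_nat (Suc (n' n))) * growth 1 (u + e) (n' n)) \<longlonglongrightarrow> 1"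
      by (rule filterlim_compose[OF rGamma_shift_asymp n'_lim])
    define g where "g = (\<lambda>n. exp (u * of_real (ln (real (n' n)) - ln (real m) - ln (real n))))"
    have 2: "g \<longlonglongrightarrow> exp (u * of_real 0)"
      unfolding g_def
    proof (intro tendsto_intros)
      have "(\<lambda>n. ln (1 + real (m - 1) / real m * inverse (real n))) \<longlonglongrightarrow> ln (1 + real (m - 1) / real m * 0)"
        by (intro tendsto_intros lim_inverse_n) auto
      moreover have "eventually (\<lambda>n. ln (1 + real (m - 1) / real m * inverse (real n)) = ln (real (n' n)) - ln (real m) - ln (real n)) sequentially"
        using eventually_gt_at_top[of 0]
      proof eventually_elim
        case (elim n)
        have "real (n' n) = real m * real n * (1 + real (m - 1) / real m * inverse (real n))"
          using m elim by (simp add: n'_def field_simps)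
        moreover have "1 + real (m - 1) / real m * inverse (real n) > 0"
          by (intro add_pos_nonneg) auto
        ultimately show ?case using m elim by (simp add: ln_mult)
      qed
      ultimately show "(\<lambda>n. ln (real (n' n)) - ln (real m) - ln (real n)) \<longlonglongrightarrow> 0"
        by (auto dest: Lim_transform_eventually)
    qed
    from tendsto_divide[OF tendsto_divide[OF 1 rgprod_shift_asymp[of L w]] 2]
    have "(\<lambda>n. rGamma (u + e + of_nat (Suc (n' n))) * growth 1 (u + e) (n' n) /
        (rgprod L (w + of_nat (Suc n)) * growth m (u + sum_list L) n) / g n) \<longlonglongrightarrow> 1" by (simp add: lenL u_def)
    moreover have "rGamma (u + e + of_nat (Suc (n' n))) * growth 1 (u + e) (n' n) /
        (rgprod L (w + of_nat (Suc n)) * growth m (u + sum_list L) n) / g n =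
        X (w + of_nat (Suc n)) / Y (w + of_nat (Suc n)) * c n" for n
    proof -
      have a: "u + e + of_nat (Suc (n' n)) = of_nat m * (w + of_nat (Suc n)) + e"
        unfolding n' u_def by (simp add: algebra_simps)
      define A where "A = complex_of_real (ln (real (n' n)))"
      define B where "B = complex_of_real (ln (real n))"
      define D where "D = complex_of_real (ln (real m))"
      have \<delta>w: "\<delta> * (w + of_nat (Suc n)) = - u * D + \<delta> * of_nat (Suc n)"
        by (simp add: \<delta>_def u_def D_def ring_distribs)
      have g1: "growth 1 (u + e) (n' n) = exp (u * A) * growth 1 e (n' n)"
        "growth m (u + sum_list L) n = exp (u * B) * growth m (sum_list L) n"
        by (simp_all add: growth_def A_def B_def ring_distribs exp_add)
      have g2: "g n = exp (u * A) / (exp (u * D) * exp (u * B))"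
        by (simp add: g_def A_def B_def D_def ring_distribs exp_add exp_diff)
      have e4: "exp (- u * D + \<delta> * of_nat (Suc n)) = exp (\<delta> * of_nat (Suc n)) / exp (u * D)"
        by (simp add: exp_add exp_minus exp_diff field_simps)
      have *: "R * (UA * G) / (Q * (UB * G')) / (UA / (UD * UB)) = R / (DE / UD * Q) * (G * DE / G')"
        if "UA \<noteq> 0" "UB \<noteq> 0" "UD \<noteq> 0" "DE \<noteq> 0" for R UA G Q UB G' UD DE :: complex
        using that by (simp add: field_simps)
      show ?thesis unfolding a X_def Y_def c_def \<delta>w g1 g2 e4 by (rule *) auto
    qed
    ultimately show ?thesis by simp
  qed
  obtain R where R: "\<And>w. Re w \<ge> R \<Longrightarrow> rgprod L w \<noteq> 0" using rgprod_nonzero_right by blast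
  obtain R' where R': "\<And>w. Re w \<ge> R' \<Longrightarrow> rgprod [e] w \<noteq> 0" using rgprod_nonzero_right by blast
  define w1 where "w1 = complex_of_real (Max {0, R, R'})"
  have Y_nz: "Y (w1 + of_nat n) \<noteq> 0" for n by (auto simp: Y_def w1_def intro!: R)
  have X_nz: "X w1 \<noteq> 0"
  proof -
    have "Max {0, R, R'} \<le> real m * Max {0, R, R'}" using m by (intro mult_le_cancel_right1[THEN iffD2]) auto
    hence "R' \<le> real m * Max {0, R, R'}" by simp
    hence "rgprod [e] (of_nat m * w1) \<noteq> 0" by (intro R') (simp add: w1_def)
    thus ?thesis by (simp add: X_def)
  qed
  define C where "C = X w1 / Y w1"
  have C: "C \<noteq> 0" using X_nz Y_nz[of 0] by (simp add: C_def)
  have "X (w1 + of_nat n) / Y (w1 + of_nat n) = C" for n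
    using XY[of w1 n] Y_nz[of n] Y_nz[of 0] by (simp add: C_def field_simps)
  hence "(\<lambda>n. C * c n) \<longlonglongrightarrow> 1" using lim[of w1] by (simp del: of_nat_Suc)
  hence limc: "(\<lambda>n. C * c n / C) \<longlonglongrightarrow> 1 / C" using C by (intro tendsto_divide) auto
  have main: "X w = C * Y w" for w
  proof -
    have "(\<lambda>n. X (w + of_nat (Suc n)) / Y (w + of_nat (Suc n)) * c n / (C * c n / C)) \<longlonglongrightarrow> 1 / (1 / C)"
      by (intro tendsto_divide[OF lim limc]) (use C in auto)
    hence "(\<lambda>n. Y w * (X (w + of_nat (Suc n)) / Y (w + of_nat (Suc n)) * c n / (C * c n / C))) \<longlonglongrightarrow> Y w * (1 / (1 / C))"
      by (intro tendsto_mult tendsto_const)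
    moreover have "eventually (\<lambda>n. c n \<noteq> 0) sequentially"
    proof -
      have "eventually (\<lambda>n. C * c n \<noteq> 0) sequentially"
        using \<open>(\<lambda>n. C * c n) \<longlonglongrightarrow> 1\<close> by (rule tendsto_imp_eventually_ne) simp
      thus ?thesis by eventually_elim auto
    qed
    hence "eventually (\<lambda>n. Y w * (X (w + of_nat (Suc n)) / Y (w + of_nat (Suc n)) * c n / (C * c n / C)) = X w) sequentially"
      using eventually_sequentially_Suc[THEN iffD2, OF evY[of w]]
    proof eventually_elim
      case (elim n)
      thus ?case using XY[of w "Suc n"] C by (simp add: field_simps del: of_nat_Suc)
    qed
    ultimately have "(\<lambda>n. X w) \<longlonglongrightarrow> Y w * (1 / (1 / C))" by (rule Lim_transform_eventually)
    thus ?thesis using LIMSEQ_unique[OF _ tendsto_const] by (metis div_by_1 divide_divide_eq_right mult.commute mult_1)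
  qed
  show ?thesis
    by (rule that[OF C]) (use main in \<open>simp add: X_def Y_def \<delta>_def L_def mult.assoc\<close>)
qed

section \<open>The entire function \<open>F\<close> and the limit of \<open>f\<close>\<close>

locale hyp_params =
  fixes p r x :: real
  assumes p_pos: "0 < p" and p_less_r: "p < r" and x_pos: "0 < x" and x_less_1: "x < 1"
begin

lemma r_pos: "r > 0" using p_pos p_less_r by linarith

text \<open>Absorbing \<open>1 / \<Gamma>(r w)\<close> into the terms of \<open>f(w)\<close> removes the poles in the denominators \<open>(r w)\<^sub>n\<close>. The
  definition of \<open>f\<close> takes the junk value 0 at these poles, as \<open>Gamma\<close> does.\<close>
definition hterm :: "real \<Rightarrow> nat \<Rightarrow> complex \<Rightarrow> complex" where
  "hterm a n w = pochhammer (of_real p * w + of_real a) n * pochhammer (1/2) n *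
     rGamma (of_real r * w + of_nat n) / fact n * of_real x ^ n"

definition F :: "real \<Rightarrow> complex \<Rightarrow> complex" where "F a w = (\<Sum>n. hterm a n w)"

definition f :: "real \<Rightarrow> complex \<Rightarrow> complex" where "f a w = Gamma (of_real r * w) * F a w"

text \<open>Cross-multiplied, so that it remains valid where \<open>r w + n\<close>
  vanishes.\<close>

lemma hterm_Suc:
  "hterm a (Suc n) w * ((of_real r * w + of_nat n) * of_nat (Suc n)) =
   hterm a n w * ((of_real p * w + of_real a + of_nat n) * (1/2 + of_nat n) * of_real x)"
proof -
  have "rGamma (of_real r * w + of_nat n) = (of_real r * w + of_nat n) * rGamma (of_real r * w + of_nat (Suc n))"
    using rGamma_plus1[of "of_real r * w + of_nat n"] by (simp add: add_ac)
  moreover have "A * B * (P * C) * G / (S * f) * (y * X) * (R * S) = A * P * (R * G) / f * X * (B * C * y)"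
    if "S \<noteq> 0" for A B P C G S f y X R :: complex
    using that by (simp add: field_simps)
  moreover have "of_nat (Suc n) \<noteq> (0 :: complex)" by (simp del: of_nat_Suc)
  ultimately show ?thesis
    unfolding hterm_def pochhammer_Suc fact_Suc power_Suc by simp
qed

text \<open>On the disc of radius \<rho> the quotient of consecutive terms is at most
  \<open>x (n + A) / (n - B)\<close>, which tends to \<open>x\<close>. Here \<open>q\<close> is the
  midpoint of \<open>x\<close> and 1, and \<open>N\<close> is where
  \<open>x (n + A) \<le> q (n - B)\<close> begins to hold.\<close>

lemma hterm_ratio_bound:
  obtains q N where "q > 0" "q < 1"
    "\<And>n w. n \<ge> N \<Longrightarrow> norm w \<le> \<rho> \<Longrightarrow> norm (hterm a (Suc n) w) \<le> q * norm (hterm a n w)"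
proof -
  define q where "q = (1 + x) / 2"
  have q: "q > 0" "q < 1" "x < q" using x_pos x_less_1 by (auto simp: q_def)
  define A where "A = p * \<bar>\<rho>\<bar> + \<bar>a\<bar>"
  define B where "B = r * \<bar>\<rho>\<bar>"
  define N where "N = nat \<lceil>(x * A + q * B) / (q - x) + B + 1\<rceil>"
  have AB: "A \<ge> 0" "B \<ge> 0" using p_pos r_pos by (auto simp: A_def B_def)
  have *: "norm (hterm a (Suc n) w) \<le> q * norm (hterm a n w)" if n: "n \<ge> N" and w: "norm w \<le> \<rho>" for n w
  proof -
    have nN: "real n \<ge> (x * A + q * B) / (q - x) + B + 1" using n by (simp add: N_def) linarith
    have "(x * A + q * B) / (q - x) \<ge> 0" using q x_pos AB by (intro divide_nonneg_pos add_nonneg_nonneg) auto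
    hence nB: "real n - B \<ge> 1" and n1: "real n \<ge> (x * A + q * B) / (q - x)" using nN AB by linarith+
    hence "(q - x) * real n \<ge> x * A + q * B" using q by (simp add: field_simps)
    hence key: "x * (real n + A) \<le> q * (real n - B)" by (simp add: algebra_simps)
    have den: "norm (of_real r * w + of_nat n) \<ge> real n - B"
    proof -
      have "norm (of_real r * w) \<le> B" using w r_pos by (auto simp: norm_mult B_def intro!: mult_left_mono)
      moreover have "real n = norm ((of_real r * w + of_nat n) - of_real r * w)" by simp
      moreover have "\<dots> \<le> norm (of_real r * w + of_nat n) + norm (of_real r * w)" by (rule norm_triangle_ineq4)
      ultimately show ?thesis by linarith
    qed
    have num: "norm (of_real p * w + of_real a + of_nat n) \<le> real n + A"
    proof -
      have "norm (of_real p * w + of_real a + of_nat n) \<le> norm (of_real p * w) + norm (complex_of_real a) + norm (of_nat n :: complex)"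
        by (intro order_trans[OF norm_triangle_ineq] add_mono) auto
      moreover have "norm (of_real p * w) \<le> p * \<bar>\<rho>\<bar>" using w p_pos by (auto simp: norm_mult intro!: mult_left_mono)
      ultimately show ?thesis by (simp add: A_def)
    qed
    have half: "norm (1/2 + of_nat n :: complex) \<le> real (Suc n)"
      by (rule order_trans[OF norm_triangle_ineq]) (simp add: norm_divide)
    define T where "T = norm (hterm a n w)"
    define T' where "T' = norm (hterm a (Suc n) w)"
    have eq: "T' * (norm (of_real r * w + of_nat n) * real (Suc n)) =
       T * (norm (of_real p * w + of_real a + of_nat n) * norm (1/2 + of_nat n :: complex) * x)"
      using arg_cong[OF hterm_Suc[of a n w], of norm] x_pos unfolding norm_mult T_def T'_def
      by (simp del: of_nat_Suc)
    have "T' * ((real n - B) * real (Suc n)) \<le> T' * (norm (of_real r * w + of_nat n) * real (Suc n))"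
      using den by (intro mult_left_mono mult_right_mono) (auto simp: T'_def)
    also have "\<dots> \<le> T * ((real n + A) * real (Suc n) * x)"
      unfolding eq using num half x_pos AB by (intro mult_left_mono mult_right_mono mult_mono) (auto simp: T_def)
    also have "\<dots> = T * real (Suc n) * (x * (real n + A))" by simp
    also have "\<dots> \<le> T * real (Suc n) * (q * (real n - B))"
      using key by (intro mult_left_mono) (auto simp: T_def)
    finally have "(T' - q * T) * ((real n - B) * real (Suc n)) \<le> 0" by (simp add: algebra_simps)
    moreover have "(real n - B) * real (Suc n) > 0" using nB by (intro mult_pos_pos) auto
    moreover have "u \<le> 0" if "u * v \<le> 0" "v > 0" for u v :: real
      using that by (simp add: mult_le_0_iff)
    ultimately have "T' - q * T \<le> 0" by blast
    thus ?thesis unfolding T_def T'_def by simp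
  qed
  show ?thesis by (rule that[OF q(1,2) *])
qed

lemma holomorphic_hterm: "hterm a n holomorphic_on A"
  unfolding hterm_def pochhammer_prod by (intro holomorphic_intros) auto

lemma hterm_majorant:
  obtains M where "summable M" "eventually (\<lambda>n. \<forall>w\<in>cball 0 \<rho>. norm (hterm a n w) \<le> M n) sequentially"
proof -
  obtain q N where q: "q > 0" "q < 1"
    and step: "\<And>n w. n \<ge> N \<Longrightarrow> norm w \<le> \<rho> \<Longrightarrow> norm (hterm a (Suc n) w) \<le> q * norm (hterm a n w)"
    using hterm_ratio_bound by blast
  have "compact (hterm a N ` cball 0 \<rho>)"
    by (intro compact_continuous_image holomorphic_on_imp_continuous_on holomorphic_hterm compact_cball)
  then obtain K where K: "\<And>w. w \<in> cball 0 \<rho> \<Longrightarrow> norm (hterm a N w) \<le> K"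
    by (meson bounded_iff compact_imp_bounded imageI)
  have b: "norm (hterm a (N + k) w) \<le> q ^ k * K" if "w \<in> cball 0 \<rho>" for k w
  proof (induction k)
    case (Suc k)
    have "norm (hterm a (N + Suc k) w) \<le> q * norm (hterm a (N + k) w)" using step[of "N + k" w] that by simp
    also have "\<dots> \<le> q * (q ^ k * K)" using Suc q by (intro mult_left_mono) auto
    finally show ?case by simp
  qed (use K that in auto)
  show ?thesis
  proof (rule that)
    have "summable (\<lambda>k. q ^ k * K)" using q by (intro summable_mult2 summable_geometric) auto
    thus "summable (\<lambda>n. q ^ (n - N) * K)"
      by (subst summable_iff_shift[symmetric, of _ N]) simp
    show "eventually (\<lambda>n. \<forall>w\<in>cball 0 \<rho>. norm (hterm a n w) \<le> q ^ (n - N) * K) sequentially"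
      using eventually_ge_at_top[of N]
    proof eventually_elim
      case (elim n)
      thus ?case using b[of _ "n - N"] by auto
    qed
  qed
qed

lemma summable_norm_hterm: "summable (\<lambda>n. norm (hterm a n w))"
proof -
  obtain M where M: "summable M" "eventually (\<lambda>n. \<forall>w\<in>cball 0 (norm w). norm (hterm a n w) \<le> M n) sequentially"
    using hterm_majorant by blast
  show ?thesis
    by (rule summable_comparison_test_ev[OF _ M(1)]) (use M(2) in eventually_elim, auto)
qed

lemma summable_hterm: "summable (\<lambda>n. hterm a n w)"
  by (rule summable_norm_cancel[OF summable_norm_hterm])

lemma holomorphic_F: "F a holomorphic_on A"
proof -
  have "F a holomorphic_on UNIV"
  proof (rule holomorphic_uniform_sequence[OF open_UNIV, where f = "\<lambda>n w. \<Sum>i<n. hterm a i w"])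
    show "(\<lambda>w. \<Sum>i<n. hterm a i w) holomorphic_on UNIV" for n
      by (intro holomorphic_intros holomorphic_hterm[of a _ UNIV, unfolded fun_eq_iff])
    fix z :: complex
    obtain M where M: "summable M" "eventually (\<lambda>n. \<forall>w\<in>cball 0 (norm z + 1). norm (hterm a n w) \<le> M n) sequentially"
      using hterm_majorant by blast
    have "uniform_limit (cball 0 (norm z + 1)) (\<lambda>n w. \<Sum>i<n. hterm a i w) (\<lambda>w. \<Sum>i. hterm a i w) sequentially"
      by (rule Weierstrass_m_test_ev[OF M(2,1)])
    moreover have "cball z 1 \<subseteq> cball 0 (norm z + 1)"
      by (auto simp: dist_norm) (metis add.commute add_left_mono diff_add_cancel norm_minus_commute norm_triangle_ineq order_trans)
    ultimately have "uniform_limit (cball z 1) (\<lambda>n w. \<Sum>i<n. hterm a i w) (F a) sequentially"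
      unfolding F_def by (rule uniform_limit_on_subset)
    thus "\<exists>d>0. cball z d \<subseteq> UNIV \<and> uniform_limit (cball z d) (\<lambda>n w. \<Sum>i<n. hterm a i w) (F a) sequentially"
      by (intro exI[of _ 1]) auto
  qed
  thus ?thesis by (rule holomorphic_on_subset) auto
qed

lemma holomorphic_F' [holomorphic_intros]: "g holomorphic_on A \<Longrightarrow> (\<lambda>z. F a (g z)) holomorphic_on A"
  using holomorphic_on_compose[of g A "F a"] holomorphic_F by (auto simp: o_def)

lemma isCont_F: "isCont (F a) w"
  using holomorphic_on_imp_continuous_on[OF holomorphic_F[of a UNIV]] by (simp add: continuous_on_eq_continuous_at)

lemma Gamma_mult_hterm:
  assumes "of_real r * w \<notin> \<int>\<^sub>\<le>\<^sub>0"
  shows "Gamma (of_real r * w) * hterm a n w =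
     pochhammer (of_real p * w + of_real a) n / pochhammer (of_real r * w) n * (pochhammer (1/2) n / fact n * of_real x ^ n)"
  unfolding hterm_def pochhammer_Gamma[OF assms, of n] by (simp add: rGamma_inverse_Gamma field_simps)

lemma hgf_eq_f:
  assumes "of_real r * w \<notin> \<int>\<^sub>\<le>\<^sub>0"
  shows "hgf p 0 r a (1/2) x w = f a w"
proof -
  have "f a w = (\<Sum>n. Gamma (of_real r * w) * hterm a n w)"
    unfolding f_def F_def by (rule suminf_mult[OF summable_hterm, symmetric])
  also have "\<dots> = hgf p 0 r a (1/2) x w"
    unfolding Gamma_mult_hterm[OF assms] using assms by (simp add: hgf_def hyp2F1_def mult_ac)
  finally show ?thesis ..
qed

text \<open>The sum of the termwise limits of \<open>f a w\<close> for \<open>Re w\<close> tending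
  to infinity, that is, the binomial series of \<open>(1 - p x / r) powr (- 1/2)\<close>. It does
  not depend on \<open>a\<close> and so is the same for the dual.\<close>

definition L :: real where "L = (\<Sum>n. pochhammer (1/2) n / fact n * (p / r * x) ^ n)"

lemma half_poch_bounds: "0 < pochhammer (1/2 :: real) n / fact n" "pochhammer (1/2 :: real) n / fact n \<le> 1"
proof -
  show "0 < pochhammer (1/2 :: real) n / fact n" by (intro divide_pos_pos pochhammer_pos) auto
  show "pochhammer (1/2 :: real) n / fact n \<le> 1"
  proof (induction n)
    case (Suc n)
    have "pochhammer (1/2 :: real) (Suc n) / fact (Suc n) = pochhammer (1/2) n / fact n * ((1/2 + real n) / (1 + real n))"
      by (simp add: pochhammer_Suc field_simps)
    also have "\<dots> \<le> 1 * 1"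
      using Suc by (intro mult_mono) (auto intro: divide_nonneg_pos simp: field_simps)
    finally show ?case by simp
  qed simp
qed

lemma abs_coeff_le: "y \<ge> 0 \<Longrightarrow> \<bar>pochhammer (1/2) n / fact n * y ^ n\<bar> \<le> (y :: real) ^ n"
proof -
  have "\<bar>c * z\<bar> \<le> z" if "0 < c" "c \<le> 1" "0 \<le> z" for c z :: real
    using that by (simp add: abs_mult mult_left_le_one_le)
  thus "y \<ge> 0 \<Longrightarrow> \<bar>pochhammer (1/2) n / fact n * y ^ n\<bar> \<le> y ^ n"
    using half_poch_bounds[of n] zero_le_power by blast
qed

lemma px_r_bounds: "0 \<le> p / r * x" "p / r * x < 1"
proof -
  show "0 \<le> p / r * x" using p_pos r_pos x_pos by simp
  have "p / r * x < 1 * 1"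
    using p_pos p_less_r x_pos x_less_1 by (intro mult_strict_mono) auto
  thus "p / r * x < 1" by simp
qed

lemma summable_L: "summable (\<lambda>n. pochhammer (1/2) n / fact n * (p / r * x) ^ n)"
proof (rule summable_comparison_test'[where g = "\<lambda>n. (p / r * x) ^ n"])
  show "summable (\<lambda>n. (p / r * x) ^ n)" using px_r_bounds by (intro summable_geometric) auto
  show "norm (pochhammer (1/2) n / fact n * (p / r * x) ^ n) \<le> (p / r * x) ^ n" for n
    using abs_coeff_le[OF px_r_bounds(1)] by simp
qed

lemma L_pos: "L > 0"
proof -
  have "(\<Sum>n<1. pochhammer (1/2) n / fact n * (p / r * x) ^ n) \<le> L"
    unfolding L_def by (intro sum_le_suminf summable_L mult_nonneg_nonneg less_imp_le[OF half_poch_bounds(1)] zero_le_power px_r_bounds(1)) auto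
  thus ?thesis by simp
qed

text \<open>From this abscissa on, \<open>p w + a + k\<close> is dominated by \<open>r w + k\<close>
  for every \<open>k\<close>, so that the series of \<open>f\<close> has the geometric majorant
  \<open>x ^ n\<close>.\<close>

definition w_min :: "real \<Rightarrow> real" where "w_min a = max 1 (\<bar>a\<bar> / (r - p))"

lemma poch_ratio_le:
  assumes "Re w \<ge> w_min a"
  shows "norm (pochhammer (of_real p * w + of_real a) n / pochhammer (of_real r * w) n) \<le> 1"
proof -
  have w1: "Re w \<ge> 1" "\<bar>a\<bar> \<le> (r - p) * Re w"
    using assms p_less_r by (auto simp: w_min_def field_simps)
  have "norm (of_real p * w + of_real a + of_nat k) \<le> norm (of_real r * w + of_nat k)" for k
  proof -
    have "r * Re w \<ge> 0" "p * Re w \<ge> 0" using w1 r_pos p_pos by auto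
    moreover have "\<bar>a\<bar> \<le> r * Re w - p * Re w" using w1 by (simp add: algebra_simps)
    ultimately have "\<bar>p * Re w + a + real k\<bar> \<le> \<bar>r * Re w + real k\<bar>" by linarith
    moreover have "\<bar>p * Im w\<bar> \<le> \<bar>r * Im w\<bar>" using p_pos p_less_r by (simp add: abs_mult mult_right_mono)
    ultimately have "(p * Re w + a + real k)\<^sup>2 + (p * Im w)\<^sup>2 \<le> (r * Re w + real k)\<^sup>2 + (r * Im w)\<^sup>2"
      by (intro add_mono) (simp_all add: abs_le_square_iff)
    thus ?thesis unfolding cmod_def by simp
  qed
  moreover have "of_real r * w + of_nat k \<noteq> 0" for k
  proof -
    have "Re (of_real r * w + of_nat k) > 0" using w1 r_pos by (auto intro: add_pos_nonneg)
    thus ?thesis by (metis less_irrefl zero_complex.simps(1))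
  qed
  ultimately have "(\<Prod>k<n. norm ((of_real p * w + of_real a + of_nat k) / (of_real r * w + of_nat k))) \<le> (\<Prod>k<n. 1)"
    by (intro prod_mono) (auto simp: norm_divide divide_le_eq_1)
  thus ?thesis by (simp add: pochhammer_prod lessThan_atLeast0 flip: prod_dividef prod_norm)
qed

lemma r_w_not_nonpos_Int: "Re w > 0 \<Longrightarrow> of_real r * w \<notin> \<int>\<^sub>\<le>\<^sub>0"
  using r_pos by (intro not_nonpos_Ints_if_Re_pos) simp

lemma f_eq_suminf:
  assumes "of_real r * w \<notin> \<int>\<^sub>\<le>\<^sub>0"
  shows "f a w = (\<Sum>n. pochhammer (of_real p * w + of_real a) n / pochhammer (of_real r * w) n *
     (pochhammer (1/2) n / fact n * of_real x ^ n))"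
  unfolding f_def F_def suminf_mult[OF summable_hterm, symmetric] Gamma_mult_hterm[OF assms] ..

lemma norm_coeff_le: "norm (pochhammer (1/2 :: complex) n / fact n * of_real x ^ n) \<le> x ^ n"
proof -
  have "pochhammer (1/2 :: complex) n / fact n * of_real x ^ n = of_real (pochhammer (1/2) n / fact n * x ^ n)"
    by (simp flip: pochhammer_of_real)
  hence "norm (pochhammer (1/2 :: complex) n / fact n * of_real x ^ n) = \<bar>pochhammer (1/2) n / fact n * x ^ n\<bar>"
    by (simp only: norm_of_real)
  also have "\<dots> \<le> x ^ n"
    using x_pos by (intro abs_coeff_le) simp
  finally show ?thesis .
qed

lemma term_le: "Re w \<ge> w_min a \<Longrightarrow>
   norm (pochhammer (of_real p * w + of_real a) n / pochhammer (of_real r * w) n *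
     (pochhammer (1/2) n / fact n * of_real x ^ n)) \<le> x ^ n"
  unfolding norm_mult[of "_ / _" "_ * _"]
  using mult_mono[OF poch_ratio_le[of a w n] norm_coeff_le[of n]] by simp

lemma f_bounded:
  assumes w: "Re w \<ge> w_min a"
  shows "norm (f a w) \<le> 1 / (1 - x)"
proof -
  have "Re w > 0" using w by (auto simp: w_min_def)
  hence nz: "of_real r * w \<notin> \<int>\<^sub>\<le>\<^sub>0" by (rule r_w_not_nonpos_Int)
  have g: "summable (\<lambda>n. x ^ n)" using x_pos x_less_1 by (intro summable_geometric) auto
  have "norm (f a w) \<le> (\<Sum>n. x ^ n)"
    unfolding f_eq_suminf[OF nz]
    by (rule norm_suminf_le[OF term_le[OF w] g])
  also have "\<dots> = 1 / (1 - x)" using x_pos x_less_1 by (intro suminf_geometric) auto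
  finally show ?thesis .
qed

text \<open>Tannery's theorem with the majorant \<open>x ^ k\<close>. Nothing is assumed on the
  imaginary parts of \<open>X n\<close>, so progressions with any starting point are
  covered.\<close>

lemma f_tendsto_L:
  assumes X: "filterlim (\<lambda>n. Re (X n)) at_top sequentially"
  shows "(\<lambda>n. f a (X n)) \<longlonglongrightarrow> of_real L"
proof -
  define A where "A = (\<lambda>k n. pochhammer (of_real p * X n + of_real a) k / pochhammer (of_real r * X n) k *
     (pochhammer (1/2) k / fact k * of_real x ^ k))"
  have ev: "eventually (\<lambda>n. Re (X n) \<ge> w_min a) sequentially"
    using X by (auto simp: filterlim_at_top)
  have inf: "filterlim X at_infinity sequentially"
    by (rule filterlim_norm_at_top_imp_at_infinity, rule filterlim_at_top_mono[OF X])
       (auto intro!: always_eventually complex_Re_le_cmod)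
  have lim: "(\<lambda>n. A k n) \<longlonglongrightarrow> of_real (pochhammer (1/2) k / fact k * (p / r * x) ^ k)" for k
  proof -
    have 1: "(\<lambda>n. (of_real p * X n + of_real a + of_nat j) / (of_real r * X n + of_nat j)) \<longlonglongrightarrow> of_real (p / r)" for j
    proof -
      have "(\<lambda>n. (of_real p + (of_real a + of_nat j) * inverse (X n)) / (of_real r + of_nat j * inverse (X n))) \<longlonglongrightarrow>
             (of_real p + (of_real a + of_nat j) * 0) / (of_real r + of_nat j * 0)"
        using r_pos by (intro tendsto_intros filterlim_compose[OF tendsto_inverse_0 inf]) auto
      moreover have "eventually (\<lambda>n. (of_real p + (of_real a + of_nat j) * inverse (X n)) / (of_real r + of_nat j * inverse (X n)) =
           (of_real p * X n + of_real a + of_nat j) / (of_real r * X n + of_nat j)) sequentially"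
        using ev
      proof eventually_elim
        case (elim n)
        hence "X n \<noteq> 0" by (auto simp: w_min_def)
        hence "of_real p * X n + of_real a + of_nat j = (of_real p + (of_real a + of_nat j) * inverse (X n)) * X n"
              "of_real r * X n + of_nat j = (of_real r + of_nat j * inverse (X n)) * X n"
          by (simp_all add: algebra_simps)
        thus ?case using \<open>X n \<noteq> 0\<close> by simp
      qed
      ultimately show ?thesis by (simp add: Lim_transform_eventually)
    qed
    have "(\<lambda>n. (\<Prod>j<k. (of_real p * X n + of_real a + of_nat j) / (of_real r * X n + of_nat j)) *
        (pochhammer (1/2) k / fact k * of_real x ^ k)) \<longlonglongrightarrow> (\<Prod>j<k. of_real (p / r)) * (pochhammer (1/2) k / fact k * of_real x ^ k)"
      by (intro tendsto_intros 1)
    moreover have "(\<Prod>j<k. of_real (p / r)) * (pochhammer (1/2) k / fact k * of_real x ^ k) =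
       complex_of_real (pochhammer (1/2) k / fact k * (p / r * x) ^ k)"
      by (simp add: power_mult_distrib power_divide mult_ac flip: pochhammer_of_real)
    moreover have "(\<Prod>j<k. (of_real p * X n + of_real a + of_nat j) / (of_real r * X n + of_nat j)) =
        pochhammer (of_real p * X n + of_real a) k / pochhammer (of_real r * X n) k" for n
      unfolding pochhammer_prod lessThan_atLeast0 prod_dividef ..
    ultimately show ?thesis by (simp only: A_def)
  qed
  have "(\<lambda>n. \<Sum>k. A k n) \<longlonglongrightarrow> (\<Sum>k. of_real (pochhammer (1/2) k / fact k * (p / r * x) ^ k))"
  proof (rule tannerys_theorem[THEN conjunct2, THEN conjunct2])
    show "(\<lambda>n. A k n) \<longlonglongrightarrow> of_real (pochhammer (1/2) k / fact k * (p / r * x) ^ k)" for k by (rule lim)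
    show "summable (\<lambda>k. x ^ k)" using x_pos x_less_1 by (intro summable_geometric) auto
    have "eventually (\<lambda>y. True \<and> Re (X (snd y)) \<ge> w_min a) ((at_top :: nat filter) \<times>\<^sub>F sequentially)"
      using eventually_prodI[where P = "\<lambda>_. True" and F = "at_top :: nat filter", OF _ ev] by simp
    thus "eventually (\<lambda>(k,n). norm (A k n) \<le> x ^ k) (at_top \<times>\<^sub>F sequentially)"
      by eventually_elim (unfold A_def case_prod_unfold, rule term_le, simp)
  qed simp
  moreover have "(\<Sum>k. complex_of_real (pochhammer (1/2) k / fact k * (p / r * x) ^ k)) = of_real L"
    unfolding L_def
    by (rule suminf_of_real[OF summable_L, symmetric])
  moreover have "eventually (\<lambda>n. (\<Sum>k. A k n) = f a (X n)) sequentially"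
    using ev
  proof eventually_elim
    case (elim n)
    hence "Re (X n) > 0" by (auto simp: w_min_def)
    thus ?case unfolding A_def by (subst f_eq_suminf) (auto dest: r_w_not_nonpos_Int)
  qed
  ultimately show ?thesis by (auto dest: Lim_transform_eventually)
qed

end

section \<open>Euler's transformation and the dual function\<close>

text \<open>The differential algebra behind Euler's transformation. Think of \<open>u\<close> as
  \<open>(1 - X)\<close> to the power \<open>e\<close>, of \<open>h1\<close>, \<open>h2\<close> and
  \<open>z1\<close>, \<open>z2\<close> as derivatives of \<open>h\<close> and
  \<open>z = u h\<close>: the hypergeometric equation with parameters \<open>a, b, c\<close> turns
  into that with \<open>c - a, c - b, c\<close>. Powers of \<open>1 - X\<close> are multiplied
  through, as the ring has no division.\<close>

lemma euler_ode_algebra: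
  fixes X h h1 h2 z z1 z2 u a b c e :: "'a :: idom"
  assumes e: "e = a + b - c"
    and z: "z = u * h"
    and z1: "(1 - X) * z1 = u * ((1 - X) * h1 - e * h)"
    and z2: "(1 - X) * ((1 - X) * z2) = u * ((e * e - e) * h - (e + e) * ((1 - X) * h1) + (1 - X) * ((1 - X) * h2))"
    and ode: "X * ((1 - X) * h2) + (c - (a + b + 1) * X) * h1 = a * b * h"
    and X: "X \<noteq> 1"
  shows "X * ((1 - X) * z2) + (c - ((c - a) + (c - b) + 1) * X) * z1 = (c - a) * (c - b) * z"
proof -
  have "(1 - X) * (X * ((1 - X) * z2) + (c - ((c - a) + (c - b) + 1) * X) * z1 - (c - a) * (c - b) * z) =
        X * ((1 - X) * ((1 - X) * z2)) + (c - ((c - a) + (c - b) + 1) * X) * ((1 - X) * z1) - (c - a) * (c - b) * (1 - X) * z"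
    by (simp add: algebra_simps)
  also have "\<dots> = u * (1 - X) * (X * ((1 - X) * h2) + (c - (a + b + 1) * X) * h1 - a * b * h)"
    unfolding z1 z2 z e by (simp add: algebra_simps)
  also have "\<dots> = 0" using ode by simp
  finally show ?thesis using X by simp
qed

definition hcoeff :: "real \<Rightarrow> real \<Rightarrow> real \<Rightarrow> nat \<Rightarrow> real" where
  "hcoeff A B C n = pochhammer A n * pochhammer B n / (pochhammer C n * fact n)"

lemma hcoeff_Suc:
  assumes "C > 0"
  shows "real (Suc n) * (C + real n) * hcoeff A B C (Suc n) = (A + real n) * (B + real n) * hcoeff A B C n"
proof -
  have "pochhammer C n \<noteq> 0" "C + real n \<noteq> 0" using pochhammer_pos[OF assms, of n] assms by auto
  moreover have "N * c * (P * a * (Q * b) / (R * c * (N * f))) = a * b * (P * Q / (R * f))"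
    if "N \<noteq> 0" "c \<noteq> 0" "R \<noteq> 0" "f \<noteq> 0" for N c P a Q b R f :: real
    using that by (simp add: field_simps)
  ultimately show ?thesis
    unfolding hcoeff_def pochhammer_Suc fact_Suc by simp
qed

lemma hcoeff_unique:
  assumes "C > 0" "z 0 = 1"
    "\<And>n. real (Suc n) * (C + real n) * z (Suc n) = (A + real n) * (B + real n) * z n"
  shows "z n = hcoeff A B C n"
proof (induction n)
  case 0
  show ?case using assms by (simp add: hcoeff_def)
next
  case (Suc n)
  have "real (Suc n) * (C + real n) \<noteq> 0" using assms(1) by (simp del: of_nat_Suc)
  moreover have "real (Suc n) * (C + real n) * z (Suc n) = real (Suc n) * (C + real n) * hcoeff A B C (Suc n)"
    unfolding assms(3) hcoeff_Suc[OF assms(1)] Suc ..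
  ultimately show ?case by (metis mult_left_cancel)
qed

text \<open>In formal power series the left side is the coefficient of \<open>(1 - X)^e\<close>
  times the hypergeometric series. The product solves the transformed differential equation, and for
  \<open>C > 0\<close> the recurrence of that equation determines a series from its constant
  term.\<close>

lemma euler_transformation_coeff:
  assumes C: "C > 0"
  shows "(\<Sum>i\<le>n. pochhammer (- (A + B - C)) i / fact i * hcoeff A B C (n - i)) = hcoeff (C - A) (C - B) C n"
proof -
  define e where "e = A + B - C"
  define c where "c = (\<lambda>n. pochhammer (- e) n / fact n)"
  define u where "u = Abs_fps c"
  define h where "h = Abs_fps (hcoeff A B C)"
  define z where "z = u * h"
  have du: "(1 - fps_X) * fps_deriv u = - (fps_const e * u)"
  proof (rule fps_ext)
    fix n
    have "N * (P * a / (N * g)) = a * (P / g)" if "N \<noteq> 0" for N P a g :: real using that by simp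
    hence "real (Suc n) * c (Suc n) = (real n - e) * c n"
      unfolding c_def pochhammer_Suc fact_Suc by (simp del: of_nat_Suc)
    thus "((1 - fps_X) * fps_deriv u) $ n = (- (fps_const e * u)) $ n"
      by (cases n) (simp_all add: u_def algebra_simps fps_X_mult_nth)
  qed
  have coeffs: "(fps_X * ((1 - fps_X) * fps_deriv (fps_deriv g)) +
      (fps_const C - (fps_const A' + fps_const B' + 1) * fps_X) * fps_deriv g) $ n =
      real (Suc n) * (C + real n) * g $ Suc n - real n * (A' + B' + real n) * g $ n" for g :: "real fps" and A' B' n
  proof -
    have "fps_X * ((1 - fps_X) * fps_deriv (fps_deriv g)) +
      (fps_const C - (fps_const A' + fps_const B' + 1) * fps_X) * fps_deriv g =
      fps_X * fps_deriv (fps_deriv g) - fps_X * (fps_X * fps_deriv (fps_deriv g)) + fps_const C * fps_deriv g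
      - fps_const (A' + B' + 1) * (fps_X * fps_deriv g)"
      by (simp add: algebra_simps flip: fps_const_add)
    thus ?thesis
      by (cases n; cases "n - 1") (simp_all add: fps_X_mult_nth algebra_simps)
  qed
  have odeh: "fps_X * ((1 - fps_X) * fps_deriv (fps_deriv h)) +
      (fps_const C - (fps_const A + fps_const B + 1) * fps_X) * fps_deriv h = fps_const A * fps_const B * h"
  proof (rule fps_ext)
    fix n
    show "(fps_X * ((1 - fps_X) * fps_deriv (fps_deriv h)) +
      (fps_const C - (fps_const A + fps_const B + 1) * fps_X) * fps_deriv h) $ n = (fps_const A * fps_const B * h) $ n"
      unfolding coeffs using hcoeff_Suc[OF C, of n A B] by (simp add: h_def algebra_simps del: of_nat_Suc)
  qed
  have dz: "(1 - fps_X) * fps_deriv z = u * ((1 - fps_X) * fps_deriv h - fps_const e * h)"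
  proof -
    have "(1 - fps_X) * fps_deriv z = ((1 - fps_X) * fps_deriv u) * h + u * ((1 - fps_X) * fps_deriv h)"
      by (simp add: z_def algebra_simps)
    thus ?thesis unfolding du by (simp add: algebra_simps)
  qed
  have ddz: "(1 - fps_X) * ((1 - fps_X) * fps_deriv (fps_deriv z)) =
     u * ((fps_const e * fps_const e - fps_const e) * h - (fps_const e + fps_const e) * ((1 - fps_X) * fps_deriv h) +
       (1 - fps_X) * ((1 - fps_X) * fps_deriv (fps_deriv h)))"
  proof -
    have "fps_deriv ((1 - fps_X) * fps_deriv z) = fps_deriv (u * ((1 - fps_X) * fps_deriv h - fps_const e * h))"
      by (simp only: dz)
    hence "(1 - fps_X) * fps_deriv (fps_deriv z) = fps_deriv z + fps_deriv u * ((1 - fps_X) * fps_deriv h - fps_const e * h)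
       + u * ((1 - fps_X) * fps_deriv (fps_deriv h) - fps_deriv h - fps_const e * fps_deriv h)"
      by (simp add: algebra_simps)
    moreover have "d * (s + t * K + u * (M - N - e * N)) = d * s + (d * t) * K + u * (d * M - d * N - e * (d * N))"
      for d s t K u M N e :: "real fps"
      by (simp add: algebra_simps)
    ultimately have "(1 - fps_X) * ((1 - fps_X) * fps_deriv (fps_deriv z)) = (1 - fps_X) * fps_deriv z +
       ((1 - fps_X) * fps_deriv u) * ((1 - fps_X) * fps_deriv h - fps_const e * h)
       + u * ((1 - fps_X) * ((1 - fps_X) * fps_deriv (fps_deriv h)) - (1 - fps_X) * fps_deriv h - fps_const e * ((1 - fps_X) * fps_deriv h))"
      by simp
    moreover have "u * (D1 - e * h) + - (e * u) * (D1 - e * h) + u * (D2 - D1 - e * D1) =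
        u * ((e * e - e) * h - (e + e) * D1 + D2)" for u D1 D2 e h :: "real fps"
      by (simp add: algebra_simps)
    ultimately show ?thesis unfolding dz du by simp
  qed
  have X1: "fps_X \<noteq> (1 :: real fps)"
  proof
    assume "fps_X = (1 :: real fps)"
    hence "fps_X $ 0 = (1 :: real fps) $ 0" by (rule arg_cong)
    thus False by simp
  qed
  have "fps_const e = fps_const A + fps_const B - fps_const C" by (simp add: e_def)
  from euler_ode_algebra[OF this z_def dz ddz odeh X1]
  have odez: "fps_X * ((1 - fps_X) * fps_deriv (fps_deriv z)) +
     (fps_const C - (fps_const (C - A) + fps_const (C - B) + 1) * fps_X) * fps_deriv z = fps_const (C - A) * fps_const (C - B) * z"
    by simp
  have "z $ n = hcoeff (C - A) (C - B) C n"
  proof (rule hcoeff_unique[OF C])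
    show "z $ 0 = 1" by (simp add: z_def u_def h_def c_def hcoeff_def)
    fix n
    have "(fps_X * ((1 - fps_X) * fps_deriv (fps_deriv z)) +
     (fps_const C - (fps_const (C - A) + fps_const (C - B) + 1) * fps_X) * fps_deriv z) $ n = (fps_const (C - A) * fps_const (C - B) * z) $ n"
      by (simp only: odez)
    thus "real (Suc n) * (C + real n) * z $ Suc n = (C - A + real n) * (C - B + real n) * z $ n"
      unfolding coeffs by (simp add: algebra_simps del: of_nat_Suc)
  qed
  thus ?thesis by (simp add: z_def u_def h_def c_def e_def fps_mult_nth atLeast0AtMost)
qed

lemma summable_hcoeff:
  assumes C: "C > 0" and x: "0 < x" "x < 1"
  shows "summable (\<lambda>n. norm (hcoeff A B C n * x ^ n))"
proof -
  define q where "q = (1 + x) / 2"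
  have q: "x < q" "q < 1" "0 < q" using x by (auto simp: q_def)
  have "((\<lambda>n. \<bar>(A + real n) * (B + real n) / ((C + real n) * (1 + real n))\<bar> * x) \<longlonglongrightarrow> \<bar>1\<bar> * x)"
    by (intro tendsto_intros) real_asymp
  hence "eventually (\<lambda>n. \<bar>(A + real n) * (B + real n) / ((C + real n) * (1 + real n))\<bar> * x < q) sequentially"
    by (rule order_tendstoD) (use q in simp)
  then obtain N where N: "\<And>n. n \<ge> N \<Longrightarrow> \<bar>(A + real n) * (B + real n) / ((C + real n) * (1 + real n))\<bar> * x < q"
    by (auto simp: eventually_at_top_linorder)
  show ?thesis
  proof (rule summable_ratio_test[OF q(2), of N])
    fix n assume n: "n \<ge> N"
    have nz: "(C + real n) * (1 + real n) \<noteq> 0" using C by auto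
    have "hcoeff A B C (Suc n) = (A + real n) * (B + real n) / ((C + real n) * (1 + real n)) * hcoeff A B C n"
      using hcoeff_Suc[OF C, of n A B] nz by (simp add: field_simps)
    hence "norm (hcoeff A B C (Suc n) * x ^ Suc n) =
       \<bar>(A + real n) * (B + real n) / ((C + real n) * (1 + real n))\<bar> * x * norm (hcoeff A B C n * x ^ n)"
      using x by (simp add: abs_mult)
    also have "\<dots> \<le> q * norm (hcoeff A B C n * x ^ n)"
      using N[OF n] by (intro mult_right_mono) auto
    finally show "norm (norm (hcoeff A B C (Suc n) * x ^ Suc n)) \<le> q * norm (norm (hcoeff A B C n * x ^ n))" by simp
  qed
qed

lemma euler_transformation:
  assumes C: "C > 0" and x: "0 < x" "x < 1"
  shows "(\<Sum>n. hcoeff A B C n * x ^ n) = (1 - x) powr (C - A - B) * (\<Sum>n. hcoeff (C - A) (C - B) C n * x ^ n)"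
proof -
  define e where "e = A + B - C"
  have u: "(\<lambda>n. pochhammer (- e) n / fact n * x ^ n) sums (1 - x) powr e"
  proof -
    have "(\<lambda>n. (e gchoose n) * (- x) ^ n) sums (1 + (- x)) powr e"
      using x by (intro gen_binomial_real) auto
    moreover have "(e gchoose n) * (- x) ^ n = pochhammer (- e) n / fact n * x ^ n" for n
    proof -
      have "(e gchoose n) * (- x) ^ n = ((- 1) ^ n * (- 1) ^ n) * (pochhammer (- e) n / fact n * x ^ n)"
        unfolding gbinomial_pochhammer power_minus[of x n] by (simp only: times_divide_eq_left times_divide_eq_right mult_ac)
      also have "(- 1) ^ n * (- 1) ^ n = (1 :: real)" by (simp flip: power_mult_distrib)
      finally show ?thesis by simp
    qed
    ultimately show ?thesis by simp
  qed
  have un: "summable (\<lambda>n. norm (pochhammer (- e) n / fact n * x ^ n))"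
  proof -
    \<comment> \<open>The binomial series is the hypergeometric series whose second upper parameter
      equals the lower one, here both 1.\<close>
    have "summable (\<lambda>n. norm (hcoeff (- e) 1 1 n * x ^ n))" by (rule summable_hcoeff[OF _ x]) simp
    thus ?thesis by (simp add: hcoeff_def pochhammer_fact[symmetric])
  qed
  have "(\<lambda>k. \<Sum>i\<le>k. (pochhammer (- e) i / fact i * x ^ i) * (hcoeff A B C (k - i) * x ^ (k - i))) sums
      ((\<Sum>n. pochhammer (- e) n / fact n * x ^ n) * (\<Sum>n. hcoeff A B C n * x ^ n))"
    by (rule Cauchy_product_sums[OF un summable_hcoeff[OF C x]])
  moreover have "(\<Sum>i\<le>k. (pochhammer (- e) i / fact i * x ^ i) * (hcoeff A B C (k - i) * x ^ (k - i))) =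
      hcoeff (C - A) (C - B) C k * x ^ k" for k
  proof -
    have "(\<Sum>i\<le>k. (pochhammer (- e) i / fact i * x ^ i) * (hcoeff A B C (k - i) * x ^ (k - i))) =
        (\<Sum>i\<le>k. pochhammer (- e) i / fact i * hcoeff A B C (k - i) * x ^ k)"
      by (intro sum.cong refl) (simp flip: power_add)
    also have "\<dots> = (\<Sum>i\<le>k. pochhammer (- e) i / fact i * hcoeff A B C (k - i)) * x ^ k"
      by (simp add: sum_distrib_right)
    finally show ?thesis using euler_transformation_coeff[OF C, of A B k] by (simp add: e_def)
  qed
  ultimately have "(\<Sum>n. hcoeff (C - A) (C - B) C n * x ^ n) = (1 - x) powr e * (\<Sum>n. hcoeff A B C n * x ^ n)"
    using u by (simp add: sums_iff)
  moreover have "(1 - x) powr (C - A - B) * (1 - x) powr e = 1"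
    using x by (simp add: e_def flip: powr_add)
  ultimately show ?thesis by (simp add: mult.assoc[symmetric])
qed

context hyp_params
begin

definition dual :: "real \<Rightarrow> real" where "dual a = 1 - 2 * p / r - a"

text \<open>The factor between \<open>F a (- n / r)\<close> and \<open>f b ((n + 2) / r)\<close> for \<open>b = dual a\<close>, up to a sine and \<open>n!\<close>,
  rewritten as a function of \<open>w = (n + 2) / r\<close>.\<close>
definition E :: "real \<Rightarrow> complex \<Rightarrow> complex" where
  "E b w = Gamma (of_real (r - p) * w - of_real b) * Gamma (of_real p * w + of_real b) *
     Gamma (of_real r * w - 1/2) * rGamma (of_real r * w - 1) * rGamma (of_real r * w) / of_real (sqrt pi) *
     exp (of_real (ln x) * (of_real r * w - 1)) * exp (of_real (ln (1 - x)) * (1/2 + of_real b - of_real (r - p) * w))"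

text \<open>At \<open>w = - n / r\<close> the reciprocal Gamma factor kills the terms up to index
  \<open>n\<close>. The remaining ones form a series with parameters
  \<open>A = \<alpha> + n + 1\<close>, \<open>B = n + 3/2\<close> and \<open>C = n + 2\<close>.
  Euler's transformation replaces \<open>A, B\<close> by \<open>1 - \<alpha>\<close> and
  \<open>1/2\<close>, which are the parameters of the dual function at the point where
  \<open>r w = n + 2\<close>. This is where both \<open>dual a\<close> and the reflection
  \<open>w\<close> to \<open>2 / r - w\<close> come from.\<close>

lemma F_at_neg:
  fixes n :: nat and a :: real
  defines "\<alpha> \<equiv> a - real n * p / r"
  shows "F a (- of_nat n / of_real r) =
     of_real (pochhammer \<alpha> (Suc n) * pochhammer (1/2) (Suc n) / fact (Suc n) * x ^ Suc n *
       (1 - x) powr (- (\<alpha> + real n + 1/2))) * f (dual a) (of_nat (n + 2) / of_real r)"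
proof -
  define A where "A = \<alpha> + real n + 1"
  define B where "B = real n + 3/2"
  define C where "C = real n + 2"
  have C: "C > 0" by (simp add: C_def)
  define w where "w = - complex_of_nat n / of_real r"
  define w' where "w' = complex_of_nat (n + 2) / of_real r"
  have rw: "of_real r * w = - of_nat n" using r_pos by (simp add: w_def)
  have pw: "of_real p * w + of_real a = of_real \<alpha>" using r_pos by (simp add: w_def \<alpha>_def field_simps)
  define K where "K = pochhammer \<alpha> (Suc n) * pochhammer (1/2) (Suc n) / fact (Suc n) * x ^ Suc n"
  have t0: "hterm a i w = 0" if "i < Suc n" for i
  proof -
    have "of_real r * w + of_nat i = - of_nat (n - i)" using that by (simp add: rw of_nat_diff)
    hence "rGamma (of_real r * w + of_nat i) = 0"
      by (simp add: rGamma_eq_zero_iff)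
    thus ?thesis by (simp add: hterm_def)
  qed
  have t1: "hterm a (j + Suc n) w = of_real (K * (hcoeff A B C j * x ^ j))" for j
  proof -
    have "of_real r * w + of_nat (j + Suc n) = 1 + of_nat j" by (simp add: rw)
    hence g: "rGamma (of_real r * w + of_nat (j + Suc n)) = 1 / fact j"
      using Gamma_fact[of j, where ?'a = complex] by (simp add: rGamma_inverse_Gamma field_simps)
    have p1: "pochhammer \<alpha> (j + Suc n) = pochhammer \<alpha> (Suc n) * pochhammer A j"
      using pochhammer_product'[of \<alpha> "Suc n" j] by (simp add: A_def add_ac)
    have p2: "pochhammer (1/2 :: real) (j + Suc n) = pochhammer (1/2) (Suc n) * pochhammer B j"
      using pochhammer_product'[of "1/2 :: real" "Suc n" j] by (simp add: B_def add_ac)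
    have p3: "fact (j + Suc n) = fact (Suc n) * pochhammer C j"
      using pochhammer_product'[of "1 :: real" "Suc n" j] unfolding pochhammer_fact by (simp add: C_def add_ac)
    have "hterm a (j + Suc n) w = of_real (pochhammer \<alpha> (j + Suc n) * pochhammer (1/2) (j + Suc n) * (1 / fact j) / fact (j + Suc n) * x ^ (j + Suc n))"
      unfolding hterm_def pw g by (simp flip: pochhammer_of_real)
    also have "pochhammer \<alpha> (j + Suc n) * pochhammer (1/2) (j + Suc n) * (1 / fact j) / fact (j + Suc n) * x ^ (j + Suc n) =
        K * (hcoeff A B C j * x ^ j)"
      unfolding p1 p2 p3 power_add K_def hcoeff_def by (simp add: field_simps del: fact_Suc power_Suc)
    finally show ?thesis .
  qed
  have "F a w = (\<Sum>j. hterm a (j + Suc n) w) + (\<Sum>i<Suc n. hterm a i w)"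
    unfolding F_def by (rule suminf_split_initial_segment[OF summable_hterm])
  also have "(\<Sum>i<Suc n. hterm a i w) = 0" using t0 by (intro sum.neutral) auto
  also have "(\<Sum>j. hterm a (j + Suc n) w) = of_real (\<Sum>j. K * (hcoeff A B C j * x ^ j))"
    unfolding t1 using summable_hcoeff[OF C x_pos x_less_1, of A B]
    by (intro suminf_of_real[symmetric] summable_mult) (rule summable_norm_cancel)
  also have "(\<Sum>j. K * (hcoeff A B C j * x ^ j)) = K * (\<Sum>j. hcoeff A B C j * x ^ j)"
    using summable_hcoeff[OF C x_pos x_less_1, of A B]
    by (intro suminf_mult) (rule summable_norm_cancel)
  also have "(\<Sum>j. hcoeff A B C j * x ^ j) = (1 - x) powr (C - A - B) * (\<Sum>n. hcoeff (C - A) (C - B) C n * x ^ n)"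
    by (rule euler_transformation[OF C x_pos x_less_1])
  also have "C - A - B = - (\<alpha> + real n + 1/2)" by (simp add: A_def B_def C_def)
  finally have F: "F a w = of_real (K * (1 - x) powr (- (\<alpha> + real n + 1/2))) * of_real (\<Sum>n. hcoeff (C - A) (C - B) C n * x ^ n)"
    by simp
  have rw': "of_real r * w' = of_real C" using r_pos by (simp add: w'_def C_def)
  have pw': "of_real p * w' + of_real (dual a) = of_real (C - A)"
    using r_pos by (simp add: w'_def dual_def C_def A_def \<alpha>_def field_simps)
  have "of_real r * w' \<notin> \<int>\<^sub>\<le>\<^sub>0" unfolding rw' using C by (intro not_nonpos_Ints_if_Re_pos) simp
  hence "f (dual a) w' = (\<Sum>n. of_real (hcoeff (C - A) (C - B) C n * x ^ n))"
    unfolding f_eq_suminf[OF \<open>of_real r * w' \<notin> \<int>\<^sub>\<le>\<^sub>0\<close>] pw' rw'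
    by (simp add: hcoeff_def C_def B_def mult_ac flip: pochhammer_of_real)
  also have "\<dots> = of_real (\<Sum>n. hcoeff (C - A) (C - B) C n * x ^ n)"
    using summable_hcoeff[OF C x_pos x_less_1, of "C - A" "C - B"]
    by (intro suminf_of_real[symmetric]) (rule summable_norm_cancel)
  finally show ?thesis using F unfolding w_def w'_def K_def by simp
qed

text \<open>The reflection formula splits the Pochhammer symbol of \<alpha> into a sine and two
  Gamma values. By the two hypotheses the arguments of these are positive, so \<open>E\<close> is
  positive at this point and any oscillation in \<open>n\<close> sits in the sine.\<close>

lemma F_at_neg':
  fixes n :: nat and a :: real
  defines "\<alpha> \<equiv> a - real n * p / r"
  assumes n: "\<alpha> < 1" "\<alpha> + real n + 1 > 0"
  shows "F a (- of_nat n / of_real r) =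
     of_real (sin (pi * \<alpha>) / pi) * fact n * E (dual a) (of_nat (n + 2) / of_real r) * f (dual a) (of_nat (n + 2) / of_real r)"
proof -
  define w' where "w' = complex_of_nat (n + 2) / of_real r"
  define A where "A = \<alpha> + real n + 1"
  have A: "A > 0" using n by (simp add: A_def)
  have rw': "of_real r * w' = of_nat (n + 2)" using r_pos by (simp add: w'_def)
  have pw': "of_real p * w' + of_real (dual a) = of_real (1 - \<alpha>)"
    using r_pos by (simp add: w'_def dual_def \<alpha>_def field_simps)
  have qw': "of_real (r - p) * w' - of_real (dual a) = of_real A"
    using r_pos by (simp add: w'_def dual_def A_def \<alpha>_def field_simps)
  have G1: "Gamma (of_real r * w' - 1/2) = of_real (Gamma (real n + 3/2))"
  proof -
    have "of_real r * w' - 1/2 = complex_of_real (real n + 3/2)" unfolding rw' by (simp add: field_simps)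
    thus ?thesis by (simp only: Gamma_complex_of_real)
  qed
  have "of_real r * w' - 1 = 1 + of_nat n" "of_real r * w' = 1 + of_nat (Suc n)" unfolding rw' by simp_all
  hence G2: "rGamma (of_real r * w' - 1) = of_real (1 / fact n)" "rGamma (of_real r * w') = of_real (1 / fact (Suc n))"
    unfolding rGamma_inverse_Gamma by (simp_all only: Gamma_fact) (simp_all add: divide_inverse del: fact_Suc)
  have e1: "exp (of_real (ln x) * (of_real r * w' - 1)) = complex_of_real (x ^ Suc n)"
  proof -
    have "of_real (ln x) * (of_real r * w' - 1) = complex_of_real (real (Suc n) * ln x)" unfolding rw' by simp
    hence "exp (of_real (ln x) * (of_real r * w' - 1)) = complex_of_real (exp (real (Suc n) * ln x))"
      by (simp only: exp_of_real)
    also have "exp (real (Suc n) * ln x) = x ^ Suc n" using x_pos by (simp only: exp_of_nat_mult exp_ln)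
    finally show ?thesis .
  qed
  have e2: "exp (of_real (ln (1 - x)) * (1/2 + of_real (dual a) - of_real (r - p) * w')) = complex_of_real ((1 - x) powr (- (\<alpha> + real n + 1/2)))"
  proof -
    have "1/2 + of_real (dual a) - of_real (r - p) * w' = 1/2 - (of_real (r - p) * w' - of_real (dual a))" by simp
    also have "\<dots> = complex_of_real (- (\<alpha> + real n + 1/2))" unfolding qw' A_def by simp
    finally have "of_real (ln (1 - x)) * (1/2 + of_real (dual a) - of_real (r - p) * w') = complex_of_real (- (\<alpha> + real n + 1/2) * ln (1 - x))"
      by simp
    thus ?thesis using x_less_1 by (simp only: exp_of_real) (simp add: powr_def)
  qed
  have Eeq: "E (dual a) w' = of_real (Gamma A * Gamma (1 - \<alpha>) * Gamma (real n + 3/2) * (1 / fact n) * (1 / fact (Suc n)) / sqrt pi *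
      x ^ Suc n * (1 - x) powr (- (\<alpha> + real n + 1/2)))"
    unfolding E_def qw' pw' G1 G2 e1 e2 Gamma_complex_of_real by simp
  have P1: "pochhammer (1/2 :: real) (Suc n) = Gamma (real n + 3/2) / sqrt pi"
  proof -
    have "pochhammer (1/2 :: real) (Suc n) = Gamma (1/2 + real (Suc n)) / Gamma (1/2)"
      by (rule pochhammer_Gamma) (auto elim!: nonpos_Ints_cases)
    thus ?thesis by (simp add: Gamma_one_half_real add_ac)
  qed
  have P2: "pochhammer \<alpha> (Suc n) = sin (pi * \<alpha>) / pi * Gamma (1 - \<alpha>) * Gamma A"
  proof -
    have nA: "A \<notin> \<int>\<^sub>\<le>\<^sub>0" "1 - \<alpha> \<notin> \<int>\<^sub>\<le>\<^sub>0" using A n by (auto elim!: nonpos_Ints_cases)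
    have "rGamma \<alpha> = pochhammer \<alpha> (Suc n) * rGamma A"
      using pochhammer_rGamma[of \<alpha> "Suc n"] by (simp add: A_def add_ac)
    hence 1: "pochhammer \<alpha> (Suc n) = rGamma \<alpha> * Gamma A"
      using nA Gamma_nonzero[of A] by (simp add: rGamma_inverse_Gamma)
    have "rGamma (complex_of_real \<alpha>) * rGamma (1 - complex_of_real \<alpha>) = sin (of_real pi * of_real \<alpha>) / of_real pi"
      by (rule rGamma_reflection_complex)
    hence "complex_of_real (rGamma \<alpha> * rGamma (1 - \<alpha>)) = of_real (sin (pi * \<alpha>) / pi)"
      by (simp flip: rGamma_complex_of_real sin_of_real)
    hence "rGamma \<alpha> * rGamma (1 - \<alpha>) = sin (pi * \<alpha>) / pi" by (simp only: of_real_eq_iff)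
    hence "rGamma \<alpha> = sin (pi * \<alpha>) / pi * Gamma (1 - \<alpha>)"
      using nA Gamma_nonzero[of "1 - \<alpha>"] by (simp add: rGamma_inverse_Gamma[of "1 - \<alpha>"] field_simps)
    thus ?thesis using 1 by simp
  qed
  have "complex_of_real (pochhammer \<alpha> (Suc n) * pochhammer (1/2) (Suc n) / fact (Suc n) * x ^ Suc n *
       (1 - x) powr (- (\<alpha> + real n + 1/2))) = of_real (sin (pi * \<alpha>) / pi * fact n) * E (dual a) w'"
    unfolding Eeq P1 P2 of_real_mult[symmetric] of_real_eq_iff by (simp add: mult_ac del: fact_Suc power_Suc)
  thus ?thesis using F_at_neg[of a n, folded \<alpha>_def] unfolding w'_def by simp
qed

end

text \<open>The device for cancelling a factor \<open>k\<close> with zeros from an identity: the set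
  where \<open>k\<close> does not vanish is open and nonempty, so the identity theorem
  applies.\<close>

lemma holomorphic_cancel:
  assumes S: "open S" "connected S" and hol: "g holomorphic_on S" "h holomorphic_on S" "k holomorphic_on S"
    and pt: "pt \<in> S" "k pt \<noteq> 0" and eq: "\<And>z. z \<in> S \<Longrightarrow> k z \<noteq> 0 \<Longrightarrow> g z = h z" and z: "z \<in> S"
  shows "g z = h z"
proof -
  define T where "T = {z \<in> S. k z \<noteq> 0}"
  have "open T"
  proof -
    have "continuous_on S k" using hol(3) by (rule holomorphic_on_imp_continuous_on)
    hence "open (S \<inter> k -` (- {0}))" by (rule continuous_open_preimage[OF _ S(1)]) auto
    moreover have "S \<inter> k -` (- {0}) = T" by (auto simp: T_def)
    ultimately show ?thesis by simp
  qed
  show ?thesis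
  proof (rule analytic_continuation_open[OF \<open>open T\<close> S(1) _ S(2) _ hol(1,2) _ z])
    show "T \<noteq> {}" using pt unfolding T_def by blast
    show "T \<subseteq> S" unfolding T_def by blast
    show "g w = h w" if "w \<in> T" for w using that eq unfolding T_def by blast
  qed
qed

text \<open>If \<open>cos \<theta> < 1\<close>, the positive sequence \<open>u\<close> has second
  differences \<open>- (2 - 2 cos \<theta>) u < 0\<close>. Its increments decrease; they cannot
  become negative, or \<open>u\<close> would. Thus \<open>u\<close> stays above \<open>u 0\<close>,
  and the increments drop by a fixed amount at each step, a contradiction.\<close>

lemma sin_eventually_sign_imp:
  fixes c \<theta> s :: real
  assumes s: "s = 1 \<or> s = -1" and pos: "\<And>k. k \<ge> K \<Longrightarrow> s * sin (c - real k * \<theta>) > 0"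
  shows "cos \<theta> = 1"
proof (rule ccontr)
  assume "cos \<theta> \<noteq> 1"
  hence C: "2 - 2 * cos \<theta> > 0" using cos_le_one[of \<theta>] by linarith
  define u where "u = (\<lambda>k. s * sin (c - real (K + k) * \<theta>))"
  have u_pos: "u k > 0" for k using pos[of "K + k"] by (simp add: u_def)
  have u_le: "u k \<le> 1" for k
    using s sin_le_one[of "c - real (K + k) * \<theta>"] sin_ge_minus_one[of "c - real (K + k) * \<theta>"] by (auto simp: u_def)
  define d where "d = (\<lambda>k. u (Suc k) - u k)"
  have rec: "d (Suc k) = d k - (2 - 2 * cos \<theta>) * u (Suc k)" for k
  proof -
    define y where "y = c - real (K + Suc k) * \<theta>"
    have "c - real (K + Suc (Suc k)) * \<theta> = y - \<theta>" "c - real (K + k) * \<theta> = y + \<theta>"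
      by (simp_all add: y_def algebra_simps)
    hence "u (Suc (Suc k)) + u k = s * (sin (y - \<theta>) + sin (y + \<theta>))" by (simp only: u_def ring_distribs)
    also have "\<dots> = 2 * cos \<theta> * (s * sin y)" by (simp add: sin_diff sin_add)
    also have "s * sin y = u (Suc k)" by (simp only: u_def y_def)
    finally show ?thesis by (simp add: d_def algebra_simps)
  qed
  have d_le: "d (j + k) \<le> d j" for j k
  proof (induction k)
    case (Suc k)
    have "(2 - 2 * cos \<theta>) * u (Suc (j + k)) \<ge> 0" using C u_pos by (intro mult_nonneg_nonneg) (auto intro: less_imp_le)
    thus ?case using Suc rec[of "j + k"] by simp
  qed simp
  have d_nonneg: "d j \<ge> 0" for j
  proof (rule ccontr)
    assume neg: "\<not> d j \<ge> 0"
    have *: "u (j + k) \<le> u j + real k * d j" for k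
    proof (induction k)
      case (Suc k)
      have "u (j + Suc k) = u (j + k) + d (j + k)" by (simp add: d_def)
      thus ?case using Suc d_le[of j k] by (simp add: algebra_simps)
    qed simp
    obtain k :: nat where "real k > u j / - d j" using reals_Archimedean2 by blast
    hence "u j + real k * d j < 0" using neg by (simp add: field_simps)
    with *[of k] u_pos[of "j + k"] show False by linarith
  qed
  have u_ge: "u k \<ge> u 0" for k
  proof (induction k)
    case (Suc k)
    thus ?case using d_nonneg[of k] by (simp add: d_def)
  qed simp
  have "d k \<le> d 0 - real k * ((2 - 2 * cos \<theta>) * u 0)" for k
  proof (induction k)
    case (Suc k)
    have "(2 - 2 * cos \<theta>) * u 0 \<le> (2 - 2 * cos \<theta>) * u (Suc k)" using C u_ge by (intro mult_left_mono) auto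
    thus ?case using Suc rec[of k] by (simp add: algebra_simps)
  qed simp
  moreover obtain k :: nat where "real k > d 0 / ((2 - 2 * cos \<theta>) * u 0)" using reals_Archimedean2 by blast
  hence "d 0 - real k * ((2 - 2 * cos \<theta>) * u 0) < 0" using C u_pos[of 0] by (simp add: field_simps)
  ultimately show False using d_nonneg[of k] by (meson not_le order_trans)
qed

section \<open>Reality, poles, and the balanced form of a gamma product formula\<close>

context hyp_params
begin

lemma cnj_hterm: "cnj (hterm a n w) = hterm a n (cnj w)"
  unfolding hterm_def pochhammer_prod by (simp add: cnj_rGamma)

lemma cnj_F: "cnj (F a w) = F a (cnj w)"
  unfolding F_def bounded_linear.suminf[OF bounded_linear_cnj summable_hterm] cnj_hterm ..

lemma f_of_real: "f a (of_real t) \<in> \<real>"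
proof -
  have "cnj (f a (of_real t)) = f a (of_real t)" by (simp add: f_def cnj_F cnj_Gamma)
  thus ?thesis by (simp add: Reals_cnj_iff)
qed

lemma E_of_real:
  assumes "(r - p) * t - b > 0" "p * t + b > 0" "r * t > 1"
  obtains y where "E b (of_real t) = of_real y" "y > 0"
proof -
  have *: "exp (of_real c * of_real y) = complex_of_real (exp (c * y))" for c y by (simp flip: exp_of_real)
  define y where "y = Gamma ((r - p) * t - b) * Gamma (p * t + b) * Gamma (r * t - 1/2) *
      rGamma (r * t - 1) * rGamma (r * t) / sqrt pi * exp (ln x * (r * t - 1)) * exp (ln (1 - x) * (1/2 + b - (r - p) * t))"
  have "E b (of_real t) = Gamma (of_real ((r - p) * t - b)) * Gamma (of_real (p * t + b)) *
     Gamma (of_real (r * t - 1/2)) * rGamma (of_real (r * t - 1)) * rGamma (of_real (r * t)) / of_real (sqrt pi) *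
     exp (of_real (ln x) * of_real (r * t - 1)) * exp (of_real (ln (1 - x)) * of_real (1/2 + b - (r - p) * t))"
    by (simp add: E_def)
  also have "\<dots> = of_real y"
    unfolding y_def Gamma_complex_of_real rGamma_complex_of_real * by simp
  finally have "E b (of_real t) = of_real y" .
  moreover have "rGamma (r * t - 1) > 0" "rGamma (r * t) > 0" using assms by (auto simp: rGamma_inverse_Gamma)
  hence "y > 0" unfolding y_def using assms by (intro mult_pos_pos divide_pos_pos) auto
  ultimately show ?thesis by (rule that)
qed

text \<open>The series stops after the index \<open>k\<close>. Because \<open>c < - k\<close>, all
  factors in the Pochhammer symbols of \<open>- k\<close> and of \<open>c\<close> are negative up to
  there; the signs cancel and every term is positive.\<close>

lemma F_nonzero_terminating:
  assumes w: "of_real p * w + of_real a = - of_nat k" "of_real r * w = of_real c" and c: "c < - real k" "of_real c \<notin> (\<int>\<^sub>\<le>\<^sub>0 :: complex set)"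
  shows "F a w \<noteq> 0"
proof -
  define y where "y = (\<lambda>n. pochhammer (- real k) n / pochhammer c n * (pochhammer (1/2) n / fact n * x ^ n))"
  have nz: "of_real r * w \<notin> \<int>\<^sub>\<le>\<^sub>0" using c w by simp
  have sgn: "pochhammer y n * (-1) ^ n > 0" if "\<And>i. i < n \<Longrightarrow> y + real i < 0" for y :: real and n
    using that
  proof (induction n)
    case (Suc n)
    have "y + real n < 0" by (rule Suc.prems) simp
    hence "- (y + real n) > 0" by simp
    moreover have "pochhammer y n * (-1) ^ n > 0" using Suc by auto
    ultimately have "(pochhammer y n * (-1) ^ n) * (- (y + real n)) > 0" by (metis mult_pos_pos)
    thus ?case by (simp add: pochhammer_Suc algebra_simps)
  qed simp
  have pos: "y n > 0" if "n \<le> k" for n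
  proof -
    have "pochhammer (- real k) n * (-1) ^ n > 0" "pochhammer c n * (-1) ^ n > 0" using that c by (intro sgn; linarith)+
    hence "(pochhammer (- real k) n * (-1) ^ n) / (pochhammer c n * (-1) ^ n) > 0" by (rule divide_pos_pos)
    hence "pochhammer (- real k) n / pochhammer c n > 0" by simp
    thus ?thesis unfolding y_def using half_poch_bounds[of n] x_pos by (intro mult_pos_pos zero_less_power) auto
  qed
  have zero: "y n = 0" if "n > k" for n
    using that by (simp add: y_def pochhammer_eq_0_iff) 
  have "f a w = (\<Sum>n. of_real (y n))"
    unfolding f_eq_suminf[OF nz] w y_def by (simp flip: pochhammer_of_real)
  also have "\<dots> = (\<Sum>n\<le>k. of_real (y n))"
    by (rule suminf_finite) (use zero in auto)
  also have "\<dots> = of_real (\<Sum>n\<le>k. y n)" by simp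
  finally have "f a w = of_real (\<Sum>n\<le>k. y n)" .
  moreover have "(\<Sum>n\<le>k. y n) > 0" using pos by (intro sum_pos) auto
  ultimately have "f a w \<noteq> 0" by (metis less_irrefl of_real_eq_0_iff)
  thus ?thesis by (auto simp: f_def)
qed

lemma holomorphic_f: "(\<And>w. w \<in> A \<Longrightarrow> of_real r * w \<notin> \<int>\<^sub>\<le>\<^sub>0) \<Longrightarrow> f a holomorphic_on A"
  unfolding f_def by (intro holomorphic_intros) auto

text \<open>Being a pole depends on a punctured neighbourhood only, so the default values of
  \<open>hgf\<close> do no harm. At a pole of \<open>Gamma (r w)\<close> a zero of
  \<open>F a\<close> cancels the simple pole: splitting off the vanishing Pochhammer factor leaves a
  difference quotient of \<open>F a\<close>, with a finite limit.\<close>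

lemma is_pole_hgf_iff: "is_pole (hgf p 0 r a (1/2) x) w \<longleftrightarrow> (\<exists>n::nat. w = - of_nat n / of_real r \<and> F a w \<noteq> 0)"
proof -
  have ev0: "eventually (\<lambda>z. of_real r * z \<notin> \<int>\<^sub>\<le>\<^sub>0) (at w)"
    proof -
      have "(\<lambda>z. rGamma (of_real r * z)) holomorphic_on UNIV" by (intro holomorphic_intros)
      moreover have "rGamma (of_real r * (1 / of_real r)) \<noteq> (0::complex)" using r_pos by simp
      ultimately have "eventually (\<lambda>z. rGamma (of_real r * z) \<noteq> 0) (at w)"
        using non_zero_neighbour_alt[of "\<lambda>z. rGamma (of_real r * z)" UNIV w "1 / of_real r"]
        by (auto elim: eventually_mono)
      thus ?thesis by eventually_elim (auto simp: rGamma_eq_zero_iff)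
    qed
  hence ev: "eventually (\<lambda>z. hgf p 0 r a (1/2) x z = f a z) (at w)"
    by eventually_elim (rule hgf_eq_f)
  have "is_pole (hgf p 0 r a (1/2) x) w \<longleftrightarrow> is_pole (f a) w"
    by (rule is_pole_cong[OF ev refl])
  also have "\<dots> \<longleftrightarrow> (\<exists>n::nat. w = - of_nat n / of_real r \<and> F a w \<noteq> 0)"
  proof (cases "of_real r * w \<in> \<int>\<^sub>\<le>\<^sub>0")
    case False
    hence "isCont (f a) w" unfolding f_def by (intro continuous_intros isCont_F) 
    hence "\<not> is_pole (f a) w" unfolding is_pole_def isCont_def
      using not_tendsto_and_filterlim_at_infinity[of "at w"] by auto
    moreover have "w \<noteq> - of_nat n / of_real r" for n using False r_pos by auto
    ultimately show ?thesis by auto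
  next
    case True
    then obtain n :: nat where n: "of_real r * w = - of_nat n" by (auto elim!: nonpos_Ints_cases')
    hence w: "w = - of_nat n / of_real r" using r_pos by (simp add: field_simps)
    have lim: "filterlim (\<lambda>z. of_real r * z) (at (- of_nat n)) (at w)"
      unfolding n[symmetric] using r_pos
      by (intro filterlim_atI tendsto_intros) (auto simp: eventually_at_filter)
    show ?thesis
    proof (cases "F a w = 0")
      case False
      have "filterlim (\<lambda>z. Gamma (of_real r * z)) at_infinity (at w)"
        by (rule filterlim_compose[OF Gamma_poles lim])
      moreover have "(F a \<longlongrightarrow> F a w) (at w)" using isCont_F isCont_def by blast
      ultimately have "filterlim (f a) at_infinity (at w)"
        unfolding f_def using False by (subst mult.commute) (rule tendsto_mult_filterlim_at_infinity)
      thus ?thesis using False w by (auto simp: is_pole_def)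
    next
      case True
      have "(F a has_field_derivative deriv (F a) w) (at w)"
        using holomorphic_derivI[OF holomorphic_F open_UNIV, of w] by simp
      hence d: "((\<lambda>z. (F a z - F a w) / (z - w)) \<longlongrightarrow> deriv (F a) w) (at w)"
        by (simp add: has_field_derivative_iff)
      have p_nz: "pochhammer (of_real r * w) n \<noteq> 0"
        unfolding n pochhammer_eq_0_iff by auto
      have poch_lim: "((\<lambda>z. pochhammer (of_real r * z) n) \<longlongrightarrow> pochhammer (of_real r * w) n) (at w)"
        unfolding pochhammer_prod by (intro tendsto_intros)
      have g_nz: "of_real r * w + of_nat (Suc n) \<notin> \<int>\<^sub>\<le>\<^sub>0" unfolding n by (intro not_nonpos_Ints_if_Re_pos) simp
      have "((\<lambda>z. Gamma (of_real r * z + of_nat (Suc n)) / pochhammer (of_real r * z) n * ((F a z - F a w) / (z - w)) / of_real r) \<longlongrightarrow>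
             Gamma (of_real r * w + of_nat (Suc n)) / pochhammer (of_real r * w) n * deriv (F a) w / of_real r) (at w)"
        using p_nz g_nz r_pos by (intro tendsto_intros d poch_lim) auto
      moreover have "eventually (\<lambda>z. Gamma (of_real r * z + of_nat (Suc n)) / pochhammer (of_real r * z) n * ((F a z - F a w) / (z - w)) / of_real r = f a z) (at w)"
        using ev0 eventually_neq_at_within[of w w]
      proof eventually_elim
        case (elim z)
        have "of_real r * z + of_nat n = of_real r * (z - w)" using n by (simp add: algebra_simps)
        hence "pochhammer (of_real r * z) (Suc n) = pochhammer (of_real r * z) n * (of_real r * (z - w))"
          by (simp add: pochhammer_Suc)
        moreover have "pochhammer (of_real r * z) (Suc n) = Gamma (of_real r * z + of_nat (Suc n)) / Gamma (of_real r * z)"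
          by (rule pochhammer_Gamma[OF elim(1)])
        moreover have "pochhammer (of_real r * z) (Suc n) \<noteq> 0"
          using elim(1) pochhammer_eq_0_imp_nonpos_Int by blast
        moreover have "g = G / (P * q)" if "P' = P * q" "P' = G / g" "P' \<noteq> 0" for P P' q G g :: complex
        proof -
          have "g \<noteq> 0" "P * q \<noteq> 0" using that by auto
          moreover from this have "G = (P * q) * g" using that by (metis nonzero_eq_divide_eq)
          ultimately show ?thesis by simp
        qed
        ultimately have "Gamma (of_real r * z) = Gamma (of_real r * z + of_nat (Suc n)) / (pochhammer (of_real r * z) n * (of_real r * (z - w)))"
          by blast
        thus ?case using True by (simp add: f_def)
      qed
      ultimately have "(f a \<longlongrightarrow> Gamma (of_real r * w + of_nat (Suc n)) / pochhammer (of_real r * w) n * deriv (F a) w / of_real r) (at w)"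
        by (rule Lim_transform_eventually)
      hence "\<not> is_pole (f a) w" unfolding is_pole_def
        using not_tendsto_and_filterlim_at_infinity[of "at w"] by auto
      thus ?thesis using True by auto
    qed
  qed
  finally show ?thesis .
qed

lemma elementary_iff: "is_elementary p 0 r a (1/2) x \<longleftrightarrow> finite {n::nat. F a (- of_nat n / of_real r) \<noteq> 0}"
proof -
  have inj: "inj_on (\<lambda>n. - complex_of_nat n / of_real r) A" for A using r_pos by (auto simp: inj_on_def)
  have "{w. is_pole (hgf p 0 r a (1/2) x) w} = (\<lambda>n. - of_nat n / of_real r) ` {n::nat. F a (- of_nat n / of_real r) \<noteq> 0}"
    unfolding is_pole_hgf_iff by auto
  thus ?thesis unfolding is_elementary_def by (simp only: finite_image_iff[OF inj])
qed

text \<open>Multiplication by \<open>rGamma (r w) * rgprod us w\<close> removes all denominators.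
  Where this factor vanishes the hypothesis says nothing, and the identity theorem fills the
  gaps.\<close>

lemma GPF_imp_entire:
  assumes "is_GPF_solution p 0 r a (1/2) x"
  shows "\<exists>C \<delta> us vs. C \<noteq> 0 \<and> (\<forall>w. F a w * rgprod us w = C * exp (\<delta> * w) * rGamma (of_real r * w) * rgprod vs w)"
proof -
  obtain C \<delta> us vs where C: "C \<noteq> 0" and eq: "\<And>w. of_real r * w \<notin> \<int>\<^sub>\<le>\<^sub>0 \<Longrightarrow> (\<forall>u\<in>set us. w + u \<notin> \<int>\<^sub>\<le>\<^sub>0) \<Longrightarrow>
           hgf p 0 r a (1/2) x w =
             C * exp (\<delta> * w) * prod_list (map (\<lambda>u. Gamma (w + u)) us)
               * prod_list (map (\<lambda>v. rGamma (w + v)) vs)"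
    using assms unfolding is_GPF_solution_def by blast
  define k where "k = (\<lambda>w. rGamma (of_real r * w) * rgprod us w)"
  obtain R where R: "R > 0" "\<And>w. Re w \<ge> R \<Longrightarrow> rgprod us w \<noteq> 0" using rgprod_nonzero_right by blast
  define g where "g = (\<lambda>w. F a w * rgprod us w)"
  define h where "h = (\<lambda>w. C * exp (\<delta> * w) * rGamma (of_real r * w) * rgprod vs w)"
  have gh: "g w = h w" for w
  proof (rule holomorphic_cancel[where S = UNIV and k = k and pt = "of_real R" and g = g and h = h and z = w])
    show "g holomorphic_on UNIV" unfolding g_def by (intro holomorphic_intros holomorphic_F holomorphic_rgprod)
    show "h holomorphic_on UNIV" unfolding h_def by (intro holomorphic_intros holomorphic_rgprod)
    show "k holomorphic_on UNIV" unfolding k_def by (intro holomorphic_intros holomorphic_rgprod)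
    show "k (of_real R) \<noteq> 0"
      using R r_w_not_nonpos_Int[of "of_real R"] by (auto simp: k_def rGamma_eq_zero_iff)
    fix z assume "k z \<noteq> 0"
    hence nz: "of_real r * z \<notin> \<int>\<^sub>\<le>\<^sub>0" "rgprod us z \<noteq> 0" by (auto simp: k_def rGamma_eq_zero_iff)
    hence "hgf p 0 r a (1/2) x z = C * exp (\<delta> * z) * prod_list (map (\<lambda>u. Gamma (z + u)) us)
               * prod_list (map (\<lambda>v. rGamma (z + v)) vs)" by (intro eq) (auto simp: rgprod_eq_0_iff)
    hence "Gamma (of_real r * z) * F a z = C * exp (\<delta> * z) * inverse (rgprod us z) * rgprod vs z"
      unfolding hgf_eq_f[OF nz(1)] f_def prod_list_Gamma_eq rgprod_def[symmetric] .
    thus "g z = h z"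
      unfolding g_def h_def using nz by (simp add: rGamma_inverse_Gamma Gamma_eq_zero_iff field_simps)
  qed auto
  thus ?thesis unfolding g_def h_def using C by blast
qed

lemma entire_imp_GPF:
  assumes "C \<noteq> 0" "\<And>w. F a w * rgprod us w = C * exp (\<delta> * w) * rGamma (of_real r * w) * rgprod vs w"
  shows "is_GPF_solution p 0 r a (1/2) x"
  unfolding is_GPF_solution_def
proof (intro exI conjI allI impI)
  show "C \<noteq> 0" by fact
  fix w assume w: "of_real r * w \<notin> \<int>\<^sub>\<le>\<^sub>0" "\<forall>u\<in>set us. w + u \<notin> \<int>\<^sub>\<le>\<^sub>0"
  hence "rgprod us w \<noteq> 0" by (auto simp: rgprod_eq_0_iff)
  thus "hgf p 0 r a (1/2) x w = C * exp (\<delta> * w) * prod_list (map (\<lambda>u. Gamma (w + u)) us)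
               * prod_list (map (\<lambda>v. rGamma (w + v)) vs)"
    unfolding hgf_eq_f[OF w(1)] f_def prod_list_Gamma_eq rgprod_def[symmetric]
    using assms(2)[of w] w(1) by (simp add: rGamma_inverse_Gamma Gamma_eq_zero_iff field_simps)
qed

definition gpf :: "real \<Rightarrow> complex list \<Rightarrow> complex list \<Rightarrow> bool" where
  "gpf a us vs \<longleftrightarrow> length us = length vs \<and> sum_list us = sum_list vs \<and>
     (\<forall>w. F a w * rgprod us w = of_real L * rGamma (of_real r * w) * rgprod vs w)"

lemma filterlim_Re_shift: "filterlim (\<lambda>n. Re (w + of_nat n)) at_top sequentially"
  by (simp, intro filterlim_tendsto_add_at_top[OF tendsto_const] filterlim_real_sequentially)

text \<open>Balance gives \<open>exp \<delta> = 1\<close>, which still allows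
  \<open>exp (\<delta> * w)\<close> to vary with \<open>w\<close> as a nontrivial function of period
  1. Since the limit along \<open>w + n\<close> is \<open>L\<close> for every starting point
  \<open>w\<close>, the product \<open>C * exp (\<delta> * w)\<close> equals \<open>L\<close>
  everywhere.\<close>

lemma GPF_imp_gpf:
  assumes "is_GPF_solution p 0 r a (1/2) x"
  obtains us vs where "gpf a us vs"
proof -
  obtain C \<delta> us vs where C: "C \<noteq> 0" and
    eq: "\<forall>w. F a w * rgprod us w = C * exp (\<delta> * w) * rGamma (of_real r * w) * rgprod vs w"
    using GPF_imp_entire[OF assms] by blast
  define q where "q = (\<lambda>w. exp (\<delta> * w) * (rgprod vs w / rgprod us w))"
  have lim: "(\<lambda>n. q (w + of_nat n)) \<longlonglongrightarrow> of_real L / C" for w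
  proof -
    have "(\<lambda>n. f a (w + of_nat n) / C) \<longlonglongrightarrow> of_real L / C"
      by (intro tendsto_divide f_tendsto_L filterlim_Re_shift tendsto_const C)
    moreover have "eventually (\<lambda>n. f a (w + of_nat n) / C = q (w + of_nat n)) sequentially"
    proof -
      have "eventually (\<lambda>n. Re (w + of_nat n) > 0) sequentially"
        using filterlim_Re_shift[of w] unfolding filterlim_at_top_dense by blast
      thus ?thesis using eventually_rgprod_shift_nonzero[of us w]
      proof eventually_elim
        case (elim n)
        define z where "z = w + of_nat n"
        have "of_real r * z \<notin> \<int>\<^sub>\<le>\<^sub>0" using elim by (intro r_w_not_nonpos_Int) (simp add: z_def)
        hence "f a z / C = q z" using spec[OF eq, of z] C elim
          by (simp add: f_def q_def rGamma_inverse_Gamma Gamma_eq_zero_iff field_simps flip: z_def)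
        thus ?case by (simp add: z_def)
      qed
    qed
    ultimately show ?thesis by (rule Lim_transform_eventually)
  qed
  have LC: "of_real L / C \<noteq> 0" using L_pos C by auto
  note bal = rgprod_ratio_balance[OF lim[unfolded q_def] LC]
  have "C * exp (\<delta> * w) = of_real L" for w
  proof -
    have "exp (\<delta> * (w + of_nat n)) = exp (\<delta> * w)" for n
      using bal(2) by (simp add: ring_distribs exp_add exp_of_nat_mult mult.commute[of \<delta> "of_nat n"])
    hence "(\<lambda>n. exp (\<delta> * w) * (rgprod vs (w + of_nat n) / rgprod us (w + of_nat n))) \<longlonglongrightarrow> of_real L / C"
      using lim[of w] unfolding q_def by simp
    moreover have "(\<lambda>n. exp (\<delta> * w) * (rgprod vs (w + of_nat n) / rgprod us (w + of_nat n))) \<longlonglongrightarrow> exp (\<delta> * w) * 1"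
      by (intro tendsto_intros rgprod_ratio_shift_tendsto_1 bal)
    ultimately have "exp (\<delta> * w) * 1 = of_real L / C" using LIMSEQ_unique by blast
    thus ?thesis using C by (simp add: field_simps)
  qed
  hence "gpf a us vs" unfolding gpf_def using bal eq by simp
  thus ?thesis by (rule that)
qed

end

section \<open>Reflection of a gamma product formula\<close>

definition sinprod :: "complex list \<Rightarrow> complex \<Rightarrow> complex" where
  "sinprod us w = prod_list (map (\<lambda>u. sin (of_real pi * (w + u))) us)"

lemma sinprod_Nil [simp]: "sinprod [] w = 1"
  and sinprod_Cons [simp]: "sinprod (u # us) w = sin (of_real pi * (w + u)) * sinprod us w"
  by (simp_all add: sinprod_def)

lemma holomorphic_sinprod: "sinprod us holomorphic_on A"
proof -
  have "(\<lambda>w. sinprod us w) holomorphic_on A"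
    by (induction us) (auto intro!: holomorphic_intros)
  thus ?thesis by simp
qed

lemma holomorphic_rgprod' [holomorphic_intros]:
  "g holomorphic_on A \<Longrightarrow> (\<lambda>w. rgprod us (g w)) holomorphic_on A"
  by (induction us) (auto intro!: holomorphic_intros)

lemma rgprod_reflection:
  "rgprod us w * rgprod (map (\<lambda>u. 1 - u) us) (- w) * of_real pi ^ length us = sinprod us w"
proof (induction us)
  case (Cons u us)
  have "rGamma (w + u) * rGamma (- w + (1 - u)) = sin (of_real pi * (w + u)) / of_real pi"
    using rGamma_reflection_complex[of "w + u"] by (simp add: algebra_simps)
  hence *: "rGamma (w + u) * rGamma (- w + (1 - u)) * of_real pi = sin (of_real pi * (w + u))" by simp
  have "rgprod (u # us) w * rgprod (map (\<lambda>u. 1 - u) (u # us)) (- w) * of_real pi ^ length (u # us) =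
     (rGamma (w + u) * rGamma (- w + (1 - u)) * of_real pi) * (rgprod us w * rgprod (map (\<lambda>u. 1 - u) us) (- w) * of_real pi ^ length us)"
    by (simp add: mult_ac)
  thus ?case unfolding * Cons by simp
qed simp

lemma sin_pi_minus_one: "sin (of_real pi * (w - 1)) = - sin (of_real pi * w :: complex)"
proof -
  have "of_real pi * (w - 1) = of_real pi * w - of_real pi" by (simp add: algebra_simps)
  moreover have "sin (of_real pi :: complex) = 0" "cos (of_real pi :: complex) = -1"
    by (simp_all flip: sin_of_real cos_of_real)
  ultimately show ?thesis by (simp add: sin_diff)
qed

lemma sinprod_minus_one: "sinprod us (w - 1) = (-1) ^ length us * sinprod us w"
proof (induction us)
  case (Cons u us)
  have "w - 1 + u = (w + u) - 1" by simp
  thus ?case using Cons sin_pi_minus_one[of "w + u"] by (simp only: sinprod_Cons list.size) simp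
qed simp

lemma sin_pi_eq_0_iff: "sin (of_real pi * w :: complex) = 0 \<longleftrightarrow> w \<in> \<int>"
proof -
  have "sin (of_real pi * w) = 0 \<longleftrightarrow> (\<exists>n::int. of_real pi * w = of_real (of_int n * pi))"
    unfolding sin_eq_0 by auto
  also have "\<dots> \<longleftrightarrow> (\<exists>n::int. w = of_int n)"
    by (rule ex_cong1) (simp add: mult.commute)
  also have "\<dots> \<longleftrightarrow> w \<in> \<int>" by (auto simp: Ints_def)
  finally show ?thesis .
qed

lemma sinprod_nonzero:
  obtains Y where "\<And>w. \<bar>Im w\<bar> \<ge> Y \<Longrightarrow> sinprod us w \<noteq> 0"
proof
  define Y where "Y = 1 + (\<Sum>u\<leftarrow>us. norm u)"
  fix w assume w: "\<bar>Im w\<bar> \<ge> Y"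
  show "sinprod us w \<noteq> 0"
  proof
    assume "sinprod us w = 0"
    then obtain u where u: "u \<in> set us" "sin (of_real pi * (w + u)) = 0"
      unfolding sinprod_def prod_list_zero_iff by auto
    hence "w + u \<in> \<int>" by (simp add: sin_pi_eq_0_iff)
    hence "Im (w + u) = 0" by (metis Ints_cases complex_Im_of_int)
    moreover have "norm u \<le> (\<Sum>u\<leftarrow>us. norm u)" using u(1) by (rule norm_le_sum_list_norm)
    moreover have "\<bar>Im u\<bar> \<le> norm u" by (rule abs_Im_le_cmod)
    ultimately show False using w by (simp add: Y_def)
  qed
qed

lemma sin_add_nat_pi: "sin (y + pi * real m) = (-1) ^ m * sin y"
  by (simp add: sin_add mult.commute[of pi])

lemma rgprod_shift: "rgprod vs (w - c) = rgprod (map (\<lambda>v. v - c) vs) w"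
  by (induction vs) (simp_all add: algebra_simps)

context hyp_params
begin

text \<open>For \<open>r = s p\<close> this is \<open>p\<close> times the logarithm of the quotient of the two terms of \<open>\<phi>\<^sub>s(x)\<close>.\<close>
definition log_eq :: real where
  "log_eq = (r - p) * ln (r - p) + p * ln p - r * ln r + r * ln x - (r - p) * ln (1 - x)"

text \<open>The multiplication formula contributes a rate \<open>m ln m\<close> for each Gamma
  factor. Of the three factors with argument near \<open>r w\<close> one is in the numerator and two
  are in the denominator, so they leave \<open>- r ln r\<close>; together with the powers of
  \<open>x\<close> and \<open>1 - x\<close> the total is \<open>log_eq\<close>, whatever the value
  of \<open>b\<close>.\<close>

lemma E_gamma_form:
  assumes pn: "p = real pn" and rn: "r = real rn"
  obtains c U V where "c \<noteq> 0" "\<And>w. E b w = c * exp (of_real log_eq * w) * (rgprod V w / rgprod U w)"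
proof -
  have pos: "pn > 0" "rn > pn" "rn > 0" using p_pos p_less_r pn rn by auto
  define qn where "qn = rn - pn"
  have qn: "qn > 0" "real qn = r - p" using pos pn rn by (auto simp: qn_def of_nat_diff)
  define A where "A = (\<lambda>m::nat. complex_of_real (real m * ln (real m)))"
  obtain C1 where C1: "C1 \<noteq> 0" "\<And>w. rGamma (of_nat qn * w + of_real (-b)) = C1 * exp (- A qn * w) * rgprod (map (\<lambda>i. (of_real (-b) + of_nat i) / of_nat qn) [0..<qn]) w"
    using rGamma_multiplication[OF qn(1), of "of_real (-b)"] unfolding A_def by blast
  obtain C2 where C2: "C2 \<noteq> 0" "\<And>w. rGamma (of_nat pn * w + of_real b) = C2 * exp (- A pn * w) * rgprod (map (\<lambda>i. (of_real b + of_nat i) / of_nat pn) [0..<pn]) w"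
    using rGamma_multiplication[OF pos(1), of "of_real b"] unfolding A_def by blast
  obtain C3 where C3: "C3 \<noteq> 0" "\<And>w. rGamma (of_nat rn * w + (-1/2)) = C3 * exp (- A rn * w) * rgprod (map (\<lambda>i. (-1/2 + of_nat i) / of_nat rn) [0..<rn]) w"
    using rGamma_multiplication[OF pos(3), of "-1/2"] unfolding A_def by blast
  obtain C4 where C4: "C4 \<noteq> 0" "\<And>w. rGamma (of_nat rn * w + (-1)) = C4 * exp (- A rn * w) * rgprod (map (\<lambda>i. (-1 + of_nat i) / of_nat rn) [0..<rn]) w"
    using rGamma_multiplication[OF pos(3), of "-1"] unfolding A_def by blast
  obtain C5 where C5: "C5 \<noteq> 0" "\<And>w. rGamma (of_nat rn * w + 0) = C5 * exp (- A rn * w) * rgprod (map (\<lambda>i. (0 + of_nat i) / of_nat rn) [0..<rn]) w"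
    using rGamma_multiplication[OF pos(3), of "0"] unfolding A_def by blast
  define P1 where "P1 = map (\<lambda>i. (of_real (-b) + of_nat i) / (of_nat qn :: complex)) [0..<qn]"
  define P2 where "P2 = map (\<lambda>i. (of_real b + of_nat i) / (of_nat pn :: complex)) [0..<pn]"
  define P3 where "P3 = map (\<lambda>i. (-1/2 + of_nat i) / (of_nat rn :: complex)) [0..<rn]"
  define P4 where "P4 = map (\<lambda>i. (-1 + of_nat i) / (of_nat rn :: complex)) [0..<rn]"
  define P5 where "P5 = map (\<lambda>i. (0 + of_nat i) / (of_nat rn :: complex)) [0..<rn]"
  define B where "B = complex_of_real (r * ln x)"
  define D where "D = complex_of_real ((r - p) * ln (1 - x))"
  define c where "c = C4 * C5 / (C1 * C2 * C3 * of_real (sqrt pi)) * exp (- of_real (ln x)) * exp (of_real (ln (1 - x) * (1/2 + b)))"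
  have "E b w = c * exp (of_real log_eq * w) * (rgprod (P4 @ P5) w / rgprod (P1 @ P2 @ P3) w)" for w
  proof -
    have cq: "complex_of_real (r - p) = of_nat qn" by (simp only: qn(2)[symmetric] of_real_of_nat_eq)
    have cp: "complex_of_real p = of_nat pn" by (simp only: pn of_real_of_nat_eq)
    have cr: "complex_of_real r = of_nat rn" by (simp only: rn of_real_of_nat_eq)
    have G: "Gamma (of_real (r - p) * w - of_real b) = inverse (C1 * exp (- A qn * w) * rgprod P1 w)"
      "Gamma (of_real p * w + of_real b) = inverse (C2 * exp (- A pn * w) * rgprod P2 w)"
      "Gamma (of_real r * w - 1/2) = inverse (C3 * exp (- A rn * w) * rgprod P3 w)"
      "rGamma (of_real r * w - 1) = C4 * exp (- A rn * w) * rgprod P4 w"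
      "rGamma (of_real r * w) = C5 * exp (- A rn * w) * rgprod P5 w"
      using C1(2)[of w] C2(2)[of w] C3(2)[of w] C4(2)[of w] C5(2)[of w]
      unfolding cq cp cr Gamma_def P1_def P2_def P3_def P4_def P5_def by simp_all
    have mA: "exp (- A m * w) = inverse (exp (A m * w))" for m by (simp add: exp_minus)
    have x1: "exp (of_real (ln x) * (of_real r * w - 1)) = exp (B * w) * exp (- of_real (ln x))"
      by (simp add: B_def ring_distribs mult_ac flip: exp_add)
    have x2: "exp (of_real (ln (1 - x)) * (1/2 + of_real b - of_real (r - p) * w)) = exp (of_real (ln (1 - x) * (1/2 + b))) * inverse (exp (D * w))"
    proof -
      have "of_real (ln (1 - x)) * (1/2 + of_real b - of_real (r - p) * w) = of_real (ln (1 - x) * (1/2 + b)) + - (D * w)"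
        by (simp add: D_def algebra_simps)
      thus ?thesis by (simp only: exp_add exp_minus)
    qed
    have le0: "log_eq = real qn * ln (real qn) + real pn * ln (real pn) - real rn * ln (real rn) + r * ln x - (r - p) * ln (1 - x)"
      unfolding log_eq_def qn(2) by (simp flip: pn rn)
    have le: "of_real log_eq * w = A qn * w + A pn * w + A rn * w - A rn * w - A rn * w + B * w - D * w"
      unfolding le0 A_def B_def D_def by (simp add: algebra_simps)
    have lex: "exp (of_real log_eq * w) = exp (A qn * w) * exp (A pn * w) * exp (A rn * w) * inverse (exp (A rn * w)) * inverse (exp (A rn * w)) * exp (B * w) * inverse (exp (D * w))"
      unfolding le by (simp add: exp_add exp_diff exp_minus field_simps)
    have "E b w = inverse (C1 * inverse (exp (A qn * w)) * rgprod P1 w) * inverse (C2 * inverse (exp (A pn * w)) * rgprod P2 w) *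
       inverse (C3 * inverse (exp (A rn * w)) * rgprod P3 w) * (C4 * inverse (exp (A rn * w)) * rgprod P4 w) * (C5 * inverse (exp (A rn * w)) * rgprod P5 w) /
       of_real (sqrt pi) * (exp (B * w) * exp (- of_real (ln x))) * (exp (of_real (ln (1 - x) * (1/2 + b))) * inverse (exp (D * w)))"
      unfolding E_def G x1 x2 mA ..
    also have "\<dots> = c * exp (of_real log_eq * w) * (rgprod (P4 @ P5) w / rgprod (P1 @ P2 @ P3) w)"
      unfolding lex rgprod_append c_def divide_inverse inverse_mult_distrib inverse_inverse_eq
      by (simp add: mult_ac)
    finally show ?thesis .
  qed
  moreover have "c \<noteq> 0" unfolding c_def using C1 C2 C3 C4 C5 by simp
  ultimately show ?thesis using that by blast
qed

end

text \<open>These assumptions are preserved by duality, which allows a second interpretation at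
  \<open>dual a\<close>.\<close>

locale gpf_ctx = hyp_params +
  fixes a :: real and us vs :: "complex list"
  assumes gpf: "gpf a us vs" and infinite_poles: "infinite {n::nat. F a (- of_nat n / of_real r) \<noteq> 0}"
begin

abbreviation b :: real where "b \<equiv> dual a"

definition us' :: "complex list" where "us' = map (\<lambda>u. 1 - u) us"
definition vs' :: "complex list" where "vs' = map (\<lambda>v. 1 - v) vs"

text \<open>Fixed once by choice, because the half plane \<open>Re w < - R\<close> is the common
  domain of the statements below.\<close>

definition R :: real where
  "R = (SOME R. R > 0 \<and> (\<forall>w. Re w \<ge> R \<longrightarrow> rgprod us' w \<noteq> 0 \<and> rgprod vs' w \<noteq> 0))"

lemma R: "R > 0" "Re w \<ge> R \<Longrightarrow> rgprod us' w \<noteq> 0" "Re w \<ge> R \<Longrightarrow> rgprod vs' w \<noteq> 0"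
proof -
  obtain R1 where R1: "R1 > 0" "\<And>w. Re w \<ge> R1 \<Longrightarrow> rgprod us' w \<noteq> 0" using rgprod_nonzero_right by blast
  obtain R2 where R2: "R2 > 0" "\<And>w. Re w \<ge> R2 \<Longrightarrow> rgprod vs' w \<noteq> 0" using rgprod_nonzero_right by blast
  have "\<exists>R. R > 0 \<and> (\<forall>w. Re w \<ge> R \<longrightarrow> rgprod us' w \<noteq> 0 \<and> rgprod vs' w \<noteq> 0)"
    by (rule exI[of _ "max R1 R2"]) (use R1 R2 in auto)
  from someI_ex[OF this, folded R_def]
  show "R > 0" "Re w \<ge> R \<Longrightarrow> rgprod us' w \<noteq> 0" "Re w \<ge> R \<Longrightarrow> rgprod vs' w \<noteq> 0" by auto
qed

lemma len: "length us = length vs" and sum: "sum_list us = sum_list vs"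
  and gpf_eq: "F a w * rgprod us w = of_real L * rGamma (of_real r * w) * rgprod vs w"
  using gpf unfolding gpf_def by auto

lemma len': "length us' = length vs'" and sum': "sum_list us' = sum_list vs'"
proof -
  have s: "sum_list (map (\<lambda>u. 1 - u) us) = of_nat (length us) - sum_list us" for us :: "complex list"
    by (induction us) simp_all
  show "length us' = length vs'" "sum_list us' = sum_list vs'"
    unfolding us'_def vs'_def s using len sum by simp_all
qed

definition Mh :: "complex \<Rightarrow> complex" where "Mh z = rgprod us' z / rgprod vs' z"

lemma Mh_tendsto: "(\<lambda>n. Mh (z + of_nat n)) \<longlonglongrightarrow> 1"
  unfolding Mh_def by (intro rgprod_ratio_shift_tendsto_1 len'[symmetric] sum'[symmetric])

text \<open>On \<open>Re w \<le> - R\<close> this is \<open>L / pi\<close> times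
  \<open>sin (pi * r * w) * sinprod vs w / sinprod us w\<close>. Expressed through
  \<open>F a\<close> it is visibly holomorphic there: the only denominator is
  \<open>rgprod us' (- w)\<close>.\<close>

definition Phi :: "complex \<Rightarrow> complex" where
  "Phi w = F a w * rGamma (1 - of_real r * w) * rgprod vs' (- w) / rgprod us' (- w)"

lemma reflected_gpf:
  "F a w * rGamma (1 - of_real r * w) * rgprod vs' (- w) * sinprod us w * of_real pi =
   of_real L * sin (of_real (pi * r) * w) * sinprod vs w * rgprod us' (- w)"
proof -
  have s: "rGamma (of_real r * w) * rGamma (1 - of_real r * w) * of_real pi = sin (of_real (pi * r) * w)"
    using rGamma_reflection_complex[of "of_real r * w"] by (simp add: mult.assoc)
  have "F a w * rGamma (1 - of_real r * w) * rgprod vs' (- w) * sinprod us w * of_real pi =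
     (F a w * rgprod us w) * rgprod us' (- w) * of_real pi ^ length us * rGamma (1 - of_real r * w) * rgprod vs' (- w) * of_real pi"
    unfolding rgprod_reflection[of us w, symmetric] us'_def by (simp add: mult_ac)
  also have "\<dots> = of_real L * (rGamma (of_real r * w) * rGamma (1 - of_real r * w) * of_real pi) *
     (rgprod vs w * rgprod vs' (- w) * of_real pi ^ length vs) * rgprod us' (- w)"
    unfolding gpf_eq len by (simp add: mult_ac)
  finally show ?thesis unfolding s vs'_def rgprod_reflection .
qed

lemma Phi_eq:
  assumes "Re w \<le> - R"
  shows "of_real pi * Phi w * sinprod us w = of_real L * sin (of_real (pi * r) * w) * sinprod vs w"
proof -
  have "rgprod us' (- w) \<noteq> 0" using assms by (intro R) simp
  thus ?thesis using reflected_gpf[of w] by (simp add: Phi_def field_simps)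
qed

lemma holomorphic_Phi: "Phi holomorphic_on {w. Re w < - R}"
proof -
  show ?thesis unfolding Phi_def
    by (intro holomorphic_intros holomorphic_F) (use R(2) in auto)
qed

lemma half_plane: "open {w. Re w < - R}" "connected {w. Re w < - R}"
  by (auto simp: open_halfspace_Re_lt intro!: convex_connected convex_halfspace_Re_lt)

text \<open>Since \<open>us\<close> and \<open>vs\<close> have equal length, both sine products
  change by the same sign under \<open>w\<close> to \<open>w - 1\<close>. Thus
  \<open>Phi w / sin (pi * r * w)\<close> has period 1; the form without division is what will be
  evaluated at a zero of the sine.\<close>

lemma Phi_shift:
  assumes w: "Re w < - R"
  shows "Phi (w - 1) * sin (of_real (pi * r) * w) = Phi w * sin (of_real (pi * r) * (w - 1))"
proof -
  define g where "g = (\<lambda>w. Phi (w - 1) * sin (of_real (pi * r) * w))"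
  define h where "h = (\<lambda>w. Phi w * sin (of_real (pi * r) * (w - 1)))"
  define k where "k = (\<lambda>w. sinprod us w * sinprod vs w)"
  obtain Y1 where Y1: "\<And>w. \<bar>Im w\<bar> \<ge> Y1 \<Longrightarrow> sinprod us w \<noteq> 0" using sinprod_nonzero by blast
  obtain Y2 where Y2: "\<And>w. \<bar>Im w\<bar> \<ge> Y2 \<Longrightarrow> sinprod vs w \<noteq> 0" using sinprod_nonzero by blast
  define pt where "pt = Complex (- R - 1) (max Y1 Y2)"
  have "(\<lambda>w. Phi (w - 1)) holomorphic_on {w. Re w < - R}"
  proof -
    have "(Phi \<circ> (\<lambda>w. w - 1)) holomorphic_on {w. Re w < - R}"
      by (rule holomorphic_on_compose_gen[OF _ holomorphic_Phi]) (auto intro!: holomorphic_intros)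
    thus ?thesis by (simp add: o_def)
  qed
  hence hol: "g holomorphic_on {w. Re w < - R}" "h holomorphic_on {w. Re w < - R}" "k holomorphic_on {w. Re w < - R}"
    unfolding g_def h_def k_def by (intro holomorphic_intros holomorphic_Phi holomorphic_sinprod; assumption)+
  have "g w = h w"
  proof (rule holomorphic_cancel[where S = "{w. Re w < - R}" and g = g and h = h and k = k and pt = pt and z = w])
    show "k pt \<noteq> 0" using Y1[of pt] Y2[of pt] by (auto simp: k_def pt_def)
    fix z assume z: "z \<in> {w. Re w < - R}" and nz: "k z \<noteq> 0"
    have 1: "of_real pi * Phi z * sinprod us z = of_real L * sin (of_real (pi * r) * z) * sinprod vs z"
      by (rule Phi_eq) (use z in simp)
    have "of_real pi * Phi (z - 1) * sinprod us (z - 1) = of_real L * sin (of_real (pi * r) * (z - 1)) * sinprod vs (z - 1)"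
      by (rule Phi_eq) (use z in simp)
    hence 2: "of_real pi * Phi (z - 1) * sinprod us z = of_real L * sin (of_real (pi * r) * (z - 1)) * sinprod vs z"
      unfolding sinprod_minus_one len by (simp add: mult_ac)
    have "(of_real pi * of_real L * sinprod us z * sinprod vs z) * g z =
       (of_real pi * Phi (z - 1) * sinprod us z) * (of_real L * sin (of_real (pi * r) * z) * sinprod vs z)"
      by (simp add: g_def mult_ac)
    also have "\<dots> = (of_real pi * of_real L * sinprod us z * sinprod vs z) * h z"
      unfolding 2 1[symmetric] by (simp add: h_def mult_ac)
    finally show "g z = h z" using nz L_pos by (auto simp: k_def)
  qed (use half_plane hol w R in \<open>auto simp: pt_def\<close>)
  thus ?thesis by (simp add: g_def h_def)
qed

definition \<alpha> :: "nat \<Rightarrow> real" where "\<alpha> n = a - real n * p / r"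

lemma large_index:
  obtains N where "\<And>n. n \<ge> N \<Longrightarrow> \<alpha> n < 1 \<and> \<alpha> n + real n + 1 > 0 \<and> real n / r > R"
proof -
  define N where "N = nat \<lceil>max (\<bar>a\<bar> * r / p + 1) (max (\<bar>a\<bar> * r / (r - p) + 1) (R * r + 1))\<rceil>"
  have "\<alpha> n < 1 \<and> \<alpha> n + real n + 1 > 0 \<and> real n / r > R" if "n \<ge> N" for n
  proof -
    have n: "real n \<ge> \<bar>a\<bar> * r / p + 1" "real n \<ge> \<bar>a\<bar> * r / (r - p) + 1" "real n \<ge> R * r + 1"
      using that unfolding N_def by linarith+
    have "real n * p / r \<ge> \<bar>a\<bar>" using n(1) p_pos r_pos by (simp add: field_simps)
    moreover have "real n * (r - p) / r \<ge> \<bar>a\<bar>" using n(2) p_less_r r_pos by (simp add: field_simps)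
    moreover have "real n * (r - p) / r = real n - real n * p / r" using r_pos by (simp add: field_simps)
    moreover have "real n / r > R" using n(3) r_pos by (simp add: field_simps)
    moreover have "a \<le> \<bar>a\<bar>" "- a \<le> \<bar>a\<bar>" by simp_all
    ultimately show ?thesis unfolding \<alpha>_def by (intro conjI) linarith+
  qed
  thus ?thesis using that by blast
qed

text \<open>The factor \<open>rGamma (1 - r w)\<close> in \<open>Phi\<close> is
  \<open>1 / n!\<close> at this point and cancels the factorial of \<open>F_at_neg'\<close>, while
  \<open>Mh\<close> cancels the reflected products.\<close>

lemma Phi_at_neg:
  assumes "\<alpha> n < 1" "\<alpha> n + real n + 1 > 0" "real n / r > R"
  shows "Phi (- of_nat n / of_real r) * Mh (of_nat n / of_real r) =
    of_real (sin (pi * \<alpha> n) / pi) * E b (of_nat (n + 2) / of_real r) * f b (of_nat (n + 2) / of_real r)"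
proof -
  define z where "z = complex_of_nat n / of_real r"
  have z: "of_real r * z = of_nat n" using r_pos by (simp add: z_def)
  have Rz: "Re z \<ge> R" using assms by (simp add: z_def Re_divide_of_real)
  have "1 - of_real r * (- z) = 1 + of_nat n" using z by simp
  hence g: "fact n * rGamma (1 - of_real r * (- z)) = 1"
    by (simp only: rGamma_inverse_Gamma Gamma_fact) simp
  have "Phi (- z) * Mh z = F a (- z) * rGamma (1 - of_real r * (- z))"
    using R(2,3)[OF Rz] by (simp add: Phi_def Mh_def)
  also have "F a (- z) = of_real (sin (pi * \<alpha> n) / pi) * fact n * E b (of_nat (n + 2) / of_real r) * f b (of_nat (n + 2) / of_real r)"
    using F_at_neg'[of a n] assms unfolding \<alpha>_def by (simp add: z_def)
  finally have "Phi (- z) * Mh z = (fact n * rGamma (1 - of_real r * (- z))) * (of_real (sin (pi * \<alpha> n) / pi) * E b (of_nat (n + 2) / of_real r) * f b (of_nat (n + 2) / of_real r))"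
    by (simp add: mult_ac)
  thus ?thesis unfolding g by (simp add: z_def)
qed

lemma E_at_pos:
  assumes "\<alpha> n < 1" "\<alpha> n + real n + 1 > 0"
  obtains y where "E b (of_nat (n + 2) / of_real r) = of_real y" "y > 0"
proof -
  have *: "complex_of_nat (n + 2) / of_real r = of_real (real (n + 2) / r)" by simp
  have "(r - p) * (real (n + 2) / r) - b = \<alpha> n + real n + 1" "p * (real (n + 2) / r) + b = 1 - \<alpha> n"
    "r * (real (n + 2) / r) = real n + 2"
    using r_pos by (simp_all add: dual_def \<alpha>_def field_simps)
  thus ?thesis using E_of_real[of "real (n + 2) / r" b] assms that unfolding * by auto
qed

end

section \<open>Integrality of \<open>p\<close> and \<open>r\<close>, and the dual formula\<close>

context gpf_ctx
begin

lemma Phi_nonzero: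
  assumes "real n / r > R" and "F a (- of_nat n / of_real r) \<noteq> 0"
  shows "Phi (- of_nat n / of_real r) \<noteq> 0"
proof -
  define w where "w = - complex_of_nat n / of_real r"
  have "1 - of_real r * w = of_nat (Suc n)" using r_pos by (simp add: w_def)
  hence "1 - of_real r * w \<notin> \<int>\<^sub>\<le>\<^sub>0" by (simp only:) (rule not_nonpos_Ints_if_Re_pos, simp)
  moreover have "rgprod us' (- w) \<noteq> 0" "rgprod vs' (- w) \<noteq> 0"
    using assms(1) by (auto intro!: R simp: w_def Re_divide_of_real)
  ultimately show ?thesis using assms(2) unfolding w_def[symmetric] by (simp add: Phi_def rGamma_eq_zero_iff)
qed

text \<open>At some \<open>w = - n / r\<close> the value \<open>Phi w\<close> is nonzero although
  \<open>sin (pi * r * w) = 0\<close>. The shift relation then forces the sine to vanish at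
  \<open>w - 1\<close> too, and the two arguments differ by \<open>pi * r\<close>.\<close>

lemma r_nat: obtains rn where "r = real rn"
proof -
  obtain N where N: "\<And>n. n \<ge> N \<Longrightarrow> \<alpha> n < 1 \<and> \<alpha> n + real n + 1 > 0 \<and> real n / r > R" using large_index by blast
  obtain n where n: "n \<ge> N" "F a (- of_nat n / of_real r) \<noteq> 0"
    using infinite_poles by (auto simp: infinite_nat_iff_unbounded_le)
  define w where "w = - complex_of_nat n / of_real r"
  have Rw: "Re w < - R" using N[OF n(1)] by (simp add: w_def Re_divide_of_real)
  have rw: "of_real r * w = - of_nat n" using r_pos by (simp add: w_def)
  have "Phi w \<noteq> 0" unfolding w_def using N[OF n(1)] n(2) by (intro Phi_nonzero) auto
  moreover have "of_real (pi * r) * w = of_real pi * (- of_nat n)" using rw by (simp add: mult.assoc)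
  hence "sin (of_real (pi * r) * w) = 0" by (simp only: sin_pi_eq_0_iff) simp
  moreover note Phi_shift[OF Rw]
  ultimately have "sin (of_real (pi * r) * (w - 1)) = 0" by simp
  moreover have "of_real (pi * r) * (w - 1) = of_real pi * of_real (- real n - r)" using rw by (simp add: algebra_simps mult.assoc)
  ultimately have "complex_of_real (- real n - r) \<in> \<int>" by (simp only: sin_pi_eq_0_iff)
  then obtain k :: int where "complex_of_real (- real n - r) = of_int k" by (metis Ints_cases)
  hence "complex_of_real (- real n - r) = of_real (of_int k)" by simp
  hence "- real n - r = of_int k" by (simp only: of_real_eq_iff)
  hence "r = of_int (- k - int n)" by simp
  moreover from this have "- k - int n > 0" using r_pos by linarith
  ultimately have "r = real (nat (- k - int n))" by simp
  thus ?thesis using that by blast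
qed

lemma Phi_minus_one:
  assumes w: "Re w < - R" and rn: "r = real rn"
  shows "Phi (w - 1) = (-1) ^ rn * Phi w"
proof -
  define g where "g = (\<lambda>w. Phi (w - 1))"
  define h where "h = (\<lambda>w. (-1) ^ rn * Phi w)"
  define k where "k = (\<lambda>w::complex. sin (of_real (pi * r) * w))"
  have hol: "g holomorphic_on {w. Re w < - R}" "h holomorphic_on {w. Re w < - R}" "k holomorphic_on {w. Re w < - R}"
  proof -
    have "(Phi \<circ> (\<lambda>w. w - 1)) holomorphic_on {w. Re w < - R}"
      by (rule holomorphic_on_compose_gen[OF _ holomorphic_Phi]) (auto intro!: holomorphic_intros)
    thus "g holomorphic_on {w. Re w < - R}" by (simp add: o_def g_def)
    show "h holomorphic_on {w. Re w < - R}" unfolding h_def by (intro holomorphic_intros holomorphic_Phi)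
    show "k holomorphic_on {w. Re w < - R}" unfolding k_def by (intro holomorphic_intros)
  qed
  have sh: "sin (of_real (pi * r) * (z - 1)) = (-1) ^ rn * sin (of_real (pi * r) * z)" for z :: complex
  proof -
    have "of_real (pi * r) * (z - 1) = of_real (pi * r) * z - of_real (real rn * pi)" by (simp add: rn algebra_simps)
    moreover have "sin (complex_of_real (real rn * pi)) = 0" "cos (complex_of_real (real rn * pi)) = (-1) ^ rn"
      unfolding sin_of_real cos_of_real sin_npi cos_npi by simp_all
    ultimately show ?thesis by (simp only: sin_diff) simp
  qed
  define pt where "pt = Complex (- R - 1) 1"
  have "g w = h w"
  proof (rule holomorphic_cancel[where S = "{w. Re w < - R}" and g = g and h = h and k = k and pt = pt and z = w])
    show "k pt \<noteq> 0"
    proof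
      assume "k pt = 0"
      hence "sin (of_real pi * (of_real r * pt)) = 0" by (simp add: k_def mult.assoc)
      hence "of_real r * pt \<in> \<int>" by (simp only: sin_pi_eq_0_iff)
      hence "Im (of_real r * pt) = 0" by (metis Ints_cases complex_Im_of_int)
      thus False using r_pos by (simp add: pt_def)
    qed
    fix z assume z: "z \<in> {w. Re w < - R}" and nz: "k z \<noteq> 0"
    have "Phi (z - 1) * k z = Phi z * ((-1) ^ rn * k z)"
      using Phi_shift[of z] z unfolding sh k_def by simp
    thus "g z = h z" using nz by (simp add: g_def h_def)
  qed (use half_plane hol w R in \<open>auto simp: pt_def\<close>)
  thus ?thesis by (simp add: g_def h_def)
qed

lemma Phi_minus_nat:
  assumes w: "Re w < - R" and rn: "r = real rn"
  shows "Phi (w - of_nat k) = (-1) ^ (rn * k) * Phi w"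
proof (induction k)
  case (Suc k)
  have "Phi (w - of_nat k - 1) = (-1) ^ rn * Phi (w - of_nat k)"
    by (rule Phi_minus_one) (use w rn in auto)
  thus ?case using Suc by (simp add: power_add diff_diff_eq add_ac)
qed simp

text \<open>Along \<open>n0 + r k\<close> the points \<open>- n / r\<close> differ by integers, so
  \<open>Phi\<close> changes only by a sign, while \<open>Mh\<close> tends to 1 and
  \<open>f b\<close> to \<open>L > 0\<close>. Hence \<open>E b\<close> times a signed sine tends to
  a nonzero limit. Positivity of \<open>E b\<close> gives that sine an eventually constant sign, so
  \<open>p - r\<close> is even; then it is a constant, and \<open>E b\<close> itself has a nonzero
  limit.\<close>

lemma main_limits:
  "\<exists>rn pn n0 e0. r = real rn \<and> p = real pn \<and> even (rn + pn) \<and> e0 \<noteq> 0 \<and>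
    (\<lambda>k. E b (of_nat (n0 + 2) / of_real r + of_nat k)) \<longlonglongrightarrow> e0 \<and>
    (\<forall>k. \<exists>y>0. E b (of_nat (n0 + 2) / of_real r + of_nat k) = of_real y) \<and>
    (\<exists>c. \<forall>k. E b (of_nat (n0 + 2) / of_real r + of_nat k) * f b (of_nat (n0 + 2) / of_real r + of_nat k) =
         c * Mh (of_nat n0 / of_real r + of_nat k))"
proof -
  obtain rn where rn: "r = real rn" by (rule r_nat)
  have rn0: "rn > 0" using rn r_pos by simp
  obtain N where N: "\<And>n. n \<ge> N \<Longrightarrow> \<alpha> n < 1 \<and> \<alpha> n + real n + 1 > 0 \<and> real n / r > R" using large_index by blast
  obtain n0 where n0: "n0 \<ge> N" "F a (- of_nat n0 / of_real r) \<noteq> 0"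
    using infinite_poles by (auto simp: infinite_nat_iff_unbounded_le)
  define W where "W = (\<lambda>k. complex_of_nat (n0 + 2) / of_real r + of_nat k)"
  define Z where "Z = (\<lambda>k. complex_of_nat n0 / of_real r + of_nat k)"
  have W_app: "complex_of_nat (n0 + 2) / of_real r + of_nat k = W k"
    and Z_app: "complex_of_nat n0 / of_real r + of_nat k = Z k" for k by (simp_all only: W_def Z_def)
  define nk where "nk = (\<lambda>k. n0 + rn * k)"
  have nk: "nk k \<ge> N" for k using n0 by (simp add: nk_def)
  have Wk: "complex_of_nat (nk k + 2) / of_real r = W k" for k
    using rn0 by (simp add: W_def nk_def rn field_simps)
  have Zk: "complex_of_nat (nk k) / of_real r = Z k" for k
    using rn0 by (simp add: Z_def nk_def rn field_simps)
  define \<Phi>0 where "\<Phi>0 = Phi (- of_nat n0 / of_real r)"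
  have \<Phi>k: "Phi (- of_nat (nk k) / of_real r) = (-1) ^ (rn * k) * \<Phi>0" for k
  proof -
    have "- complex_of_nat (nk k) / of_real r = - of_nat n0 / of_real r - of_nat k"
      using rn0 by (simp add: nk_def rn field_simps)
    moreover have "Re (- complex_of_nat n0 / of_real r) < - R" using N[OF n0(1)] by (simp add: Re_divide_of_real)
    ultimately show ?thesis using Phi_minus_nat[OF _ rn] by (simp only: \<Phi>0_def)
  qed
  have \<Phi>0: "\<Phi>0 \<noteq> 0" unfolding \<Phi>0_def using N[OF n0(1)] n0(2) by (intro Phi_nonzero) auto
  have key: "(-1) ^ (rn * k) * \<Phi>0 * Mh (Z k) = of_real (sin (pi * \<alpha> (nk k)) / pi) * E b (W k) * f b (W k)" for k
    using Phi_at_neg[of "nk k"] N[OF nk[of k]] unfolding \<Phi>k Wk Zk by simp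
  have "\<forall>k. \<exists>y. y > 0 \<and> E b (W k) = of_real y"
    using E_at_pos N[OF nk] unfolding Wk[symmetric] by metis
  then obtain e where e: "\<And>k. e k > 0" "\<And>k. E b (W k) = of_real (e k)" by metis
  have W_real: "W k = of_real (real (n0 + 2) / r + real k)" for k by (simp add: W_def)
  have "\<forall>k. \<exists>y. f b (W k) = of_real y"
    using f_of_real unfolding W_real by (metis Reals_cases)
  then obtain g where g: "\<And>k. f b (W k) = of_real (g k)" by metis
  have g_lim: "g \<longlonglongrightarrow> L"
  proof -
    have "(\<lambda>k. f b (W k)) \<longlonglongrightarrow> of_real L" unfolding W_def by (intro f_tendsto_L filterlim_Re_shift)
    thus ?thesis unfolding g tendsto_of_real_iff .
  qed
  have \<alpha>_nk: "\<alpha> (nk k) = \<alpha> n0 - real k * p" for k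
    using r_pos by (simp add: \<alpha>_def nk_def rn[symmetric] field_simps)
  define \<beta> where "\<beta> = pi * \<alpha> n0"
  \<comment> \<open>Since \<open>r\<close> is an integer, the sign of \<open>Phi\<close> can be
    moved into the sine, which becomes \<open>sin (\<beta> - k * (pi * (p - r)))\<close>.\<close>
  define s where "s = (\<lambda>k. (-1) ^ (rn * k) * sin (pi * \<alpha> (nk k)))"
  have s_eq: "s k = sin (\<beta> - real k * (pi * (p - r)))" for k
  proof -
    have "\<beta> - real k * (pi * (p - r)) = pi * \<alpha> (nk k) + pi * real (rn * k)"
      by (simp add: \<beta>_def \<alpha>_nk rn[symmetric] algebra_simps)
    thus ?thesis by (simp only: sin_add_nat_pi s_def)
  qed
  have key': "\<Phi>0 * of_real pi * Mh (Z k) = of_real (s k * e k * g k)" for k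
  proof -
    have "((-1) ^ (rn * k) * (-1) ^ (rn * k)) * (\<Phi>0 * of_real pi * Mh (Z k)) =
         (-1) ^ (rn * k) * of_real pi * ((-1) ^ (rn * k) * \<Phi>0 * Mh (Z k))" by (simp add: mult_ac)
    also have "\<dots> = of_real (s k * e k * g k)" unfolding key e g s_def by simp
    finally show ?thesis by (simp flip: power_mult_distrib)
  qed
  define l where "l = Re (\<Phi>0 * of_real pi)"
  have lim: "(\<lambda>k. complex_of_real (s k * e k * g k)) \<longlonglongrightarrow> \<Phi>0 * of_real pi"
  proof -
    have "(\<lambda>k. \<Phi>0 * of_real pi * Mh (Z k)) \<longlonglongrightarrow> \<Phi>0 * of_real pi * 1"
      unfolding Z_def by (intro tendsto_intros Mh_tendsto)
    thus ?thesis unfolding key' by simp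
  qed
  have lim_re: "(\<lambda>k. s k * e k * g k) \<longlonglongrightarrow> l" using tendsto_Re[OF lim] by (simp add: l_def)
  have l_eq: "\<Phi>0 * of_real pi = of_real l"
    using LIMSEQ_unique[OF lim tendsto_of_real[OF lim_re]] .
  have l0: "l \<noteq> 0" using l_eq \<Phi>0 by auto
  have ev: "eventually (\<lambda>k. sgn l * s k > 0) sequentially"
  proof -
    have "(\<lambda>k. sgn l * (s k * e k * g k)) \<longlonglongrightarrow> sgn l * l" by (intro tendsto_intros lim_re)
    moreover have "sgn l * l > 0" using l0 by (simp add: sgn_if)
    ultimately have "eventually (\<lambda>k. sgn l * (s k * e k * g k) > 0) sequentially" by (rule order_tendstoD)
    moreover have "eventually (\<lambda>k. g k > 0) sequentially" using g_lim L_pos by (rule order_tendstoD)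
    ultimately show ?thesis
    proof eventually_elim
      case (elim k)
      hence "(sgn l * s k) * (e k * g k) > 0" by (simp add: mult_ac)
      thus ?case using elim e(1)[of k] by (metis mult_pos_pos zero_less_mult_pos2)
    qed
  qed
  then obtain K where K: "\<And>k. k \<ge> K \<Longrightarrow> sgn l * s k > 0" by (auto simp: eventually_at_top_linorder)
  have "cos (pi * (p - r)) = 1"
    by (rule sin_eventually_sign_imp[of "sgn l" K \<beta>]) (use K l0 in \<open>auto simp: s_eq sgn_if\<close>)
  then obtain j :: int where "pi * (p - r) = of_int j * 2 * pi" by (auto simp: cos_one_2pi_int)
  hence pr: "p = r + 2 * of_int j" by simp
  hence p_int: "p = of_int (int rn + 2 * j)" by (simp add: rn)
  hence pj: "int rn + 2 * j > 0" using p_pos by linarith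
  define pn where "pn = nat (int rn + 2 * j)"
  have pn: "p = real pn" using p_int pj by (simp add: pn_def)
  have ev_pr: "even (rn + pn)"
  proof -
    have "int (rn + pn) = 2 * (int rn + j)" using pj by (simp add: pn_def)
    hence "even (int (rn + pn))" by simp
    thus ?thesis by simp
  qed
  have s_const: "s k = sin \<beta>" for k
  proof -
    have "pi * \<alpha> (nk k) + pi * real (pn * k) = \<beta>"
      by (simp add: \<beta>_def \<alpha>_nk pn[symmetric] algebra_simps)
    hence "sin \<beta> = (-1) ^ (pn * k) * sin (pi * \<alpha> (nk k))" by (metis sin_add_nat_pi)
    hence "(-1) ^ (pn * k) * sin \<beta> = sin (pi * \<alpha> (nk k))" by (simp flip: power_mult_distrib mult.assoc)
    hence "s k = (-1) ^ ((rn + pn) * k) * sin \<beta>" by (simp add: s_def power_add ring_distribs)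
    also have "(-1) ^ ((rn + pn) * k) = (1 :: real)" using ev_pr by simp
    finally show ?thesis by simp
  qed
  have sb: "sin \<beta> \<noteq> 0" using lim_re l0 LIMSEQ_unique[OF _ tendsto_const] unfolding s_const by fastforce
  have e_lim: "e \<longlonglongrightarrow> l / (sin \<beta> * L)"
  proof -
    have "(\<lambda>k. s k * e k * g k / (sin \<beta> * g k)) \<longlonglongrightarrow> l / (sin \<beta> * L)"
      using sb L_pos by (intro tendsto_intros lim_re g_lim) auto
    moreover have "eventually (\<lambda>k. g k > 0) sequentially" using g_lim L_pos by (rule order_tendstoD)
    hence "eventually (\<lambda>k. s k * e k * g k / (sin \<beta> * g k) = e k) sequentially"
      by eventually_elim (use sb in \<open>simp add: s_const\<close>)
    ultimately show ?thesis by (rule Lim_transform_eventually)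
  qed
  show ?thesis
  proof (rule exI[of _ rn], rule exI[of _ pn], rule exI[of _ n0], rule exI[of _ "complex_of_real (l / (sin \<beta> * L))"], intro conjI)
    show "r = real rn" "p = real pn" "even (rn + pn)" by fact+
    show "complex_of_real (l / (sin \<beta> * L)) \<noteq> 0" using l0 sb L_pos by simp
    show "(\<lambda>k. E b (of_nat (n0 + 2) / of_real r + of_nat k)) \<longlonglongrightarrow> complex_of_real (l / (sin \<beta> * L))"
      unfolding W_app e by (intro tendsto_of_real e_lim)
    show "\<forall>k. \<exists>y>0. E b (of_nat (n0 + 2) / of_real r + of_nat k) = of_real y"
      using e unfolding W_app by blast
    show "\<exists>c. \<forall>k. E b (of_nat (n0 + 2) / of_real r + of_nat k) * f b (of_nat (n0 + 2) / of_real r + of_nat k) =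
         c * Mh (of_nat n0 / of_real r + of_nat k)"
      unfolding W_app Z_app
    proof (intro exI allI)
      fix k
      have "\<Phi>0 * of_real pi * Mh (Z k) = of_real (sin \<beta>) * (E b (W k) * f b (W k))"
        unfolding key' e g s_const by simp
      thus "E b (W k) * f b (W k) = \<Phi>0 * of_real pi / of_real (sin \<beta>) * Mh (Z k)"
        using sb by (simp add: field_simps)
    qed
  qed
qed

text \<open>A real rate with \<open>exp log_eq = 1\<close> is 0. In the formula for the dual,
  \<open>U\<close> and \<open>V\<close> come from \<open>1 / E b\<close> and the shifted lists from
  \<open>Mh (w - 2 / r)\<close>; the shift is by \<open>2 / r\<close> because \<open>F a\<close> at
  \<open>- n / r\<close> is matched with \<open>f b\<close> at \<open>(n + 2) / r\<close>.\<close>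

lemma dual_gpf:
  obtains rn pn D U V where "r = real rn" "p = real pn" "even (rn + pn)" "D > 0" "log_eq = 0"
    "length U = length V" "sum_list U = sum_list V"
    "\<And>w. E b w = of_real D * (rgprod V w / rgprod U w)"
    "gpf b (V @ map (\<lambda>v. v - 2 / of_real r) vs') (U @ map (\<lambda>v. v - 2 / of_real r) us')"
proof -
  obtain rn pn n0 e0 \<kappa> where rn: "r = real rn" and pn: "p = real pn" and par: "even (rn + pn)" and e0: "e0 \<noteq> 0"
    and elim: "(\<lambda>k. E b (of_nat (n0 + 2) / of_real r + of_nat k)) \<longlonglongrightarrow> e0"
    and epos: "\<forall>k. \<exists>y>0. E b (of_nat (n0 + 2) / of_real r + of_nat k) = of_real y"
    and \<kappa>': "\<forall>k. E b (of_nat (n0 + 2) / of_real r + of_nat k) * f b (of_nat (n0 + 2) / of_real r + of_nat k) =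
         \<kappa> * Mh (of_nat n0 / of_real r + of_nat k)"
    using main_limits by (elim exE conjE) (rule that)
  note \<kappa> = spec[OF \<kappa>']
  define w0 where "w0 = complex_of_nat (n0 + 2) / of_real r"
  obtain c U V where c: "c \<noteq> 0" and Eform: "\<And>w. E b w = c * exp (of_real log_eq * w) * (rgprod V w / rgprod U w)"
    using E_gamma_form[OF pn rn] by blast
  have "(\<lambda>k. E b (w0 + of_nat k) / c) \<longlonglongrightarrow> e0 / c" using elim c unfolding w0_def by (intro tendsto_divide) auto
  hence "(\<lambda>k. exp (of_real log_eq * (w0 + of_nat k)) * (rgprod V (w0 + of_nat k) / rgprod U (w0 + of_nat k))) \<longlonglongrightarrow> e0 / c"
    using c by (simp add: Eform)
  note bal = rgprod_ratio_balance[OF this]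
  have bal: "length U = length V" "exp (complex_of_real log_eq) = 1" "sum_list U = sum_list V"
    using bal e0 c by auto
  have "complex_of_real (exp log_eq) = 1" using bal(2) by (simp flip: exp_of_real)
  hence "exp log_eq = 1" by (simp only: of_real_eq_1_iff)
  hence le0: "log_eq = 0" by simp
  have Eform: "E b w = c * (rgprod V w / rgprod U w)" for w using Eform[of w] le0 by simp
  have Elim: "(\<lambda>k. E b (w + of_nat k)) \<longlonglongrightarrow> c" for w
  proof -
    have "(\<lambda>k. c * (rgprod V (w + of_nat k) / rgprod U (w + of_nat k))) \<longlonglongrightarrow> c * 1"
      by (intro tendsto_mult tendsto_const rgprod_ratio_shift_tendsto_1 bal)
    thus ?thesis by (simp add: Eform)
  qed
  obtain y where y: "\<And>k. y k > 0" "\<And>k. E b (w0 + of_nat k) = of_real (y k)" using epos unfolding w0_def by metis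
  define D where "D = Re c"
  have ylim: "y \<longlonglongrightarrow> D" using tendsto_Re[OF Elim[of w0]] by (simp add: y D_def)
  have cD: "c = of_real D"
    using LIMSEQ_unique[OF Elim[of w0, unfolded y] tendsto_of_real[OF ylim]] .
  have "D \<ge> 0" by (rule LIMSEQ_le_const[OF ylim]) (use y(1) in \<open>auto intro: less_imp_le\<close>)
  hence D: "D > 0" using c cD by (cases "D = 0") auto
  have \<kappa>_eq: "\<kappa> = c * of_real L"
  proof -
    have "(\<lambda>k. E b (w0 + of_nat k) * f b (w0 + of_nat k)) \<longlonglongrightarrow> c * of_real L"
      by (intro tendsto_mult Elim f_tendsto_L filterlim_Re_shift)
    hence "(\<lambda>k. \<kappa> * Mh (of_nat n0 / of_real r + of_nat k)) \<longlonglongrightarrow> c * of_real L" using \<kappa> by (simp add: w0_def)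
    moreover have "(\<lambda>k. \<kappa> * Mh (of_nat n0 / of_real r + of_nat k)) \<longlonglongrightarrow> \<kappa> * 1"
      by (intro tendsto_intros Mh_tendsto)
    ultimately show ?thesis using LIMSEQ_unique by fastforce
  qed
  obtain R1 B1 where R1: "R1 > 0" "\<And>w. Re w \<ge> R1 \<Longrightarrow> rgprod V w \<noteq> 0" "\<And>w. Re w \<ge> R1 \<Longrightarrow> norm (rgprod U w / rgprod V w) \<le> B1"
    using rgprod_ratio_bounded[of V U] bal by metis
  obtain R2 where R2: "\<And>w. Re w \<ge> R2 \<Longrightarrow> rgprod U w \<noteq> 0" using rgprod_nonzero_right by blast
  obtain R3 B3 where R3: "R3 > 0" "\<And>w. Re w \<ge> R3 \<Longrightarrow> rgprod vs' w \<noteq> 0" "\<And>w. Re w \<ge> R3 \<Longrightarrow> norm (rgprod us' w / rgprod vs' w) \<le> B3"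
    using rgprod_ratio_bounded[of vs' us'] len' sum' by metis
  \<comment> \<open>To the right of \<open>Q\<close> all denominators are nonzero,
    \<open>f b\<close> has its geometric bound, and both Gamma quotients, one of them shifted by
    \<open>2 / r\<close>, are bounded.\<close>
  define Q where "Q = Max {R1, R2, R3 + 2 / r, w_min b, R + 2 / r}"
  have Q: "Q \<ge> R1" "Q \<ge> R2" "Q \<ge> R3 + 2 / r" "Q \<ge> w_min b" "Q \<ge> R + 2 / r" by (auto simp: Q_def)
  define h where "h = (\<lambda>w. f b w - of_real L * (rgprod us' (w - 2 / of_real r) / rgprod vs' (w - 2 / of_real r)) * (rgprod U w / rgprod V w))"
  have shiftRe: "Re (w - 2 / of_real r) = Re w - 2 / r" for w by (simp add: Re_divide_of_real)
  have h0: "h w = 0" if w: "Re w > Q" for w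
  proof -
    obtain k0 :: nat where k0: "real k0 > Q - Re w0" using reals_Archimedean2 by blast
    show ?thesis
    proof (rule bounded_half_plane_eq_0[where f = h and z = w and R = Q and ?z0.0 = "w0 + of_nat k0" and B = "1 / (1 - x) + norm (complex_of_real L) * B3 * B1"])
      have 1: "f b holomorphic_on {z. Re z > Q}"
        using Q(4) by (intro holomorphic_f r_w_not_nonpos_Int) (auto simp: w_min_def)
      have 2: "rgprod vs' (w - 2 / of_real r) \<noteq> 0" "rgprod V w \<noteq> 0" if "w \<in> {z. Re z > Q}" for w
        using that Q(1,3) by (auto intro!: R3(2) R1(2) simp: shiftRe)
      show "h holomorphic_on {z. Re z > Q}" unfolding h_def
        by (intro holomorphic_intros 1 2)
      show "norm (h z) \<le> 1 / (1 - x) + norm (complex_of_real L) * B3 * B1" if z: "Re z > Q" for z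
        unfolding h_def
      proof (rule order_trans[OF norm_triangle_ineq4], rule add_mono)
        show "norm (f b z) \<le> 1 / (1 - x)" using z Q(4) by (intro f_bounded) simp
        have b3: "norm (rgprod us' (z - 2 / of_real r) / rgprod vs' (z - 2 / of_real r)) \<le> B3"
          using z Q(3) by (intro R3(3)) (simp add: shiftRe)
        moreover have "norm (rgprod U z / rgprod V z) \<le> B1" using z Q(1) by (intro R1(3)) simp
        moreover have "B3 \<ge> 0" using b3 norm_ge_zero order_trans by blast
        ultimately show "norm (of_real L * (rgprod us' (z - 2 / of_real r) / rgprod vs' (z - 2 / of_real r)) * (rgprod U z / rgprod V z)) \<le>
           norm (complex_of_real L) * B3 * B1"
          unfolding norm_mult[of "_ * _" "_ / _"] norm_mult[of "of_real L"] by (intro mult_mono mult_left_mono) auto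
      qed
      fix n :: nat
      define z where "z = w0 + of_nat (k0 + n)"
      have zQ: "Re z > Q" using k0 by (simp add: z_def)
      have z2: "z - 2 / of_real r = of_nat n0 / of_real r + of_nat (k0 + n)"
        by (simp add: z_def w0_def add_divide_distrib)
      have "E b z * f b z = c * of_real L * Mh (z - 2 / of_real r)"
        unfolding z2 using \<kappa>[of "k0 + n"] unfolding \<kappa>_eq w0_def[symmetric] z_def .
      hence "rgprod V z / rgprod U z * f b z = of_real L * Mh (z - 2 / of_real r)"
      proof -
        assume *: "E b z * f b z = c * of_real L * Mh (z - 2 / of_real r)"
        have "c * (rgprod V z / rgprod U z * f b z) = E b z * f b z" unfolding Eform by (simp only: mult.assoc)
        also have "\<dots> = c * (of_real L * Mh (z - 2 / of_real r))" unfolding * by (simp only: mult.assoc)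
        finally show ?thesis using c by (simp only: mult_cancel_left) simp
      qed
      moreover have "rgprod V z \<noteq> 0" "rgprod U z \<noteq> 0" using R1 R2 Q zQ by auto
      moreover have "y - l * m * (u / v) = 0" if "v / u * y = l * m" "v \<noteq> 0" "u \<noteq> 0" for y l m u v :: complex
        unfolding that(1)[symmetric] using that(2,3) by simp
      ultimately have "h z = 0" unfolding h_def Mh_def[symmetric] by blast
      thus "h (w0 + of_nat k0 + of_nat n) = 0" by (simp add: z_def add_ac)
    qed (use w k0 in auto)
  qed
  define V' where "V' = V @ map (\<lambda>v. v - 2 / of_real r) vs'"
  define U' where "U' = U @ map (\<lambda>v. v - 2 / of_real r) us'"
  have "gpf b V' U'"
    unfolding gpf_def
  proof (intro conjI allI)
    show "length V' = length U'" using bal len' by (simp add: V'_def U'_def)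
    have s: "sum_list (map (\<lambda>v. v - t) xs) = sum_list xs - of_nat (length xs) * t" for xs and t :: complex
      by (induction xs) (simp_all add: algebra_simps)
    show "sum_list V' = sum_list U'" using bal len' sum' by (simp add: V'_def U'_def s)
    define g1 where "g1 = (\<lambda>w. F b w * rgprod V' w)"
    define g2 where "g2 = (\<lambda>w. of_real L * rGamma (of_real r * w) * rgprod U' w)"
    fix w
    have "g1 w = g2 w"
    proof (rule analytic_continuation_open[of "{z. Re z > Q}" UNIV g1 g2])
      show "open {z. Re z > Q}" by (rule open_halfspace_Re_gt)
      have "complex_of_real (Q + 1) \<in> {z. Re z > Q}" by simp
      thus "{z. Re z > Q} \<noteq> {}" by blast
      show "g1 holomorphic_on UNIV" "g2 holomorphic_on UNIV" unfolding g1_def g2_def by (intro holomorphic_intros holomorphic_F)+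
      fix z assume "z \<in> {z. Re z > Q}"
      hence z: "Re z > Q" by simp
      have nz: "rgprod V z \<noteq> 0" "rgprod vs' (z - 2 / of_real r) \<noteq> 0"
        using R1 R3 Q z by (auto simp: shiftRe)
      have "Re z > 0" using z Q(4) by (simp add: w_min_def)
      hence gz: "of_real r * z \<notin> \<int>\<^sub>\<le>\<^sub>0" by (rule r_w_not_nonpos_Int)
      have "f b z * (rgprod V z * rgprod vs' (z - 2 / of_real r)) = of_real L * rgprod us' (z - 2 / of_real r) * rgprod U z"
      proof -
        have "f b z = of_real L * (rgprod us' (z - 2 / of_real r) / rgprod vs' (z - 2 / of_real r)) * (rgprod U z / rgprod V z)"
          using h0[OF z] by (simp add: h_def)
        moreover have "l * (u / v) * (u' / v') * (v' * v) = l * u * u'" if "v \<noteq> 0" "v' \<noteq> 0" for l u v u' v' :: complex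
          using that by simp
        ultimately show ?thesis using nz by simp
      qed
      note H = this
      have "(rGamma (of_real r * z) * Gamma (of_real r * z)) * F b z * (rgprod V z * rgprod vs' (z - 2 / of_real r)) =
          rGamma (of_real r * z) * (f b z * (rgprod V z * rgprod vs' (z - 2 / of_real r)))"
        by (simp only: f_def mult_ac)
      also have "\<dots> = of_real L * rGamma (of_real r * z) * rgprod us' (z - 2 / of_real r) * rgprod U z"
        unfolding H by (simp only: mult_ac)
      finally have X: "(rGamma (of_real r * z) * Gamma (of_real r * z)) * F b z * (rgprod V z * rgprod vs' (z - 2 / of_real r)) =
          of_real L * rGamma (of_real r * z) * rgprod us' (z - 2 / of_real r) * rgprod U z" .
      have G1: "rGamma (of_real r * z) * Gamma (of_real r * z) = 1"
        using gz by (simp add: rGamma_inverse_Gamma Gamma_eq_zero_iff)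
      show "g1 z = g2 z"
        using X[unfolded G1] unfolding g1_def g2_def V'_def U'_def rgprod_append rgprod_shift[symmetric]
        by (simp only: mult_1 mult_ac)
    qed auto
    thus "F b w * rgprod V' w = of_real L * rGamma (of_real r * w) * rgprod U' w" by (simp add: g1_def g2_def)
  qed
  thus ?thesis unfolding V'_def U'_def using that[OF rn pn par D le0 bal(1,3) Eform[unfolded cD]] by blast
qed

end

section \<open>The function \<open>\<Theta>\<close>\<close>

locale gpf_dual_ctx = gpf_ctx +
  fixes rn pn :: nat and D :: real and U V :: "complex list"
  assumes rn: "r = real rn" and pn: "p = real pn" and parity: "even (rn + pn)"
    and D_pos: "D > 0" and log_eq_0: "log_eq = 0"
    and lenUV: "length U = length V" and sumUV: "sum_list U = sum_list V"
    and E_eq: "\<And>w. E b w = of_real D * (rgprod V w / rgprod U w)"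
    and gpf_b: "gpf b (V @ map (\<lambda>v. v - 2 / of_real r) vs') (U @ map (\<lambda>v. v - 2 / of_real r) us')"
begin

lemma E_tendsto_D: "(\<lambda>k. E b (w + of_nat k)) \<longlonglongrightarrow> of_real D"
proof -
  have "(\<lambda>k. of_real D * (rgprod V (w + of_nat k) / rgprod U (w + of_nat k))) \<longlonglongrightarrow> of_real D * 1"
    by (intro tendsto_mult tendsto_const rgprod_ratio_shift_tendsto_1 lenUV sumUV)
  thus ?thesis by (simp add: E_eq)
qed

lemma sin_shift_nat: "sin (of_real (pi * real m) * (z - of_nat k) + c) = (-1) ^ (m * k) * sin (of_real (pi * real m) * z + c :: complex)"
proof -
  have "of_real (pi * real m) * (z - of_nat k) + c = (of_real (pi * real m) * z + c) - of_real (real (m * k) * pi)"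
    by (simp add: algebra_simps)
  moreover have "sin (complex_of_real (real (m * k) * pi)) = 0" "cos (complex_of_real (real (m * k) * pi)) = (-1) ^ (m * k)"
    unfolding sin_of_real cos_of_real sin_npi cos_npi by simp_all
  ultimately show ?thesis by (simp only: sin_diff) simp
qed

lemma parity_power: "(-1) ^ (pn * k) = ((-1) ^ (rn * k) :: 'a :: comm_ring_1)"
proof -
  have "(-1) ^ pn = ((-1) ^ rn :: 'a)" using parity by (cases "even pn") auto
  thus ?thesis by (simp add: power_mult)
qed

lemma m1_sq: "(-1) ^ n * (-1) ^ n = (1 :: 'a :: comm_ring_1)"
  by (simp flip: power_mult_distrib)

text \<open>Replacing \<open>n\<close> by \<open>n + r k\<close> changes \<open>Phi\<close> and the
  sine by the same sign, as \<open>p\<close> and \<open>r\<close> have equal parity. So the relation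
  with \<open>E b\<close>, \<open>f b\<close> and \<open>Mh\<close> holds with the same constants
  for all \<open>k\<close>, and the limit in \<open>k\<close> evaluates it at the original
  \<open>n\<close>.\<close>

lemma Phi_at_neg_exact:
  assumes n: "\<And>m. m \<ge> n \<Longrightarrow> \<alpha> m < 1 \<and> \<alpha> m + real m + 1 > 0 \<and> real m / r > R"
  shows "Phi (- of_nat n / of_real r) = of_real (D * L / pi) * of_real (sin (pi * \<alpha> n))"
proof -
  define W where "W = (\<lambda>k. complex_of_nat (n + 2) / of_real r + of_nat k)"
  define Z where "Z = (\<lambda>k. complex_of_nat n / of_real r + of_nat k)"
  define nk where "nk = (\<lambda>k. n + rn * k)"
  have rn0: "rn > 0" using rn r_pos by simp
  have Wk: "complex_of_nat (nk k + 2) / of_real r = W k" for k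
    using rn0 by (simp add: W_def nk_def rn field_simps)
  have Zk: "complex_of_nat (nk k) / of_real r = Z k" for k
    using rn0 by (simp add: Z_def nk_def rn field_simps)
  define \<Phi>0 where "\<Phi>0 = Phi (- of_nat n / of_real r)"
  have \<Phi>k: "Phi (- of_nat (nk k) / of_real r) = (-1) ^ (rn * k) * \<Phi>0" for k
  proof -
    have "- complex_of_nat (nk k) / of_real r = - of_nat n / of_real r - of_nat k"
      using rn0 by (simp add: nk_def rn field_simps)
    moreover have "Re (- complex_of_nat n / of_real r) < - R" using n[of n] by (simp add: Re_divide_of_real)
    ultimately show ?thesis using Phi_minus_nat[OF _ rn] by (simp only: \<Phi>0_def)
  qed
  have \<alpha>_nk: "\<alpha> (nk k) = \<alpha> n - real k * p" for k
    using r_pos by (simp add: \<alpha>_def nk_def rn[symmetric] field_simps)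
  have sin_k: "sin (pi * \<alpha> (nk k)) = (-1) ^ (rn * k) * sin (pi * \<alpha> n)" for k
  proof -
    have "pi * \<alpha> n = pi * \<alpha> (nk k) + pi * real (pn * k)" by (simp add: \<alpha>_nk pn[symmetric] algebra_simps)
    hence "sin (pi * \<alpha> n) = (-1) ^ (rn * k) * sin (pi * \<alpha> (nk k))" by (simp only: sin_add_nat_pi parity_power)
    hence "(-1) ^ (rn * k) * sin (pi * \<alpha> n) = ((-1) ^ (rn * k) * (-1) ^ (rn * k)) * sin (pi * \<alpha> (nk k))"
      by (simp only: mult.assoc)
    thus ?thesis unfolding m1_sq by simp
  qed
  have key: "\<Phi>0 * Mh (Z k) = of_real (sin (pi * \<alpha> n) / pi) * E b (W k) * f b (W k)" for k
  proof -
    have "(-1) ^ (rn * k) * \<Phi>0 * Mh (Z k) = of_real (sin (pi * \<alpha> (nk k)) / pi) * E b (W k) * f b (W k)"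
      using Phi_at_neg[of "nk k"] n[of "nk k"] unfolding \<Phi>k Wk Zk by (simp add: nk_def)
    also have "\<dots> = (-1) ^ (rn * k) * (of_real (sin (pi * \<alpha> n) / pi) * E b (W k) * f b (W k))"
      unfolding sin_k by simp
    finally have "((-1) ^ (rn * k) * (-1) ^ (rn * k)) * (\<Phi>0 * Mh (Z k)) =
       ((-1) ^ (rn * k) * (-1) ^ (rn * k)) * (of_real (sin (pi * \<alpha> n) / pi) * E b (W k) * f b (W k))"
      by (simp only: mult.assoc)
    thus ?thesis unfolding m1_sq by simp
  qed
  have "(\<lambda>k. \<Phi>0 * Mh (Z k)) \<longlonglongrightarrow> \<Phi>0 * 1" unfolding Z_def by (intro tendsto_intros Mh_tendsto)
  moreover have "(\<lambda>k. of_real (sin (pi * \<alpha> n) / pi) * E b (W k) * f b (W k)) \<longlonglongrightarrow> of_real (sin (pi * \<alpha> n) / pi) * of_real D * of_real L"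
    unfolding W_def by (intro tendsto_mult tendsto_const E_tendsto_D f_tendsto_L filterlim_Re_shift)
  ultimately have "\<Phi>0 * 1 = of_real (sin (pi * \<alpha> n) / pi) * of_real D * of_real L"
    unfolding key by (rule LIMSEQ_unique)
  thus ?thesis by (simp add: \<Phi>0_def)
qed

text \<open>The extension of \<open>Phi\<close> from the half plane \<open>Re w < - R\<close> by its periodicity up to sign.\<close>
definition Theta :: "complex \<Rightarrow> complex" where
  "Theta w = (let K = nat \<lceil>Re w + R + 1\<rceil> in (-1) ^ (rn * K) * Phi (w - of_nat K))"

lemma Theta_eq:
  assumes "Re w - real K < - R"
  shows "Theta w = (-1) ^ (rn * K) * Phi (w - of_nat K)"
proof -
  have sh: "(-1) ^ (rn * (K + j)) * Phi (w - of_nat (K + j)) = (-1) ^ (rn * K) * Phi (w - of_nat K)"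
    if "Re w - real K < - R" for K j
  proof -
    have "w - of_nat (K + j) = w - of_nat K - of_nat j" by simp
    moreover have "Phi (w - of_nat K - of_nat j) = (-1) ^ (rn * j) * Phi (w - of_nat K)"
      by (rule Phi_minus_nat[OF _ rn]) (use that in simp)
    ultimately have "(-1) ^ (rn * (K + j)) * Phi (w - of_nat (K + j)) =
       ((-1) ^ (rn * j) * (-1) ^ (rn * j)) * ((-1) ^ (rn * K) * Phi (w - of_nat K))"
      by (simp only: ring_distribs power_add mult_ac)
    thus ?thesis unfolding m1_sq by simp
  qed
  define K' where "K' = nat \<lceil>Re w + R + 1\<rceil>"
  have K': "Re w - real K' < - R" unfolding K'_def by linarith
  have "(-1) ^ (rn * K') * Phi (w - of_nat K') = (-1) ^ (rn * K) * Phi (w - of_nat K)"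
  proof (cases "K \<le> K'")
    case True
    thus ?thesis using sh[OF assms, of "K' - K"] by simp
  next
    case False
    thus ?thesis using sh[OF K', of "K - K'"] by simp
  qed
  thus ?thesis by (simp add: Theta_def K'_def Let_def)
qed

lemma large_shift: obtains K where "Re w - real K < c"
proof -
  obtain K :: nat where "real K > Re w - c" using reals_Archimedean2 by blast
  thus ?thesis using that[of K] by linarith
qed

lemma holomorphic_Theta: "Theta holomorphic_on A"
proof -
  have "Theta analytic_on UNIV"
    unfolding analytic_on_def
  proof
    fix w
    obtain K where K: "Re w - real K < - R - 1" by (rule large_shift)
    have *: "Re z - real K < - R" if "z \<in> ball w 1" for z
    proof -
      have "\<bar>Re w - Re z\<bar> \<le> norm (w - z)" using abs_Re_le_cmod[of "w - z"] by simp
      thus ?thesis using that K by (simp add: dist_norm)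
    qed
    have "(Phi \<circ> (\<lambda>z. z - of_nat K)) holomorphic_on ball w 1"
      by (rule holomorphic_on_compose_gen[OF _ holomorphic_Phi]) (use * in \<open>auto intro!: holomorphic_intros\<close>)
    hence "(\<lambda>z. (-1) ^ (rn * K) * Phi (z - of_nat K)) holomorphic_on ball w 1"
      unfolding o_def by (intro holomorphic_intros)
    hence "Theta holomorphic_on ball w 1"
      by (rule holomorphic_transform) (rule Theta_eq[OF *, symmetric])
    thus "\<exists>e>0. Theta holomorphic_on ball w e" by (intro exI[of _ 1]) auto
  qed
  hence "Theta holomorphic_on UNIV" by (rule analytic_imp_holomorphic)
  thus ?thesis by (rule holomorphic_on_subset) auto
qed

lemma holomorphic_Theta' [holomorphic_intros]: "g holomorphic_on A \<Longrightarrow> (\<lambda>z. Theta (g z)) holomorphic_on A"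
  using holomorphic_on_compose[of g A Theta] holomorphic_Theta by (auto simp: o_def)

lemma Theta_minus_nat: "Theta (w - of_nat k) = (-1) ^ (rn * k) * Theta w"
proof -
  obtain K where K: "Re w - real K < - R" by (rule large_shift)
  have "Theta (w - of_nat k) = (-1) ^ (rn * K) * Phi (w - of_nat k - of_nat K)"
    by (rule Theta_eq) (use K in simp)
  also have "w - of_nat k - of_nat K = w - of_nat K - of_nat k" by simp
  also have "Phi (w - of_nat K - of_nat k) = (-1) ^ (rn * k) * Phi (w - of_nat K)"
    by (rule Phi_minus_nat[OF _ rn]) (use K in simp)
  finally show ?thesis unfolding Theta_eq[OF K] by (simp add: mult_ac)
qed

lemma sinprod_minus_nat: "sinprod xs (w - of_nat k) = (-1) ^ (length xs * k) * sinprod xs w"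
proof (induction k)
  case (Suc k)
  have "sinprod xs (w - of_nat k - 1) = (-1) ^ length xs * sinprod xs (w - of_nat k)" by (rule sinprod_minus_one)
  thus ?case using Suc by (simp add: power_add diff_diff_eq add_ac)
qed simp

lemma Theta_sinprod: "of_real pi * Theta w * sinprod us w = of_real L * sin (of_real (pi * r) * w) * sinprod vs w"
proof -
  obtain K where K: "Re w - real K < - R" by (rule large_shift)
  have "of_real pi * Phi (w - of_nat K) * sinprod us (w - of_nat K) = of_real L * sin (of_real (pi * r) * (w - of_nat K)) * sinprod vs (w - of_nat K)"
    by (rule Phi_eq) (use K in simp)
  moreover have "sin (of_real (pi * r) * (w - of_nat K)) = (-1) ^ (rn * K) * sin (of_real (pi * r) * w)"
    using sin_shift_nat[of rn w K 0] by (simp add: rn)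
  ultimately have "(-1) ^ (length us * K) * (of_real pi * Phi (w - of_nat K) * sinprod us w) =
     (-1) ^ (length us * K) * ((-1) ^ (rn * K) * (of_real L * sin (of_real (pi * r) * w) * sinprod vs w))"
    unfolding sinprod_minus_nat len by (simp only: mult_ac)
  hence "of_real pi * Phi (w - of_nat K) * sinprod us w = (-1) ^ (rn * K) * (of_real L * sin (of_real (pi * r) * w) * sinprod vs w)"
    by simp
  hence "(-1) ^ (rn * K) * (of_real pi * Phi (w - of_nat K) * sinprod us w) = ((-1) ^ (rn * K) * (-1) ^ (rn * K)) * (of_real L * sin (of_real (pi * r) * w) * sinprod vs w)"
    by (simp only: mult.assoc)
  thus ?thesis unfolding m1_sq Theta_eq[OF K] by (simp add: mult_ac)
qed

text \<open>The point is \<open>m / r\<close> with an integer \<open>m\<close>. An integer shift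
  carries it to some \<open>- n / r\<close> with \<open>n\<close> large, where \<open>Phi\<close> is
  known exactly; both sides pick up the same sign.\<close>

lemma Theta_at_zero:
  assumes "of_real r * w \<in> \<int>"
  shows "Theta w = of_real (D * L / pi) * sin (of_real pi * (of_real p * w + of_real a))"
proof -
  obtain m :: int where m: "of_real r * w = of_int m" using assms by (metis Ints_cases)
  have w: "w = of_real (of_int m / r)" using m r_pos by (simp add: field_simps)
  obtain N where N: "\<And>n. n \<ge> N \<Longrightarrow> \<alpha> n < 1 \<and> \<alpha> n + real n + 1 > 0 \<and> real n / r > R" using large_index by blast
  have rn0: "rn > 0" using rn r_pos by simp
  define K where "K = N + nat \<bar>m\<bar>"
  define n where "n = nat (int (rn * K) - m)"
  have "int (rn * K) \<ge> int K" using rn0 mult_right_mono[of 1 "int rn" "int K"] by simp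
  hence K1: "int (rn * K) - m \<ge> int N" unfolding K_def by linarith
  hence nN: "n \<ge> N" by (simp add: n_def)
  have n_eq: "real n = r * real K - of_int m" using K1 by (simp add: n_def rn)
  have wK: "w - of_nat K = - of_nat n / of_real r"
  proof -
    have "w - of_nat K = of_real (of_int m / r - real K)" by (simp add: w)
    also have "of_int m / r - real K = - real n / r" using r_pos by (simp add: n_eq field_simps)
    finally show ?thesis by simp
  qed
  have ReK: "Re w - real K < - R"
  proof -
    have "Re w - real K = Re (w - of_nat K)" by simp
    also have "\<dots> = - real n / r" unfolding wK by (simp add: Re_divide_of_real)
    finally show ?thesis using N[OF nN] by simp
  qed
  have "Phi (- of_nat n / of_real r) = of_real (D * L / pi) * of_real (sin (pi * \<alpha> n))"
    by (rule Phi_at_neg_exact) (use N nN in auto)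
  moreover have "of_real (sin (pi * \<alpha> n)) = (-1) ^ (rn * K) * sin (of_real pi * (of_real p * w + of_real a))"
  proof -
    have "\<alpha> n = p * (of_int m / r - real K) + a" using r_pos by (simp add: \<alpha>_def n_eq field_simps)
    hence "complex_of_real (sin (pi * \<alpha> n)) = sin (of_real (pi * (p * (of_int m / r - real K) + a)))"
      by (simp only: sin_of_real)
    also have "complex_of_real (pi * (p * (of_int m / r - real K) + a)) = of_real (pi * real pn) * (w - of_nat K) + of_real (pi * a)"
      by (simp add: w pn algebra_simps)
    also have "sin \<dots> = (-1) ^ (rn * K) * sin (of_real (pi * real pn) * w + of_real (pi * a))"
      unfolding sin_shift_nat parity_power ..
    also have "of_real (pi * real pn) * w + of_real (pi * a) = of_real pi * (of_real p * w + of_real a)"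
      by (simp add: pn algebra_simps)
    finally show ?thesis .
  qed
  ultimately have "Theta w = ((-1) ^ (rn * K) * (-1) ^ (rn * K)) * (of_real (D * L / pi) * sin (of_real pi * (of_real p * w + of_real a)))"
    unfolding Theta_eq[OF ReK] wK by (simp only: mult_ac)
  thus ?thesis unfolding m1_sq by simp
qed

end

section \<open>Division of entire functions, and sines for large imaginary part\<close>

lemma entire_quotient_simple_zeros:
  fixes g s :: "complex \<Rightarrow> complex"
  assumes g: "g holomorphic_on UNIV" and s: "s holomorphic_on UNIV"
    and z: "\<And>w. s w = 0 \<Longrightarrow> g w = 0 \<and> deriv s w \<noteq> 0"
  obtains q where "q holomorphic_on UNIV" "\<And>w. g w = s w * q w"
proof -
  \<comment> \<open>At a zero of \<open>s\<close>, which is simple, the quotient receives its limit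
    value; locally \<open>g\<close> and \<open>s\<close> share the factor
    \<open>z - w0\<close>.\<close>
  define q where "q = (\<lambda>w. if s w = 0 then deriv g w / deriv s w else g w / s w)"
  have "q analytic_on UNIV"
    unfolding analytic_on_def
  proof
    fix w0 :: complex
    show "\<exists>e>0. q holomorphic_on ball w0 e"
    proof (cases "s w0 = 0")
      case False
      have "isCont s w0" using holomorphic_on_imp_continuous_on[OF s] by (simp add: continuous_on_eq_continuous_at)
      then obtain e where e: "e > 0" "\<And>z. dist z w0 < e \<Longrightarrow> s z \<noteq> 0"
        using False by (metis continuous_at_avoid dist_commute)
      have nz: "s z \<noteq> 0" if "z \<in> ball w0 e" for z using that e(2)[of z] by (simp add: dist_commute)
      have "(\<lambda>z. g z / s z) holomorphic_on ball w0 e"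
        by (intro holomorphic_intros holomorphic_on_subset[OF g] holomorphic_on_subset[OF s] nz) auto
      hence "q holomorphic_on ball w0 e"
        by (rule holomorphic_transform) (use nz in \<open>auto simp: q_def\<close>)
      thus ?thesis using e by blast
    next
      case True
      define A where "A = (\<lambda>z. if z = w0 then deriv g w0 else (g z - g w0) / (z - w0))"
      define B where "B = (\<lambda>z. if z = w0 then deriv s w0 else (s z - s w0) / (z - w0))"
      have A: "A holomorphic_on UNIV" unfolding A_def by (rule pole_lemma[OF g]) simp
      have B: "B holomorphic_on UNIV" unfolding B_def by (rule pole_lemma[OF s]) simp
      have gA: "g z = (z - w0) * A z" and sB: "s z = (z - w0) * B z" for z
        using z[OF True] True by (auto simp: A_def B_def)
      have "B w0 \<noteq> 0" using z[OF True] by (simp add: B_def)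
      moreover have "isCont B w0" using holomorphic_on_imp_continuous_on[OF B] by (simp add: continuous_on_eq_continuous_at)
      ultimately obtain e where e: "e > 0" "\<And>z. dist z w0 < e \<Longrightarrow> B z \<noteq> 0"
        by (metis continuous_at_avoid dist_commute)
      have nz: "B z \<noteq> 0" if "z \<in> ball w0 e" for z using that e(2)[of z] by (simp add: dist_commute)
      have "(\<lambda>z. A z / B z) holomorphic_on ball w0 e"
        by (intro holomorphic_intros holomorphic_on_subset[OF A] holomorphic_on_subset[OF B] nz) auto
      hence "q holomorphic_on ball w0 e"
      proof (rule holomorphic_transform)
        fix z assume "z \<in> ball w0 e"
        show "A z / B z = q z"
        proof (cases "z = w0")
          case True
          thus ?thesis using \<open>s w0 = 0\<close> by (simp add: A_def B_def q_def)
        next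
          case False
          thus ?thesis using nz[OF \<open>z \<in> ball w0 e\<close>] by (simp add: q_def gA sB)
        qed
      qed
      thus ?thesis using e by blast
    qed
  qed
  hence "q holomorphic_on UNIV" by (rule analytic_imp_holomorphic)
  moreover have "g w = s w * q w" for w using z[of w] by (auto simp: q_def)
  ultimately show ?thesis by (rule that)
qed

text \<open>Separates the exponential that dominates when \<open>\<epsilon> * Im z\<close> tends to
  infinity from a factor tending to 1.\<close>

lemma sin_exp_form:
  fixes z :: complex
  assumes "\<epsilon> = 1 \<or> \<epsilon> = -1"
  shows "sin z = of_real \<epsilon> * \<i> / 2 * exp (- \<i> * of_real \<epsilon> * z) * (1 - exp (2 * \<i> * of_real \<epsilon> * z))"
proof -
  have 1: "exp (- (\<i> * z)) * exp (2 * \<i> * z) = exp (\<i> * z)" "exp (\<i> * z) * exp (- (2 * \<i> * z)) = exp (- (\<i> * z))"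
    by (simp_all add: algebra_simps flip: exp_add)
  have s: "sin z = \<i> / 2 * (exp (- (\<i> * z)) - exp (\<i> * z))"
    by (simp add: sin_exp_eq')
  show ?thesis
  proof (cases "\<epsilon> = 1")
    case True
    have "\<i> / 2 * exp (- (\<i> * z)) * (1 - exp (2 * \<i> * z)) = \<i> / 2 * (exp (- (\<i> * z)) - exp (- (\<i> * z)) * exp (2 * \<i> * z))"
      by (simp only: right_diff_distrib mult_1_right mult.assoc)
    thus ?thesis unfolding 1 s[symmetric] by (simp add: True)
  next
    case False
    hence \<epsilon>: "\<epsilon> = -1" using assms by simp
    have "- \<i> / 2 * exp (\<i> * z) * (1 - exp (- (2 * \<i> * z))) = - \<i> / 2 * (exp (\<i> * z) - exp (\<i> * z) * exp (- (2 * \<i> * z)))"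
      by (simp only: right_diff_distrib mult_1_right mult.assoc)
    also have "\<dots> = sin z" unfolding 1 s by (simp add: algebra_simps)
    finally show ?thesis by (simp add: \<epsilon>)
  qed
qed

text \<open>Approach to infinity in the upper or lower direction for \<epsilon> = 1 or -1, uniformly
  in the real part.\<close>

definition im_filter :: "real \<Rightarrow> complex filter" where
  "im_filter \<epsilon> = filtercomap (\<lambda>w. \<epsilon> * Im w) at_top"

lemma exp_im_filter_tendsto_0:
  assumes "c > 0"
  shows "((\<lambda>w. exp (\<i> * of_real \<epsilon> * (of_real c * w + d))) \<longlongrightarrow> 0) (im_filter \<epsilon>)"
proof (rule tendsto_norm_zero_cancel)
  have "filterlim (\<lambda>w. \<epsilon> * Im w) at_top (im_filter \<epsilon>)" unfolding im_filter_def by (rule filterlim_filtercomap)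
  hence "filterlim (\<lambda>w. (- c) * (\<epsilon> * Im w)) at_bot (im_filter \<epsilon>)"
    using assms by (intro filterlim_tendsto_neg_mult_at_bot[OF tendsto_const]) auto
  hence "((\<lambda>w. exp ((- c) * (\<epsilon> * Im w))) \<longlongrightarrow> 0) (im_filter \<epsilon>)"
    by (rule filterlim_compose[OF exp_at_bot])
  hence "((\<lambda>w. exp (- \<epsilon> * Im d) * exp ((- c) * (\<epsilon> * Im w))) \<longlongrightarrow> exp (- \<epsilon> * Im d) * 0) (im_filter \<epsilon>)"
    by (intro tendsto_mult tendsto_const)
  hence "((\<lambda>w. exp ((- \<epsilon> * Im d) + (- c) * (\<epsilon> * Im w))) \<longlongrightarrow> 0) (im_filter \<epsilon>)"
    by (simp only: exp_add mult_zero_right)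
  thus "((\<lambda>w. norm (exp (\<i> * of_real \<epsilon> * (of_real c * w + d)))) \<longlongrightarrow> 0) (im_filter \<epsilon>)"
    by (simp add: norm_exp_eq_Re algebra_simps)
qed

definition exp_prod :: "real \<Rightarrow> complex list \<Rightarrow> complex \<Rightarrow> complex" where
  "exp_prod \<epsilon> us w = prod_list (map (\<lambda>u. 1 - exp (\<i> * of_real \<epsilon> * (of_real (2 * pi) * w + of_real (2 * pi) * u))) us)"

lemma exp_prod_tendsto_1: "((\<lambda>w. exp_prod \<epsilon> us w) \<longlongrightarrow> 1) (im_filter \<epsilon>)"
proof (induction us)
  case (Cons u us)
  have "((\<lambda>w. (1 - exp (\<i> * of_real \<epsilon> * (of_real (2 * pi) * w + of_real (2 * pi) * u))) * exp_prod \<epsilon> us w) \<longlongrightarrow> (1 - 0) * 1) (im_filter \<epsilon>)"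
    by (intro tendsto_intros exp_im_filter_tendsto_0 Cons) simp
  thus ?case by (simp add: exp_prod_def)
qed (simp add: exp_prod_def)

lemma sinprod_exp_form:
  assumes "\<epsilon> = 1 \<or> \<epsilon> = -1"
  shows "sinprod us w = (of_real \<epsilon> * \<i> / 2) ^ length us * exp (- \<i> * of_real \<epsilon> * of_real pi * (of_nat (length us) * w + sum_list us)) * exp_prod \<epsilon> us w"
proof (induction us)
  case Nil
  show ?case by (simp add: exp_prod_def)
next
  case (Cons u us)
  have 1: "- \<i> * of_real \<epsilon> * of_real pi * (of_nat (length (u # us)) * w + sum_list (u # us)) =
    - \<i> * of_real \<epsilon> * (of_real pi * (w + u)) + - \<i> * of_real \<epsilon> * of_real pi * (of_nat (length us) * w + sum_list us)"
    by (simp add: algebra_simps)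
  have 2: "exp_prod \<epsilon> (u # us) w = (1 - exp (2 * \<i> * of_real \<epsilon> * (of_real pi * (w + u)))) * exp_prod \<epsilon> us w"
    by (simp add: exp_prod_def algebra_simps)
  have 3: "(c * x * y) * (d * x' * y') = (c * d) * (x * x') * (y * y')" for c x y d x' y' :: complex by (simp add: mult_ac)
  have "sinprod (u # us) w = sin (of_real pi * (w + u)) * sinprod us w" by simp
  thus ?case unfolding 1 2 exp_add Cons sin_exp_form[OF assms, of "of_real pi * (w + u)"] 3 by simp
qed

text \<open>The dominant exponential of \<open>sinprod\<close> depends on the number and the sum of
  the parameters only, so it cancels for balanced lists.\<close>

lemma sinprod_ratio_tendsto_1:
  assumes \<epsilon>: "\<epsilon> = 1 \<or> \<epsilon> = -1" and len: "length us = length vs" and sum: "sum_list us = sum_list vs"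
  shows "((\<lambda>w. sinprod vs w / sinprod us w) \<longlongrightarrow> 1) (im_filter \<epsilon>)"
proof -
  have "((\<lambda>w. exp_prod \<epsilon> vs w / exp_prod \<epsilon> us w) \<longlongrightarrow> 1 / 1) (im_filter \<epsilon>)"
    by (intro tendsto_divide exp_prod_tendsto_1) simp
  moreover have "sinprod vs w / sinprod us w = exp_prod \<epsilon> vs w / exp_prod \<epsilon> us w" for w
    unfolding sinprod_exp_form[OF \<epsilon>] len sum using \<epsilon> by auto
  ultimately show ?thesis by simp
qed

lemma eventually_im_filter: "eventually (\<lambda>w. \<epsilon> * Im w \<ge> y) (im_filter \<epsilon>)"
  unfolding im_filter_def by (rule eventually_filtercomapI[of "\<lambda>x. x \<ge> y"]) (auto simp: eventually_ge_at_top)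

lemma sin_ratio_tendsto_0:
  assumes \<epsilon>: "\<epsilon> = 1 \<or> \<epsilon> = -1" and pr: "0 < p" "p < r"
  shows "((\<lambda>w. sin (of_real pi * (of_real p * w + of_real a)) / sin (of_real (pi * r) * w)) \<longlongrightarrow> 0) (im_filter \<epsilon>)"
proof -
  have "((\<lambda>w. exp (\<i> * of_real \<epsilon> * (of_real (pi * (r - p)) * w + - of_real (pi * a))) *
      ((1 - exp (\<i> * of_real \<epsilon> * (of_real (2 * pi * p) * w + of_real (2 * pi * a)))) /
      (1 - exp (\<i> * of_real \<epsilon> * (of_real (2 * pi * r) * w + 0))))) \<longlongrightarrow> 0 * ((1 - 0) / (1 - 0))) (im_filter \<epsilon>)"
    using pr by (intro tendsto_intros exp_im_filter_tendsto_0 mult_pos_pos) auto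
  moreover have "exp (\<i> * of_real \<epsilon> * (of_real (pi * (r - p)) * w + - of_real (pi * a))) *
      ((1 - exp (\<i> * of_real \<epsilon> * (of_real (2 * pi * p) * w + of_real (2 * pi * a)))) /
      (1 - exp (\<i> * of_real \<epsilon> * (of_real (2 * pi * r) * w + 0)))) =
      sin (of_real pi * (of_real p * w + of_real a)) / sin (of_real (pi * r) * w)" for w
  proof -
    define A where "A = of_real pi * (of_real p * w + of_real a)"
    define B where "B = of_real (pi * r) * w"
    have e: "\<i> * of_real \<epsilon> * (of_real (2 * pi * p) * w + of_real (2 * pi * a)) = 2 * \<i> * of_real \<epsilon> * A"
      "\<i> * of_real \<epsilon> * (of_real (2 * pi * r) * w + 0) = 2 * \<i> * of_real \<epsilon> * B"
      "\<i> * of_real \<epsilon> * (of_real (pi * (r - p)) * w + - of_real (pi * a)) = (- \<i> * of_real \<epsilon> * A) - (- \<i> * of_real \<epsilon> * B)"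
      by (simp_all add: A_def B_def algebra_simps)
    have "sin A / sin B = exp (- \<i> * of_real \<epsilon> * A) / exp (- \<i> * of_real \<epsilon> * B) * ((1 - exp (2 * \<i> * of_real \<epsilon> * A)) / (1 - exp (2 * \<i> * of_real \<epsilon> * B)))"
      unfolding sin_exp_form[OF \<epsilon>, of A] sin_exp_form[OF \<epsilon>, of B] using \<epsilon> by auto
    thus ?thesis unfolding e exp_diff A_def[symmetric] B_def[symmetric] by simp
  qed
  ultimately show ?thesis by simp
qed

text \<open>The limits bound \<open>q\<close> outside a horizontal strip, compactness of one period
  rectangle bounds it inside. Liouville's theorem makes \<open>q\<close> constant, and the limit
  identifies the constant.\<close>

lemma periodic_bounded_imp_constant:
  fixes q :: "complex \<Rightarrow> complex"
  assumes q: "q holomorphic_on UNIV" and per: "\<And>w. q (w - 1) = q w"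
    and lim: "\<And>\<epsilon>. \<epsilon> = 1 \<or> \<epsilon> = -1 \<Longrightarrow> (q \<longlongrightarrow> c) (im_filter \<epsilon>)"
  shows "q w = c"
proof -
  have per_nat: "q (w - of_nat k) = q w" for w k
  proof (induction k)
    case (Suc k)
    have "q (w - of_nat k - 1) = q (w - of_nat k)" by (rule per)
    thus ?case using Suc by (simp add: diff_diff_eq add_ac)
  qed simp
  have per_int: "q (w - of_int k) = q w" for w k
  proof (cases "k \<ge> 0")
    case True
    thus ?thesis using per_nat[of w "nat k"] by simp
  next
    case False
    thus ?thesis using per_nat[of "w - of_int k" "nat (- k)"] by simp
  qed
  have ev: "\<exists>Y. \<forall>w. \<epsilon> * Im w \<ge> Y \<longrightarrow> norm (q w) \<le> norm c + 1" if "\<epsilon> = 1 \<or> \<epsilon> = -1" for \<epsilon>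
  proof -
    have "eventually (\<lambda>w. norm (q w) < norm c + 1) (im_filter \<epsilon>)"
      by (rule order_tendstoD(2)[OF tendsto_norm[OF lim[OF that]]]) simp
    thus ?thesis unfolding im_filter_def eventually_filtercomap eventually_at_top_linorder
      by (metis less_imp_le)
  qed
  obtain Y1 where Y1: "\<And>w. Im w \<ge> Y1 \<Longrightarrow> norm (q w) \<le> norm c + 1" using ev[of 1] by auto
  obtain Y2 where Y2: "\<And>w. - Im w \<ge> Y2 \<Longrightarrow> norm (q w) \<le> norm c + 1" using ev[of "-1"] by auto
  define Y where "Y = max \<bar>Y1\<bar> \<bar>Y2\<bar>"
  have "continuous_on (cbox (Complex 0 (- Y)) (Complex 1 Y)) q"
    using holomorphic_on_imp_continuous_on[OF q] by (rule continuous_on_subset) auto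
  hence "bounded (q ` cbox (Complex 0 (- Y)) (Complex 1 Y))"
    by (intro compact_imp_bounded compact_continuous_image) auto
  then obtain B where B: "\<And>w. w \<in> cbox (Complex 0 (- Y)) (Complex 1 Y) \<Longrightarrow> norm (q w) \<le> B"
    by (meson bounded_iff imageI)
  have "norm (q w) \<le> max B (norm c + 1)" for w
  proof (cases "\<bar>Im w\<bar> \<le> Y")
    case True
    have "w - of_int \<lfloor>Re w\<rfloor> \<in> cbox (Complex 0 (- Y)) (Complex 1 Y)"
      using True by (auto simp: in_cbox_complex_iff) linarith+
    hence "norm (q (w - of_int \<lfloor>Re w\<rfloor>)) \<le> B" by (rule B)
    thus ?thesis unfolding per_int by simp
  next
    case False
    hence "Im w \<ge> Y1 \<or> - Im w \<ge> Y2" unfolding Y_def by linarith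
    hence "norm (q w) \<le> norm c + 1" using Y1[of w] Y2[of w] by blast
    thus ?thesis by simp
  qed
  hence "bounded (range q)" unfolding bounded_iff by blast
  then obtain c' where c': "\<And>w. q w = c'" using Liouville_theorem[OF q] unfolding constant_on_def by blast
  have "filterlim (\<lambda>n. Complex 0 (real n)) (im_filter 1) sequentially"
    unfolding im_filter_def filterlim_filtercomap_iff by (simp add: o_def filterlim_real_sequentially)
  from filterlim_compose[OF lim[of 1] this] have "(\<lambda>n. c') \<longlonglongrightarrow> c" by (simp add: c')
  hence "c' = c" by (rule LIMSEQ_unique[OF tendsto_const])
  thus ?thesis using c' by simp
qed

context gpf_dual_ctx
begin

text \<open>By \<open>Theta_at_zero\<close> the difference \<open>X\<close> vanishes at the simple
  zeros of \<open>S w = sin (pi * r * w)\<close>, so \<open>q = X / S\<close> is entire.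
  \<open>Theta\<close>, \<open>T\<close> and \<open>S\<close> change by the same sign under a unit
  shift, hence \<open>q\<close> has period 1. It tends to \<open>L / pi\<close> in both imaginary
  directions: the sine products are balanced, and \<open>T / S\<close> decays because
  \<open>p < r\<close>.\<close>

lemma Theta_formula:
  "Theta w = of_real (L / pi) * (sin (of_real (pi * r) * w) + of_real D * sin (of_real pi * (of_real p * w + of_real a)))"
proof -
  define S where "S = (\<lambda>w::complex. sin (of_real (pi * r) * w))"
  define T where "T = (\<lambda>w::complex. sin (of_real pi * (of_real p * w + of_real a)))"
  define X where "X = (\<lambda>w. Theta w - of_real (D * L / pi) * T w)"
  have S_int: "S w = 0 \<longleftrightarrow> of_real r * w \<in> \<int>" for w
  proof -
    have "S w = sin (of_real pi * (of_real r * w))" by (simp add: S_def mult.assoc)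
    thus ?thesis by (simp only: sin_pi_eq_0_iff)
  qed
  have holS: "S holomorphic_on UNIV" unfolding S_def by (intro holomorphic_intros)
  have holX: "X holomorphic_on UNIV" unfolding X_def T_def by (intro holomorphic_intros)
  have zeros: "X w = 0 \<and> deriv S w \<noteq> 0" if "S w = 0" for w
  proof
    show "X w = 0" using Theta_at_zero that unfolding S_int X_def T_def by simp
    have "(S has_field_derivative cos (of_real (pi * r) * w) * of_real (pi * r)) (at w)"
      unfolding S_def by (auto intro!: derivative_eq_intros)
    hence "deriv S w = cos (of_real (pi * r) * w) * of_real (pi * r)" by (rule DERIV_imp_deriv)
    moreover have "cos (of_real (pi * r) * w) \<noteq> 0"
    proof
      assume "cos (of_real (pi * r) * w) = 0"
      thus False using that sin_cos_squared_add[of "of_real (pi * r) * w"] by (simp add: S_def)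
    qed
    ultimately show "deriv S w \<noteq> 0" using r_pos by simp
  qed
  obtain q where q: "q holomorphic_on UNIV" "\<And>w. X w = S w * q w"
    using entire_quotient_simple_zeros[OF holX holS zeros] by blast
  have S1: "S (w - 1) = (-1) ^ rn * S w" for w
    using sin_shift_nat[of rn w 1 0] by (simp add: S_def rn)
  have T1: "T (w - 1) = (-1) ^ rn * T w" for w
  proof -
    have e: "of_real pi * (of_real p * w + of_real a) = of_real (pi * real pn) * w + of_real (pi * a)" for w
      by (simp add: pn algebra_simps)
    show ?thesis using sin_shift_nat[of pn w 1 "of_real (pi * a)"] parity_power[of 1, where ?'a = complex] unfolding T_def e by simp
  qed
  have Theta1: "Theta (w - 1) = (-1) ^ rn * Theta w" for w using Theta_minus_nat[of w 1] by simp
  have per: "q (w - 1) = q w" for w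
  proof (rule holomorphic_cancel[where S = UNIV and g = "\<lambda>w. q (w - 1)" and h = q and k = S and pt = "\<i>" and z = w])
    show "(\<lambda>w. q (w - 1)) holomorphic_on UNIV"
    proof -
      have "(q \<circ> (\<lambda>w. w - 1)) holomorphic_on UNIV"
        by (rule holomorphic_on_compose_gen[OF _ q(1)]) (auto intro!: holomorphic_intros)
      thus ?thesis by (simp add: o_def)
    qed
    show "S \<i> \<noteq> 0"
    proof
      assume "S \<i> = 0"
      hence "of_real r * \<i> \<in> \<int>" by (simp only: S_int)
      hence "Im (of_real r * \<i>) = 0" by (metis Ints_cases complex_Im_of_int)
      thus False using r_pos by simp
    qed
    fix z assume nz: "S z \<noteq> 0"
    have "(-1) ^ rn * S z * q (z - 1) = X (z - 1)" using q(2)[of "z - 1"] S1 by simp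
    also have "\<dots> = (-1) ^ rn * X z" unfolding X_def Theta1 T1 by (simp add: algebra_simps)
    also have "\<dots> = (-1) ^ rn * S z * q z" using q(2)[of z] by simp
    finally show "q (z - 1) = q z" using nz by simp
  qed (use holS q in auto)
  have lim: "(q \<longlongrightarrow> of_real (L / pi)) (im_filter \<epsilon>)" if \<epsilon>: "\<epsilon> = 1 \<or> \<epsilon> = -1" for \<epsilon>
  proof -
    obtain Y where Y: "\<And>w. \<bar>Im w\<bar> \<ge> Y \<Longrightarrow> sinprod us w \<noteq> 0" using sinprod_nonzero by blast
    have "((\<lambda>w. of_real (L / pi) * (sinprod vs w / sinprod us w) - of_real (D * L / pi) * (T w / S w)) \<longlongrightarrow>
        of_real (L / pi) * 1 - of_real (D * L / pi) * 0) (im_filter \<epsilon>)"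
      unfolding T_def S_def
      by (intro tendsto_diff tendsto_mult tendsto_const sinprod_ratio_tendsto_1 sin_ratio_tendsto_0 \<epsilon> len sum p_pos p_less_r)
    moreover have "eventually (\<lambda>w. of_real (L / pi) * (sinprod vs w / sinprod us w) - of_real (D * L / pi) * (T w / S w) = q w) (im_filter \<epsilon>)"
      using eventually_im_filter[of "max 1 Y" \<epsilon>]
    proof eventually_elim
      case (elim w)
      hence im: "\<bar>Im w\<bar> \<ge> max 1 Y" using \<epsilon> by auto
      have S: "S w \<noteq> 0"
      proof
        assume "S w = 0"
        hence "of_real r * w \<in> \<int>" by (simp only: S_int)
        hence "Im (of_real r * w) = 0" by (metis Ints_cases complex_Im_of_int)
        thus False using r_pos im by auto
      qed
      have su: "sinprod us w \<noteq> 0" using im by (intro Y) simp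
      have "of_real pi * Theta w * sinprod us w = of_real L * S w * sinprod vs w"
        unfolding S_def by (rule Theta_sinprod)
      hence "Theta w / S w = of_real (L / pi) * (sinprod vs w / sinprod us w)" using S su by (simp add: field_simps)
      moreover have "q w = Theta w / S w - of_real (D * L / pi) * (T w / S w)"
        using q(2)[of w] S by (simp add: X_def field_simps)
      ultimately show ?case by simp
    qed
    ultimately have "(q \<longlongrightarrow> of_real (L / pi) * 1 - of_real (D * L / pi) * 0) (im_filter \<epsilon>)"
      by (rule Lim_transform_eventually)
    thus ?thesis by simp
  qed
  have "q w = of_real (L / pi)" by (rule periodic_bounded_imp_constant[OF q(1) per lim])
  hence "X w = S w * of_real (L / pi)" using q(2)[of w] by simp
  thus ?thesis unfolding X_def S_def T_def by (simp add: algebra_simps)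
qed

end

section \<open>The connection formula\<close>

lemma sin_pi_add_int: "\<bar>sin (pi * (y + of_int m))\<bar> = \<bar>sin (pi * y)\<bar>"
proof -
  have "pi * (y + of_int m) = pi * y + of_int m * pi" by (simp add: algebra_simps)
  moreover have "sin (of_int m * pi) = 0" by (simp add: sin_zero_iff_int2)
  moreover from this have "\<bar>cos (of_int m * pi)\<bar> = 1"
    using sin_cos_squared_add[of "of_int m * pi"] by (simp add: abs_square_eq_1)
  ultimately show ?thesis by (simp add: sin_add abs_mult)
qed

text \<open>The source of the upper bound \<open>s\<close> for \<open>D\<close>.\<close>

lemma abs_sin_mult_le: "\<bar>sin (real n * y)\<bar> \<le> real n * \<bar>sin y\<bar>"
proof (induction n)
  case (Suc n)
  have "sin (real (Suc n) * y) = sin (real n * y) * cos y + cos (real n * y) * sin y"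
    by (simp add: sin_add ring_distribs)
  also have "\<bar>\<dots>\<bar> \<le> \<bar>sin (real n * y)\<bar> * \<bar>cos y\<bar> + \<bar>cos (real n * y)\<bar> * \<bar>sin y\<bar>"
    by (metis abs_mult abs_triangle_ineq)
  also have "\<dots> \<le> \<bar>sin (real n * y)\<bar> * 1 + 1 * \<bar>sin y\<bar>"
    by (intro add_mono mult_left_mono mult_right_mono) auto
  finally show ?case using Suc by (simp add: ring_distribs)
qed simp

text \<open>Chebyshev polynomials of the second kind, with the index raised by one. They turn the
  equation \<open>sin (s y) = l * sin y\<close> into a polynomial equation for
  \<open>cos y\<close>.\<close>

fun cheb :: "nat \<Rightarrow> complex poly" where
  "cheb 0 = 0"
| "cheb (Suc 0) = 1"
| "cheb (Suc (Suc n)) = [:0, 2:] * cheb (Suc n) - cheb n"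

lemma cheb_sin: "poly (cheb n) (cos y) * sin y = sin (of_nat n * y)"
proof (induction n rule: cheb.induct)
  case (3 n)
  define t where "t = of_nat (Suc n) * y"
  have "of_nat (Suc (Suc n)) * y = t + y" "of_nat n * y = t - y" by (simp_all add: t_def algebra_simps)
  hence "sin (of_nat (Suc (Suc n)) * y) = 2 * cos y * sin t - sin (of_nat n * y)"
    by (simp add: sin_add sin_diff)
  thus ?case using 3 by (simp add: t_def algebra_simps)
qed auto

lemma cheb_at_1: "poly (cheb n) 1 = of_nat n" and cheb_at_m1: "poly (cheb n) (-1) = - ((-1) ^ n * of_nat n)"
  by (induction n rule: cheb.induct) (simp_all add: algebra_simps)

text \<open>The polynomial is not constant, since its value is \<open>s\<close> at 1 but 0 at
  \<open>cos (pi / s)\<close>. A complex root exists, and every complex number is a cosine.\<close>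

lemma cheb_root:
  assumes "s \<ge> 2"
  obtains y where "poly (cheb s) (cos y) = l"
proof -
  have "\<not> constant (poly (cheb s - [:l:]))"
  proof
    assume "constant (poly (cheb s - [:l:]))"
    hence "poly (cheb s - [:l:]) 1 = poly (cheb s - [:l:]) (cos (of_real (pi / real s)))"
      unfolding Fundamental_Theorem_Algebra.constant_def by blast
    hence eq: "poly (cheb s) (cos (of_real (pi / real s))) = of_nat s" by (simp add: cheb_at_1)
    have "poly (cheb s) (cos (of_real (pi / real s))) * sin (of_real (pi / real s)) = sin (of_nat s * of_real (pi / real s))"
      by (rule cheb_sin)
    also have "of_nat s * of_real (pi / real s) = complex_of_real pi" using assms by simp
    also have "sin (complex_of_real pi) = 0" by (simp flip: sin_of_real)
    finally have "sin (complex_of_real (pi / real s)) = 0" using eq assms by auto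
    hence "sin (pi / real s) = 0" by (simp only: sin_of_real of_real_eq_0_iff)
    moreover have "sin (pi / real s) > 0"
    proof (rule sin_gt_zero)
      show "0 < pi / real s" using assms by simp
      have "pi < pi * real s" using assms by simp
      thus "pi / real s < pi" using assms by (simp add: field_simps)
    qed
    ultimately show False by simp
  qed
  then obtain c where "poly (cheb s - [:l:]) c = 0" using Fundamental_Theorem_Algebra.fundamental_theorem_of_algebra by blast
  hence "poly (cheb s) (cos (Arccos c)) = l" by simp
  thus ?thesis by (rule that)
qed

context gpf_dual_ctx
begin

definition X :: "complex \<Rightarrow> complex" where
  "X w = exp (of_real (ln x) * (of_real r * w - 1)) * exp (of_real (ln (1 - x)) * (1/2 + of_real b - of_real (r - p) * w))"

lemma E_entire:
  "rGamma (of_real r * w - 1) * rGamma (of_real r * w) * X w * rgprod U w =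
   of_real (D * sqrt pi) * (rGamma (of_real (r - p) * w - of_real b) * rGamma (of_real p * w + of_real b) * rGamma (of_real r * w - 1/2)) * rgprod V w"
proof -
  obtain R2 where R2: "\<And>w. Re w \<ge> R2 \<Longrightarrow> rgprod U w \<noteq> 0" using rgprod_nonzero_right by blast
  define Q where "Q = Max {R2, \<bar>b\<bar> / (r - p), \<bar>b\<bar> / p, 1 / r}"
  have Q: "Q \<ge> R2" "Q \<ge> \<bar>b\<bar> / (r - p)" "Q \<ge> \<bar>b\<bar> / p" "Q \<ge> 1 / r" by (auto simp: Q_def)
  define g where "g = (\<lambda>w. rGamma (of_real r * w - 1) * rGamma (of_real r * w) * X w * rgprod U w)"
  define h where "h = (\<lambda>w. of_real (D * sqrt pi) * (rGamma (of_real (r - p) * w - of_real b) * rGamma (of_real p * w + of_real b) * rGamma (of_real r * w - 1/2)) * rgprod V w)"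
  have "g w = h w"
  proof (rule analytic_continuation_open[of "{z. Re z > Q}" UNIV g h])
    show "open {z. Re z > Q}" by (rule open_halfspace_Re_gt)
    have "complex_of_real (Q + 1) \<in> {z. Re z > Q}" by simp
    thus "{z. Re z > Q} \<noteq> {}" by blast
    show "g holomorphic_on UNIV" "h holomorphic_on UNIV" unfolding g_def h_def X_def by (intro holomorphic_intros)+
    fix z assume "z \<in> {z. Re z > Q}"
    hence z: "Re z > Q" by simp
    have pos: "(r - p) * Re z > b" "p * Re z > - b" "r * Re z > 1/2"
    proof -
      have "\<bar>b\<bar> / (r - p) < Re z" using Q z by linarith
      thus "(r - p) * Re z > b" using p_less_r by (simp add: pos_divide_less_eq mult.commute)
      have "\<bar>b\<bar> / p < Re z" using Q z by linarith
      thus "p * Re z > - b" using p_pos by (simp add: pos_divide_less_eq mult.commute)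
      have "1 / r < Re z" using Q z by linarith
      thus "r * Re z > 1/2" using r_pos by (simp add: pos_divide_less_eq mult.commute)
    qed
    have G: "rGamma (of_real (r - p) * z - of_real b) * Gamma (of_real (r - p) * z - of_real b) = 1"
        "rGamma (of_real p * z + of_real b) * Gamma (of_real p * z + of_real b) = 1"
        "rGamma (of_real r * z - 1/2) * Gamma (of_real r * z - 1/2) = 1"
    proof -
      have *: "rGamma y * Gamma y = 1" if "Re y > 0" for y :: complex
        using not_nonpos_Ints_if_Re_pos[OF that] by (simp add: rGamma_inverse_Gamma Gamma_eq_zero_iff)
      show "rGamma (of_real (r - p) * z - of_real b) * Gamma (of_real (r - p) * z - of_real b) = 1"
        "rGamma (of_real p * z + of_real b) * Gamma (of_real p * z + of_real b) = 1"
        "rGamma (of_real r * z - 1/2) * Gamma (of_real r * z - 1/2) = 1"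
        using pos by (intro *; simp)+
    qed
    have U: "rgprod U z \<noteq> 0" using Q z by (intro R2) simp
    have s: "complex_of_real (sqrt pi) \<noteq> 0" by simp
    have E1: "E b z * rgprod U z = of_real D * rgprod V z" using E_eq[of z] U by simp
    have alg: "c4 * c5 * (x1 * x2) * u = d * s * (c1 * c2 * c3) * v"
      if "g1 * g2 * g3 * c4 * c5 / s * x1 * x2 * u = d * v" "c1 * g1 = 1" "c2 * g2 = 1" "c3 * g3 = 1" "s \<noteq> 0"
      for g1 g2 g3 c1 c2 c3 c4 c5 s x1 x2 u d v :: complex
    proof -
      have "d * s * (c1 * c2 * c3) * v = s * (c1 * c2 * c3) * (d * v)" by (simp only: mult_ac)
      also have "\<dots> = s * (c1 * c2 * c3) * (g1 * g2 * g3 * c4 * c5 / s * x1 * x2 * u)" unfolding that(1) ..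
      also have "\<dots> = (c1 * g1) * (c2 * g2) * (c3 * g3) * (c4 * c5 * (x1 * x2) * u)" using that(5) by simp
      finally show ?thesis using that(2-4) by simp
    qed
    show "g z = h z"
      unfolding g_def h_def X_def of_real_mult[of D] by (rule alg[OF E1[unfolded E_def] G s])
  qed auto
  thus ?thesis by (simp add: g_def h_def)
qed

text \<open>The lists \<open>U\<close> and \<open>V\<close> are eliminated: they stand for the known
  factor \<open>E b\<close>, whose explicit Gamma and exponential factors take their place.\<close>

lemma dual_reflected:
  "F b w * rGamma (of_real r * w - 1) * X w * rgprod vs' (w - 2 / of_real r) =
   of_real (L * D * sqrt pi) * (rGamma (of_real (r - p) * w - of_real b) * rGamma (of_real p * w + of_real b) * rGamma (of_real r * w - 1/2)) *
     rgprod us' (w - 2 / of_real r)"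
proof -
  define g where "g = (\<lambda>w. F b w * rGamma (of_real r * w - 1) * X w * rgprod vs' (w - 2 / of_real r))"
  define h where "h = (\<lambda>w. of_real (L * D * sqrt pi) * (rGamma (of_real (r - p) * w - of_real b) * rGamma (of_real p * w + of_real b) * rGamma (of_real r * w - 1/2)) *
     rgprod us' (w - 2 / of_real r))"
  obtain R1 where R1: "R1 > 0" "\<And>w. Re w \<ge> R1 \<Longrightarrow> rgprod V w \<noteq> 0" using rgprod_nonzero_right by blast
  have "g w = h w"
  proof (rule holomorphic_cancel[where S = UNIV and g = g and h = h and k = "rgprod V" and pt = "of_real R1" and z = w])
    show "g holomorphic_on UNIV" "h holomorphic_on UNIV" unfolding g_def h_def X_def by (intro holomorphic_intros)+
    show "rgprod V holomorphic_on UNIV" by (rule holomorphic_rgprod)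
    show "rgprod V (of_real R1) \<noteq> 0" by (rule R1) simp
    fix z assume nz: "rgprod V z \<noteq> 0"
    have 1: "F b z * (rgprod V z * rgprod vs' (z - 2 / of_real r)) = of_real L * rGamma (of_real r * z) * (rgprod U z * rgprod us' (z - 2 / of_real r))"
      using gpf_b unfolding gpf_def rgprod_append rgprod_shift[symmetric] by blast
    have "rgprod V z * g z = (F b z * (rgprod V z * rgprod vs' (z - 2 / of_real r))) * rGamma (of_real r * z - 1) * X z"
      by (simp only: g_def mult_ac)
    also have "\<dots> = of_real L * rgprod us' (z - 2 / of_real r) * (rGamma (of_real r * z - 1) * rGamma (of_real r * z) * X z * rgprod U z)"
      unfolding 1 by (simp only: mult_ac)
    also have "\<dots> = rgprod V z * h z"
      unfolding E_entire by (simp only: h_def of_real_mult mult_ac)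
    finally show "g z = h z" using nz by simp
  qed auto
  thus ?thesis by (simp add: g_def h_def)
qed

lemma Theta_reflected: "F a z * rGamma (1 - of_real r * z) * rgprod vs' (- z) = Theta z * rgprod us' (- z)"
proof -
  define g where "g = (\<lambda>z. F a z * rGamma (1 - of_real r * z) * rgprod vs' (- z))"
  define h where "h = (\<lambda>z. Theta z * rgprod us' (- z))"
  have "g z = h z"
  proof (rule analytic_continuation_open[of "{z. Re z < - R}" UNIV g h])
    have "complex_of_real (- R - 1) \<in> {z. Re z < - R}" by simp
    thus "{z. Re z < - R} \<noteq> {}" by blast
    show "g holomorphic_on UNIV" "h holomorphic_on UNIV" unfolding g_def h_def by (intro holomorphic_intros)+
    fix z assume "z \<in> {z. Re z < - R}"
    hence z: "Re z < - R" by simp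
    hence "rgprod us' (- z) \<noteq> 0" by (intro R) simp
    moreover have "Theta z = Phi z" using Theta_eq[of z 0] z by simp
    ultimately show "g z = h z" by (simp add: g_def h_def Phi_def)
  qed (use half_plane in auto)
  thus ?thesis by (simp add: g_def h_def)
qed

text \<open>\<open>dual_reflected\<close> at \<open>2 / r - z\<close> and
  \<open>Theta_reflected\<close> at \<open>z\<close> contain the same products
  \<open>rgprod us' (- z)\<close> and \<open>rgprod vs' (- z)\<close>. Combining them removes these,
  and no unknown Gamma parameter is left.\<close>

lemma connection:
  "F b (2 / of_real r - z) * X (2 / of_real r - z) * Theta z =
   of_real (L * D * sqrt pi) * (rGamma (1 + of_real a - of_real (r - p) * z) * rGamma (1 - of_real a - of_real p * z) * rGamma (3/2 - of_real r * z)) * F a z"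
proof -
  define w where "w = 2 / of_real r - z"
  define g where "g = (\<lambda>z. F b (2 / of_real r - z) * X (2 / of_real r - z) * Theta z)"
  define h where "h = (\<lambda>z. of_real (L * D * sqrt pi) * (rGamma (1 + of_real a - of_real (r - p) * z) * rGamma (1 - of_real a - of_real p * z) * rGamma (3/2 - of_real r * z)) * F a z)"
  have e: "of_real r * (2 / of_real r - z) - 1 = 1 - of_real r * z" "2 / of_real r - z - 2 / of_real r = - z"
    "of_real (r - p) * (2 / of_real r - z) - of_real b = 1 + of_real a - of_real (r - p) * z"
    "of_real p * (2 / of_real r - z) + of_real b = 1 - of_real a - of_real p * z"
    "of_real r * (2 / of_real r - z) - 1/2 = 3/2 - of_real r * z" for z :: complex
    using r_pos by (simp_all add: dual_def field_simps)
  have "g z = h z"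
  proof (rule holomorphic_cancel[where S = UNIV and g = g and h = h and k = "\<lambda>z. rgprod us' (- z)" and pt = "- of_real R" and z = z])
    show "g holomorphic_on UNIV" "h holomorphic_on UNIV" "(\<lambda>z. rgprod us' (- z)) holomorphic_on UNIV"
      unfolding g_def h_def X_def by (intro holomorphic_intros)+
    show "rgprod us' (- (- of_real R)) \<noteq> 0" by (rule R) simp
    fix z assume nz: "rgprod us' (- z) \<noteq> 0"
    have "g z * rgprod us' (- z) = F b (2 / of_real r - z) * X (2 / of_real r - z) * (Theta z * rgprod us' (- z))"
      by (simp only: g_def mult_ac)
    also have "\<dots> = (F b (2 / of_real r - z) * rGamma (1 - of_real r * z) * X (2 / of_real r - z) * rgprod vs' (- z)) * F a z"
      unfolding Theta_reflected[symmetric] by (simp only: mult_ac)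
    also have "\<dots> = h z * rgprod us' (- z)"
      using dual_reflected[of "2 / of_real r - z", unfolded e] by (simp only: h_def mult_ac)
    finally show "g z = h z" using nz by simp
  qed auto
  thus ?thesis by (simp add: g_def h_def)
qed

section \<open>Integrality of \<open>r / p\<close> and the bounds for \<open>D\<close>\<close>

lemma ratio_gt_1: "r / p > 1" using p_pos p_less_r by (simp add: field_simps)

text \<open>At the \<open>w\<close> with \<open>p w + b = - k\<close> the dual series terminates,
  and the bound on \<open>k\<close> makes its value nonzero unless \<open>r w\<close> is an integer.
  With \<open>z = 2 / r - w\<close> the factor \<open>rGamma (1 - a - p z)\<close> kills the right
  side of the connection formula, so \<open>Theta z = 0\<close>. As \<open>p z + a = k + 1\<close>,
  this means \<open>sin (pi * r * z) = 0\<close>, so \<open>r z = 2 - r w\<close> is an integer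
  after all.\<close>

lemma dual_ratio_int:
  assumes k: "real k > \<bar>b\<bar> * (r / p) / (r / p - 1)"
  shows "(b + real k) * (r / p) \<in> \<int>"
proof (rule ccontr)
  assume nint: "(b + real k) * (r / p) \<notin> \<int>"
  define c where "c = - ((b + real k) * (r / p))"
  define w where "w = complex_of_real (- (b + real k) / p)"
  define z where "z = 2 / of_real r - w"
  have pw: "of_real p * w + of_real b = - of_nat k" using p_pos by (simp add: w_def field_simps)
  have "r * (- (b + real k) / p) = c" using p_pos by (simp add: c_def field_simps)
  hence rw: "of_real r * w = of_real c" unfolding w_def by (simp only: of_real_mult[symmetric])
  have cint: "complex_of_real c \<notin> \<int>"
  proof
    assume "complex_of_real c \<in> \<int>"
    then obtain m :: int where "complex_of_real c = of_int m" by (metis Ints_cases)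
    hence "c = of_int m" by (metis of_real_eq_iff of_real_of_int_eq)
    hence "(b + real k) * (r / p) = of_int (- m)" by (simp add: c_def)
    thus False using nint by (metis Ints_of_int)
  qed
  have "c < - real k"
  proof -
    have "r / p - 1 > 0" using ratio_gt_1 by simp
    hence "real k * (r / p - 1) > \<bar>b\<bar> * (r / p)" using k by (simp only: pos_divide_less_eq)
    moreover have "\<bar>b\<bar> * (r / p) \<ge> - b * (r / p)" using ratio_gt_1 by (intro mult_right_mono) auto
    ultimately show ?thesis by (simp add: c_def algebra_simps)
  qed
  moreover have "complex_of_real c \<notin> \<int>\<^sub>\<le>\<^sub>0" using cint nonpos_Ints_Int by blast
  ultimately have "F b w \<noteq> 0" by (intro F_nonzero_terminating[OF pw rw])
  have wz: "2 / of_real r - z = w" by (simp add: z_def)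
  have pz: "of_real p * z + of_real a = of_real (1 + real k)"
  proof -
    have "of_real p * z + of_real a = of_real (2 * p / r) - (of_real p * w + of_real b) + of_real b + of_real a"
      by (simp add: z_def algebra_simps)
    thus ?thesis unfolding pw by (simp add: dual_def)
  qed
  have "1 - of_real a - of_real p * z = - of_nat k" using pz by (simp add: algebra_simps)
  hence "rGamma (1 - of_real a - of_real p * z) = 0" by (simp add: rGamma_eq_zero_iff)
  hence "F b w * X w * Theta z = 0" using connection[of z] unfolding wz by simp
  moreover have "X w \<noteq> 0" by (simp add: X_def)
  ultimately have "Theta z = 0" using \<open>F b w \<noteq> 0\<close> by simp
  moreover have "sin (of_real pi * (of_real p * z + of_real a)) = 0"
    unfolding pz by (simp only: sin_pi_eq_0_iff) simp
  ultimately have "sin (of_real (pi * r) * z) = 0" using Theta_formula[of z] L_pos by simp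
  hence "sin (of_real pi * (of_real r * z)) = 0" by (simp add: mult.assoc)
  hence "of_real r * z \<in> \<int>" by (simp only: sin_pi_eq_0_iff)
  moreover have "of_real r * z = 2 - of_real c" using r_pos rw by (simp add: z_def field_simps)
  ultimately have "2 - (2 - complex_of_real c) \<in> \<int>" by (metis Ints_diff Ints_numeral)
  thus False using cint by simp
qed

lemma integrality:
  obtains s :: nat and j :: int where "r = real s * p" "s \<ge> 2" "real s * a = of_int j"
proof -
  obtain k :: nat where k: "real k > \<bar>b\<bar> * (r / p) / (r / p - 1)" using reals_Archimedean2 by blast
  have 1: "(b + real k) * (r / p) \<in> \<int>" by (rule dual_ratio_int[OF k])
  \<comment> \<open>Two consecutive values of \<open>k\<close>: the difference of the two integers
    is \<open>r / p\<close>.\<close>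
  have 2: "(b + real (Suc k)) * (r / p) \<in> \<int>" by (rule dual_ratio_int) (use k in linarith)
  have "(b + real (Suc k)) * (r / p) - (b + real k) * (r / p) = r / p" by (simp add: algebra_simps add_divide_distrib[symmetric])
  hence "r / p \<in> \<int>" using Ints_diff[OF 2 1] by simp
  then obtain m :: int where m: "r / p = of_int m" by (metis Ints_cases)
  hence "m > 1" using ratio_gt_1 by simp
  define s where "s = nat m"
  have s: "r / p = real s" "s \<ge> 2" using m \<open>m > 1\<close> by (auto simp: s_def)
  have rs: "r = real s * p" using s p_pos by (simp add: field_simps)
  obtain l :: int where l: "(b + real k) * real s = of_int l" using 1 unfolding s(1) by (metis Ints_cases)
  have "real s * (2 * p / r) = 2" using rs p_pos s(2) by (simp add: field_simps)
  hence "real s * a = real s - 2 - real s * b" by (simp add: dual_def algebra_simps)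
  also have "\<dots> = of_int (int s - 2 - l + int k * int s)" using l by (simp add: algebra_simps)
  finally show ?thesis using that[OF rs s(2)] by blast
qed

text \<open>At a zero of \<open>Theta\<close> with \<open>F a z\<close> nonzero, one of three
  reciprocal Gamma factors vanishes. The factor with \<open>1 - a - p z\<close> is excluded, since
  it would make both sines zero. The other two make \<open>z\<close> real, with \<open>r z\<close>
  congruent modulo 1 to \<open>v = p z + a\<close>, which gives \<open>D = 1\<close>, or to
  \<open>1/2\<close>, which gives \<open>D * \<bar>sin (pi * v)\<bar> = 1\<close>. The upper bound
  holds in both cases because \<open>r z\<close> is congruent to \<open>s * v\<close>.\<close>

lemma D_bounds_of_zero:
  fixes w :: complex
  assumes zero: "sin (of_real (pi * r) * w) + of_real D * sin (of_real pi * (of_real p * w + of_real a)) = 0"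
    and nz: "sin (of_real (pi * r) * w) \<noteq> 0" and s: "r = real s * p" and j: "real s * a = of_int j"
  shows "1 \<le> D \<and> D \<le> real s"
proof -
  \<comment> \<open>\<open>Theta\<close> is periodic up to sign, so the zero can be moved to the
    right until \<open>F a\<close> does not vanish there.\<close>
  have "eventually (\<lambda>n. f a (w + of_nat n) \<noteq> 0) sequentially"
    using f_tendsto_L[OF filterlim_Re_shift] L_pos by (intro tendsto_imp_eventually_ne) auto
  then obtain K where K: "f a (w + of_nat K) \<noteq> 0" by (auto simp: eventually_at_top_linorder)
  define z where "z = w + of_nat K"
  have Fz: "F a z \<noteq> 0" using K by (auto simp: f_def z_def)
  have "Theta w = 0" using zero Theta_formula[of w] by simp
  hence "Theta z = 0" using Theta_minus_nat[of z K] by (simp add: z_def)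
  hence zero': "sin (of_real (pi * r) * z) + of_real D * sin (of_real pi * (of_real p * z + of_real a)) = 0"
    using Theta_formula[of z] L_pos by simp
  have nz': "sin (of_real (pi * r) * z) \<noteq> 0"
    using sin_shift_nat[of rn z K 0] nz by (auto simp: z_def rn)
  have "rGamma (1 + of_real a - of_real (r - p) * z) = 0 \<or> rGamma (1 - of_real a - of_real p * z) = 0 \<or> rGamma (3/2 - of_real r * z) = 0"
    using connection[of z] \<open>Theta z = 0\<close> Fz L_pos D_pos by simp
  moreover have "rGamma (1 - of_real a - of_real p * z) \<noteq> 0"
  proof
    assume "rGamma (1 - of_real a - of_real p * z) = 0"
    hence "1 - of_real a - of_real p * z \<in> \<int>" using nonpos_Ints_Int by (auto simp: rGamma_eq_zero_iff)
    hence "1 - (1 - of_real a - of_real p * z) \<in> \<int>" by (rule Ints_diff[OF Ints_1])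
    hence "of_real p * z + of_real a \<in> \<int>" by (simp add: add.commute)
    hence "sin (of_real pi * (of_real p * z + of_real a)) = 0" by (simp only: sin_pi_eq_0_iff)
    thus False using zero' nz' by simp
  qed
  ultimately consider "1 + of_real a - of_real (r - p) * z \<in> \<int>" | "3/2 - of_real r * z \<in> \<int>"
    using nonpos_Ints_Int by (auto simp: rGamma_eq_zero_iff)
  hence "\<exists>t m. z = of_real t \<and> (r * t = (p * t + a) + of_int m \<or> r * t = 1/2 + of_int m)"
  proof cases
    case 1
    then obtain m :: int where m: "1 + of_real a - of_real (r - p) * z = of_int m" by (metis Ints_cases)
    have z: "z = of_real ((1 + a - of_int m) / (r - p))" using m p_less_r by (simp add: field_simps)
    have "r * ((1 + a - of_int m) / (r - p)) = (p * ((1 + a - of_int m) / (r - p)) + a) + of_int (1 - m)"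
      using p_less_r by (simp add: field_simps)
    thus ?thesis using z by blast
  next
    case 2
    then obtain m :: int where m: "3/2 - of_real r * z = of_int m" by (metis Ints_cases)
    have z: "z = of_real ((3/2 - of_int m) / r)" using m r_pos by (simp add: field_simps)
    have "r * ((3/2 - of_int m) / r) = 1/2 + of_int (1 - m)"
      using r_pos by (simp add: field_simps)
    thus ?thesis using z by blast
  qed
  then obtain t m where t: "z = of_real t" "r * t = (p * t + a) + of_int m \<or> r * t = 1/2 + of_int m" by blast
  define v where "v = p * t + a"
  have "complex_of_real (sin (pi * (r * t)) + D * sin (pi * v)) = 0"
  proof -
    have e: "of_real (pi * r) * z = complex_of_real (pi * (r * t))" "of_real pi * (of_real p * z + of_real a) = complex_of_real (pi * v)"
      by (simp_all add: t v_def mult.assoc)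
    show ?thesis using zero' unfolding e sin_of_real of_real_add of_real_mult[of D] .
  qed
  hence eq: "sin (pi * (r * t)) = - D * sin (pi * v)" by (simp only: of_real_eq_0_iff)
  have nzr: "sin (pi * (r * t)) \<noteq> 0"
  proof
    assume "sin (pi * (r * t)) = 0"
    moreover have "of_real (pi * r) * z = complex_of_real (pi * (r * t))" by (simp add: t mult.assoc)
    ultimately show False using nz' by (simp only: sin_of_real) simp
  qed
  have abs_eq: "\<bar>sin (pi * (r * t))\<bar> = D * \<bar>sin (pi * v)\<bar>" using D_pos unfolding eq by (simp add: abs_mult)
  have sv: "\<bar>sin (pi * v)\<bar> > 0" using nzr eq by auto
  have "1 \<le> D"
    using t(2)
  proof
    assume "r * t = (p * t + a) + of_int m"
    hence "\<bar>sin (pi * (r * t))\<bar> = \<bar>sin (pi * v)\<bar>" using sin_pi_add_int[of v m] by (simp only: v_def)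
    thus ?thesis using abs_eq sv by simp
  next
    assume "r * t = 1/2 + of_int m"
    hence "\<bar>sin (pi * (r * t))\<bar> = 1" using sin_pi_add_int[of "1/2" m] by simp
    hence "1 = D * \<bar>sin (pi * v)\<bar>" using abs_eq by simp
    moreover have "D * \<bar>sin (pi * v)\<bar> \<le> D * 1" using D_pos by (intro mult_left_mono) auto
    ultimately show ?thesis by linarith
  qed
  moreover have "D \<le> real s"
  proof -
    have "r * t = real s * v + of_int (- j)" using s j by (simp add: v_def algebra_simps)
    hence "\<bar>sin (pi * (r * t))\<bar> = \<bar>sin (pi * (real s * v))\<bar>" using sin_pi_add_int[of "real s * v" "- j"] by simp
    also have "pi * (real s * v) = real s * (pi * v)" by simp
    also have "\<bar>sin (real s * (pi * v))\<bar> \<le> real s * \<bar>sin (pi * v)\<bar>" by (rule abs_sin_mult_le)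
    finally have "D * \<bar>sin (pi * v)\<bar> \<le> real s * \<bar>sin (pi * v)\<bar>" unfolding abs_eq .
    thus ?thesis using sv by simp
  qed
  ultimately show ?thesis by blast
qed

text \<open>With \<open>y = pi * (p w + a)\<close> one has \<open>pi * r * w = s y - pi * j\<close>,
  and \<open>Theta w = 0\<close> becomes \<open>sin (s y) = - \<sigma> * D * sin y\<close> with the
  sign \<open>\<sigma> = cos (pi * j)\<close>.\<close>

lemma D_bounds:
  assumes s: "r = real s * p" "s \<ge> 2" and j: "real s * a = of_int j"
  shows "1 \<le> D \<and> D \<le> real s"
proof -
  define \<sigma> where "\<sigma> = cos (complex_of_real (pi * of_int j))"
  have sinj: "sin (complex_of_real (pi * of_int j)) = 0"
    using sin_pi_eq_0_iff[of "of_int j"] by simp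
  have \<sigma>: "\<sigma> = 1 \<or> \<sigma> = -1"
  proof -
    have "\<sigma>\<^sup>2 = 1"
      using sin_cos_squared_add[of "complex_of_real (pi * of_int j)"] unfolding sinj \<sigma>_def by simp
    thus ?thesis by (simp only: power2_eq_1_iff)
  qed
  obtain y where y: "poly (cheb s) (cos y) = - \<sigma> * of_real D" using cheb_root[OF s(2)] by blast
  have ys: "- \<sigma> * of_real D * sin y = sin (of_nat s * y)" using cheb_sin[of s y] y by simp
  define w where "w = (y / of_real pi - of_real a) / of_real p"
  have pw: "of_real pi * (of_real p * w + of_real a) = y" using p_pos by (simp add: w_def field_simps)
  have rw: "of_real (pi * r) * w = of_nat s * y - of_real (pi * of_int j)"
  proof -
    have "of_real (pi * r) * w = of_nat s * (of_real pi * (of_real p * w + of_real a)) - of_real (pi * (real s * a))"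
      by (simp add: s(1) algebra_simps)
    thus ?thesis unfolding pw j .
  qed
  have sr: "sin (of_real (pi * r) * w) = \<sigma> * sin (of_nat s * y)"
    unfolding rw sin_diff sinj \<sigma>_def by simp
  have \<sigma>2: "\<sigma> * \<sigma> = 1" using \<sigma> by auto
  have zero: "sin (of_real (pi * r) * w) + of_real D * sin (of_real pi * (of_real p * w + of_real a)) = 0"
  proof -
    have "sin (of_real (pi * r) * w) = - (\<sigma> * \<sigma>) * of_real D * sin y" unfolding sr ys[symmetric] by simp
    thus ?thesis unfolding pw \<sigma>2 by simp
  qed
  show ?thesis
  proof (cases "sin (of_real (pi * r) * w) = 0")
    case False
    show ?thesis by (rule D_bounds_of_zero[OF zero False s(1) j])
  next
    case True
    hence "sin y = 0" using zero D_pos unfolding pw by simp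
    \<comment> \<open>In this degenerate case the polynomial equation is solved at an endpoint,
      where \<open>cheb s\<close> has modulus \<open>s\<close>; so \<open>D = s\<close>.\<close>
    hence "cos y = 1 \<or> cos y = -1" using sin_cos_squared_add[of y] by (simp add: power2_eq_1_iff)
    hence "norm (- \<sigma> * of_real D) = real s"
    proof
      assume "cos y = 1"
      hence "- \<sigma> * of_real D = of_nat s" using y by (simp only: cheb_at_1)
      hence "norm (- \<sigma> * of_real D) = norm (of_nat s :: complex)" by (simp only:)
      thus ?thesis by simp
    next
      assume "cos y = -1"
      hence "norm (- \<sigma> * of_real D) = norm (- ((-1) ^ s * of_nat s :: complex))"
        unfolding y[symmetric] by (simp only: cheb_at_m1)
      thus ?thesis by (simp add: norm_mult norm_power)
    qed
    moreover have "norm (- \<sigma> * of_real D) = D" using \<sigma> D_pos by (auto simp: norm_mult)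
    ultimately show ?thesis using s(2) by simp
  qed
qed

end

section \<open>Comparison with the dual\<close>

context hyp_params
begin

text \<open>The limits of \<open>E a\<close> and \<open>E b\<close> are \<open>D'\<close> and \<open>D\<close>, so this evaluates \<open>D' / D\<close>.\<close>
lemma E_ratio_limit:
  assumes pn: "p = real pn" and rn: "r = real rn"
  shows "(\<lambda>k. E a (of_nat k) / E c (of_nat k)) \<longlonglongrightarrow> of_real (exp ((c - a) * (ln ((r - p) / p) - ln (1 - x))))"
proof -
  have pos: "pn > 0" "rn > pn" using p_pos p_less_r pn rn by auto
  define qn where "qn = rn - pn"
  have qn: "qn > 0" "real qn = r - p" using pos pn rn by (auto simp: qn_def of_nat_diff)
  \<comment> \<open>Chosen such that \<open>Suc (n1 k) = (r - p) * k\<close> and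
    \<open>Suc (n2 k) = p * k\<close>, the integer parts of the two Gamma arguments that carry the
    parameter.\<close>
  define n1 where "n1 = (\<lambda>k. qn * k - 1)"
  define n2 where "n2 = (\<lambda>k. pn * k - 1)"
  have inf: "filterlim (\<lambda>k. m * k - 1) at_top sequentially" if "m > 0" for m :: nat
  proof (rule filterlim_at_top_mono[OF filterlim_minus_const_nat_at_top[of 1]])
    have "k - 1 \<le> m * k - 1" for k using that by (intro diff_le_mono) simp
    thus "eventually (\<lambda>k. k - 1 \<le> m * k - 1) sequentially" by simp
  qed
  define A1 where "A1 = (\<lambda>e k. rGamma (of_real e + of_nat (Suc (n1 k))) * growth 1 (of_real e) (n1 k))"
  define A2 where "A2 = (\<lambda>e k. rGamma (of_real e + of_nat (Suc (n2 k))) * growth 1 (of_real e) (n2 k))"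
  have A1: "A1 e \<longlonglongrightarrow> 1" for e unfolding A1_def n1_def
    by (rule filterlim_compose[OF rGamma_shift_asymp inf[OF qn(1)]])
  have A2: "A2 e \<longlonglongrightarrow> 1" for e unfolding A2_def n2_def
    by (rule filterlim_compose[OF rGamma_shift_asymp inf[OF pos(1)]])
  \<comment> \<open>The factorials cancel in the quotient, and the remaining powers combine to
    \<open>n1 / n2\<close> to the power \<open>c - a\<close>.\<close>
  have l: "(\<lambda>k. ln (real (n1 k)) - ln (real (n2 k))) \<longlonglongrightarrow> ln ((r - p) / p)"
  proof -
    have "((\<lambda>k. ln ((r - p) * real k - 1) - ln (p * real k - 1)) \<longlonglongrightarrow> ln (r - p) - ln p)"
      using p_pos p_less_r by real_asymp
    also have "ln (r - p) - ln p = ln ((r - p) / p)" using p_pos p_less_r by (simp add: ln_div)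
    finally have "((\<lambda>k. ln ((r - p) * real k - 1) - ln (p * real k - 1)) \<longlonglongrightarrow> ln ((r - p) / p))" .
    moreover have "eventually (\<lambda>k. ln ((r - p) * real k - 1) - ln (p * real k - 1) = ln (real (n1 k)) - ln (real (n2 k))) sequentially"
      using eventually_gt_at_top[of 0]
    proof eventually_elim
      case (elim k)
      have "real (n1 k) = (r - p) * real k - 1" "real (n2 k) = p * real k - 1"
        using elim qn pos by (auto simp: n1_def n2_def of_nat_diff pn)
      thus ?case by simp
    qed
    ultimately show ?thesis by (rule Lim_transform_eventually)
  qed
  have lim: "(\<lambda>k. A1 (-c) k * A2 c k / (A1 (-a) k * A2 a k) * of_real (exp ((c - a) * (ln (real (n1 k)) - ln (real (n2 k))))) * of_real (exp (ln (1 - x) * (a - c)))) \<longlonglongrightarrow>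
      1 * 1 / (1 * 1) * of_real (exp ((c - a) * ln ((r - p) / p))) * of_real (exp (ln (1 - x) * (a - c)))"
    by (intro tendsto_intros A1 A2 l) auto
  have lim_eq: "1 * 1 / (1 * 1) * of_real (exp ((c - a) * ln ((r - p) / p))) * of_real (exp (ln (1 - x) * (a - c))) =
     complex_of_real (exp ((c - a) * (ln ((r - p) / p) - ln (1 - x))))"
    by (simp add: algebra_simps flip: of_real_mult exp_add)
  have ev: "eventually (\<lambda>k. A1 (-c) k * A2 c k / (A1 (-a) k * A2 a k) * of_real (exp ((c - a) * (ln (real (n1 k)) - ln (real (n2 k))))) * of_real (exp (ln (1 - x) * (a - c))) =
      E a (of_nat k) / E c (of_nat k)) sequentially"
    using eventually_gt_at_top[of 0]
  proof eventually_elim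
    case (elim k)
    have s1: "Suc (n1 k) = qn * k" "Suc (n2 k) = pn * k" using elim qn pos by (auto simp: n1_def n2_def)
    have a1: "of_real (-e) + complex_of_nat (Suc (n1 k)) = of_real (r - p) * of_nat k - of_real e" for e
      unfolding s1 qn(2)[symmetric] by simp
    have a2: "of_real e + complex_of_nat (Suc (n2 k)) = of_real p * of_nat k + of_real e" for e
      unfolding s1 pn by simp
    define l1 where "l1 = complex_of_real (ln (real (n1 k)))"
    define l2 where "l2 = complex_of_real (ln (real (n2 k)))"
    define f1 where "f1 = (fact (n1 k) :: complex)"
    define f2 where "f2 = (fact (n2 k) :: complex)"
    define G1 where "G1 = (\<lambda>e. rGamma (of_real (r - p) * of_nat k - of_real e) :: complex)"
    define G2 where "G2 = (\<lambda>e. rGamma (of_real p * of_nat k + of_real e) :: complex)"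
    \<comment> \<open>The part of \<open>E\<close> that is the same for both parameters.\<close>
    define K where "K = Gamma (of_real r * of_nat k - 1/2) * rGamma (of_real r * of_nat k - 1) * rGamma (of_real r * of_nat k) / complex_of_real (sqrt pi) *
       exp (of_real (ln x) * (of_real r * of_nat k - 1))"
    have K: "K \<noteq> 0"
    proof -
      have "rn * k \<ge> 2 * 1" using pos elim by (intro mult_mono) auto
      hence "r * real k \<ge> 2" unfolding rn by (metis mult_2 of_nat_le_iff of_nat_mult of_nat_numeral mult.right_neutral)
      hence "of_real r * of_nat k - 1/2 \<notin> (\<int>\<^sub>\<le>\<^sub>0 :: complex set)" "of_real r * of_nat k - 1 \<notin> (\<int>\<^sub>\<le>\<^sub>0 :: complex set)" "of_real r * of_nat k \<notin> (\<int>\<^sub>\<le>\<^sub>0 :: complex set)"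
        by (auto intro!: not_nonpos_Ints_if_Re_pos)
      thus ?thesis by (simp add: K_def rGamma_eq_zero_iff Gamma_eq_zero_iff)
    qed
    have Eform: "E e (of_nat k) = K * inverse (G1 e) * inverse (G2 e) * exp (of_real (ln (1 - x)) * (1/2 + of_real e - of_real (r - p) * of_nat k))" for e
      unfolding E_def K_def G1_def G2_def Gamma_def by (simp add: mult_ac)
    have ee: "exp (of_real (ln (1 - x)) * (1/2 + of_real a - of_real (r - p) * of_nat k)) =
       exp (of_real (ln (1 - x)) * (1/2 + of_real c - of_real (r - p) * of_nat k)) * exp (complex_of_real (ln (1 - x) * (a - c)))"
      unfolding exp_add[symmetric] by (simp add: algebra_simps)
    have lhs: "A1 (-e) k = G1 e * (f1 * exp (- of_real e * l1))" "A2 e k = G2 e * (f2 * exp (of_real e * l2))" for e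
      unfolding A1_def A2_def a1 a2 growth_def G1_def G2_def f1_def f2_def l1_def l2_def by simp_all
    have e3: "of_real (exp ((c - a) * (ln (real (n1 k)) - ln (real (n2 k))))) =
       exp (of_real c * l1) * exp (- of_real c * l2) * exp (- of_real a * l1) * exp (of_real a * l2)"
      unfolding exp_add[symmetric] exp_of_real[symmetric] l1_def l2_def by (simp add: algebra_simps)
    have m: "exp (- of_real e * y) = inverse (exp (of_real e * y))" for e and y :: complex by (simp add: exp_minus)
    have ff: "f1 \<noteq> 0" "f2 \<noteq> 0" by (simp_all add: f1_def f2_def)
    have alg: "g1 * (f * inverse e1) * (g2 * (f' * e2)) / (h1 * (f * inverse e3) * (h2 * (f' * e4))) * (e1 * inverse e2 * inverse e3 * e4) * y =
       (K * inverse h1 * inverse h2 * (z * y)) / (K * inverse g1 * inverse g2 * z)"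
      if "f \<noteq> 0" "f' \<noteq> 0" "e1 \<noteq> 0" "e2 \<noteq> 0" "e3 \<noteq> 0" "e4 \<noteq> 0" "K \<noteq> 0" "z \<noteq> 0"
      for f f' e1 e2 e3 e4 K z g1 g2 h1 h2 y :: complex
    proof -
      have 1: "g1 * (f * inverse e1) * (g2 * (f' * e2)) / (h1 * (f * inverse e3) * (h2 * (f' * e4))) * (e1 * inverse e2 * inverse e3 * e4) * y =
        g1 * g2 * inverse h1 * inverse h2 * y * ((f * inverse f) * (f' * inverse f') * (e1 * inverse e1) * (e2 * inverse e2) * (e3 * inverse e3) * (e4 * inverse e4))"
        by (simp only: divide_inverse inverse_mult_distrib inverse_inverse_eq mult_ac)
      have 2: "(K * inverse h1 * inverse h2 * (z * y)) / (K * inverse g1 * inverse g2 * z) =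
        g1 * g2 * inverse h1 * inverse h2 * y * ((K * inverse K) * (z * inverse z))"
        by (simp only: divide_inverse inverse_mult_distrib inverse_inverse_eq mult_ac)
      show ?thesis unfolding 1 2 using that by simp
    qed
    show ?case
      unfolding lhs e3 m Eform ee exp_of_real
      by (rule alg) (use K ff in auto)
  qed
  from Lim_transform_eventually[OF lim ev] show ?thesis unfolding lim_eq .
qed

end

context gpf_dual_ctx
begin

text \<open>\<open>F_at_neg'\<close> with \<open>a\<close> and its dual exchanged. The values of
  \<open>f a\<close> which it needs lie on a progression through \<open>- n0 / r\<close> and are
  nonzero far to the right; the sine agrees up to sign with the one in
  \<open>F a (- n0 / r)\<close>, which is nonzero.\<close>

lemma dual_infinite_poles: "infinite {n::nat. F b (- of_nat n / of_real r) \<noteq> 0}"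
proof -
  obtain N where N: "\<And>n. n \<ge> N \<Longrightarrow> \<alpha> n < 1 \<and> \<alpha> n + real n + 1 > 0 \<and> real n / r > R" using large_index by blast
  obtain n0 where n0: "n0 \<ge> N" "F a (- of_nat n0 / of_real r) \<noteq> 0"
    using infinite_poles by (auto simp: infinite_nat_iff_unbounded_le)
  have sin0: "sin (pi * \<alpha> n0) \<noteq> 0"
    using F_at_neg'[of a n0, folded \<alpha>_def] N[OF n0(1)] n0(2) by auto
  define X0 where "X0 = (\<lambda>k. complex_of_real (- real n0 / r) + of_nat k)"
  have "eventually (\<lambda>k. f a (X0 k) \<noteq> 0) sequentially"
    unfolding X0_def using L_pos by (intro tendsto_imp_eventually_ne[OF f_tendsto_L[OF filterlim_Re_shift]]) auto
  moreover have big: "eventually (\<lambda>k. c < real k) sequentially" for c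
    using filterlim_real_sequentially unfolding filterlim_at_top_dense by blast
  ultimately have "eventually (\<lambda>k. f a (X0 k) \<noteq> 0 \<and> \<bar>\<alpha> n0\<bar> / p < real k \<and> (\<bar>\<alpha> n0\<bar> + real n0 + 1) / (r - p) < real k \<and>
     real (n0 + 3) < real k) sequentially"
    by (intro eventually_conj) 
  then obtain K where K: "\<And>k. k \<ge> K \<Longrightarrow> f a (X0 k) \<noteq> 0 \<and> \<bar>\<alpha> n0\<bar> / p < real k \<and> (\<bar>\<alpha> n0\<bar> + real n0 + 1) / (r - p) < real k \<and>
     real (n0 + 3) < real k" by (auto simp: eventually_at_top_linorder)
  have rn0: "rn > 0" using rn r_pos by simp
  show ?thesis
    unfolding infinite_nat_iff_unbounded_le
  proof
    fix m :: nat
    define k where "k = max K (m + n0 + 2)"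
    have k: "f a (X0 k) \<noteq> 0" "\<bar>\<alpha> n0\<bar> < real k * p" "\<bar>\<alpha> n0\<bar> + real n0 + 1 < real k * (r - p)" "n0 + 3 < k"
      using K[of k] p_pos p_less_r by (auto simp: k_def pos_divide_less_eq)
    \<comment> \<open>Then \<open>(n + 2) / r = k - n0 / r\<close>.\<close>
    define n where "n = rn * k - n0 - 2"
    have rk: "k \<le> rn * k" using rn0 by simp
    have n_eq: "real n = r * real k - real n0 - 2" 
    proof -
      have "n = rn * k - (n0 + 2)" by (simp add: n_def)
      moreover have "n0 + 2 \<le> rn * k" using rk k(4) by linarith
      ultimately have "real n = real (rn * k) - real (n0 + 2)" by (simp only: of_nat_diff)
      thus ?thesis by (simp add: rn)
    qed
    have "n \<ge> m" using rk unfolding n_def k_def by linarith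
    define \<beta> where "\<beta> = b - real n * p / r"
    have \<beta>: "\<beta> = 1 - real k * p - \<alpha> n0"
      using r_pos by (simp add: \<beta>_def n_eq dual_def \<alpha>_def field_simps)
    have c1: "\<beta> < 1" using k(2) unfolding \<beta> by linarith
    have c2: "\<beta> + real n + 1 > 0" using k(3) unfolding \<beta> n_eq by (simp add: algebra_simps)
    have t: "complex_of_nat (n + 2) / of_real r = X0 k"
    proof -
      have "real (n + 2) / r = - real n0 / r + real k" using r_pos by (simp add: n_eq field_simps)
      hence "complex_of_real (real (n + 2) / r) = X0 k" by (simp add: X0_def)
      thus ?thesis by simp
    qed
    have dd: "dual b = a" by (simp add: dual_def)
    have "F b (- of_nat n / of_real r) = of_real (sin (pi * \<beta>) / pi) * fact n * E a (X0 k) * f a (X0 k)"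
      using F_at_neg'[of b n] c1 c2 unfolding \<beta>_def dd t by simp
    moreover have "sin (pi * \<beta>) \<noteq> 0"
    proof -
      have "\<beta> = - \<alpha> n0 + of_int (1 - int k * int pn)" by (simp add: \<beta> pn)
      hence "\<bar>sin (pi * \<beta>)\<bar> = \<bar>sin (pi * (- \<alpha> n0))\<bar>" by (simp only: sin_pi_add_int)
      thus ?thesis using sin0 by auto
    qed
    moreover have "E a (X0 k) \<noteq> 0"
    proof -
      have "(r - p) * (real (n + 2) / r) - a = \<beta> + real n + 1" "p * (real (n + 2) / r) + a = 1 - \<beta>"
        "r * (real (n + 2) / r) = real n + 2"
        using r_pos by (simp_all add: dual_def \<beta>_def field_simps)
      then obtain y where "E a (of_real (real (n + 2) / r)) = of_real y" "y > 0"
        using E_of_real[of "real (n + 2) / r" a] c1 c2 by auto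
      moreover have "complex_of_real (real (n + 2) / r) = X0 k" using t by simp
      ultimately show ?thesis by auto
    qed
    ultimately have "F b (- of_nat n / of_real r) \<noteq> 0" using k(1) by simp
    thus "\<exists>n\<ge>m. n \<in> {n. F b (- of_nat n / of_real r) \<noteq> 0}" using \<open>n \<ge> m\<close> by blast
  qed
qed

end

lemma (in gpf_ctx) dual_ctx_exists: "\<exists>rn pn D U V. gpf_dual_ctx p r x a us vs rn pn D U V"
proof -
  obtain rn pn D U V where *: "r = real rn" "p = real pn" "even (rn + pn)" "D > 0" "log_eq = 0"
    "length U = length V" "sum_list U = sum_list V"
    "\<And>w. E b w = of_real D * (rgprod V w / rgprod U w)"
    "gpf b (V @ map (\<lambda>v. v - 2 / of_real r) vs') (U @ map (\<lambda>v. v - 2 / of_real r) us')"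
    using dual_gpf by metis
  have "gpf_dual_ctx p r x a us vs rn pn D U V"
    by unfold_locales (fact *)+
  thus ?thesis by blast
qed

lemma gpf_imp_GPF:
  assumes "hyp_params p r x" "hyp_params.gpf p r x a us vs"
  shows "is_GPF_solution p 0 r a (1/2) x"
proof -
  interpret hyp_params p r x by fact
  show ?thesis
    by (rule entire_imp_GPF[of "of_real L" a us 0 vs]) (use L_pos assms(2) in \<open>auto simp: gpf_def\<close>)
qed

section \<open>The equation for \<open>x\<close>\<close>

lemma log_equation_imp:
  fixes s :: nat and x :: real
  assumes s: "s \<ge> 2" and x: "0 < x" "x < 1"
    and eq: "(real s - 1) * ln (real s - 1) - real s * ln (real s) + real s * ln x - (real s - 1) * ln (1 - x) = 0"
  shows "phi s x = 0" "ln (real s - 1) - ln (1 - x) > ln (real s)"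
proof -
  have s1: "real (s - 1) = real s - 1" using s by (simp add: of_nat_diff)
  have "ln (real (s - 1) ^ (s - 1) * x ^ s) = real (s - 1) * ln (real s - 1) + real s * ln x"
    using s x by (subst ln_mult) (auto simp: ln_realpow s1)
  also have "\<dots> = real s * ln (real s) + real (s - 1) * ln (1 - x)" using eq unfolding s1 by simp
  also have "\<dots> = ln (real s ^ s * (1 - x) ^ (s - 1))"
    using s x by (subst ln_mult) (auto simp: ln_realpow)
  finally have "real (s - 1) ^ (s - 1) * x ^ s = real s ^ s * (1 - x) ^ (s - 1)"
    using s x by (subst (asm) ln_inj_iff) auto
  thus "phi s x = 0" by (simp add: phi_def)
  have ls: "ln (real s) > 0" using s by simp
  \<comment> \<open>Equivalent to \<open>(s - 1) / (1 - x) > s\<close>. For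
    \<open>x \<le> 1 / s\<close> the left side of the logarithmic equation would be at most
    \<open>- (s + 1) * ln s < 0\<close>.\<close>
  have "x > 1 / real s"
  proof (rule ccontr)
    assume "\<not> x > 1 / real s"
    hence xs: "x \<le> 1 / real s" by simp
    have "ln x \<le> ln (1 / real s)" using xs x s by (subst ln_le_cancel_iff) auto
    hence 1: "ln x \<le> - ln (real s)" using s by (simp add: ln_div)
    have "(real s - 1) / real s \<le> 1 - x" using xs s by (simp add: field_simps)
    hence "ln ((real s - 1) / real s) \<le> ln (1 - x)" using s x by (subst ln_le_cancel_iff) auto
    hence 2: "ln (real s - 1) - ln (real s) \<le> ln (1 - x)" using s by (simp add: ln_div)
    have "real s * ln x \<le> real s * (- ln (real s))" using 1 by (intro mult_left_mono) auto
    moreover have "(real s - 1) * (ln (real s - 1) - ln (real s)) \<le> (real s - 1) * ln (1 - x)" using 2 s by (intro mult_left_mono) auto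
    ultimately have "0 \<le> - ((real s + 1) * ln (real s))" using eq by (simp add: algebra_simps)
    moreover have "(real s + 1) * ln (real s) > 0" using ls by (intro mult_pos_pos) auto
    ultimately show False by simp
  qed
  hence "(real s - 1) / (1 - x) > real s" using s x by (simp add: field_simps)
  hence "ln (real s) < ln ((real s - 1) / (1 - x))" using s x by (subst ln_less_cancel_iff) auto
  thus "ln (real s - 1) - ln (1 - x) > ln (real s)" using s x by (simp add: ln_div)
qed

text \<open>\<open>phi s\<close> is strictly increasing on the unit interval: a strictly increasing
  term minus a decreasing one.\<close>

lemma phi_unique_root:
  assumes s: "s \<ge> 2" and x: "0 < x" "x < 1" "phi s x = 0" and z: "0 < z" "z < 1" "phi s z = 0"
  shows "z = x"
proof -
  have mono: "phi s y < phi s y'" if "0 < y" "y < y'" "y' < 1" for y y'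
  proof -
    have "real (s - 1) ^ (s - 1) * y ^ s < real (s - 1) ^ (s - 1) * y' ^ s"
      using s that by (intro mult_strict_left_mono power_strict_mono) auto
    moreover have "real s ^ s * (1 - y') ^ (s - 1) \<le> real s ^ s * (1 - y) ^ (s - 1)"
      using that by (intro mult_left_mono power_mono) auto
    ultimately show ?thesis by (simp add: phi_def)
  qed
  show ?thesis using mono[of x z] mono[of z x] x z by (cases x z rule: linorder_cases) auto
qed

lemma coeff_mult_Ints:
  fixes p q :: "real poly"
  assumes "\<And>i. coeff p i \<in> \<int>" "\<And>i. coeff q i \<in> \<int>"
  shows "coeff (p * q) i \<in> \<int>"
  unfolding coeff_mult using assms by (intro Ints_sum Ints_mult)

lemma phi_root_algebraic:
  assumes s: "s \<ge> 2" and x: "phi s x = 0"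
  shows "algebraic x"
proof -
  define P where "P = monom (real (s - 1) ^ (s - 1)) s - [:real s ^ s:] * [:1, -1:] ^ (s - 1)"
  have c1: "coeff ([:1, -1:] ^ n :: real poly) i \<in> \<int>" for n i
  proof (induction n arbitrary: i)
    case (Suc n)
    thus ?case unfolding power_Suc by (intro coeff_mult_Ints) (auto simp: coeff_pCons split: nat.splits)
  qed (auto simp: coeff_1)
  have "coeff P i \<in> \<int>" for i
    unfolding P_def coeff_diff
    by (intro Ints_diff coeff_mult_Ints c1) (auto simp: coeff_pCons split: nat.splits)
  \<comment> \<open>At 1 the subtracted product vanishes and \<open>(s - 1) ^ (s - 1)\<close> is
    left.\<close>
  moreover have "poly P 1 \<noteq> 0" using s by (auto simp: P_def poly_monom power_0_left)
  hence "P \<noteq> 0" by auto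
  moreover have "poly P x = 0" using x by (simp add: P_def poly_monom phi_def)
  ultimately show ?thesis unfolding algebraic_def by blast
qed

section \<open>Both members of a dual pair, and the range of \<open>j\<close>\<close>

theorem theorem2p1:
  fixes p r a x :: real
  assumes "in_class_I p 0 r a (1/2) x"
    and "is_GPF_solution p 0 r a (1/2) x"
    and "\<not> is_elementary p 0 r a (1/2) x"
  defines "a' \<equiv> 1 - 2 * p / r - a"
  shows "is_GPF_solution p 0 r a' (1/2) x \<and> \<not> is_elementary p 0 r a' (1/2) x \<and>
         (\<exists>s::nat. r / p = real s \<and> s \<ge> 2 \<and>
           (\<exists>P::int. p = of_int P \<and> even (P * (int s - 1))) \<and>
           (\<exists>j j' :: nat. a = real j / real s \<and> a' = real j' / real s \<and> j + j' = s - 2) \<and>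
           a \<in> \<rat> \<and> a' \<in> \<rat> \<and>
           phi s x = 0 \<and> (\<forall>z. 0 < z \<and> z < 1 \<and> phi s z = 0 \<longrightarrow> z = x) \<and>
           algebraic x)"
proof -
  have hyp: "hyp_params p r x" using assms(1) by unfold_locales (auto simp: in_class_I_def)
  interpret hyp_params p r x by (rule hyp)
  have a': "a' = dual a" by (simp add: a'_def dual_def)
  have dd: "dual (dual a) = a" by (simp add: dual_def)
  obtain us vs where g: "gpf a us vs" by (rule GPF_imp_gpf[OF assms(2)])
  have inf: "infinite {n::nat. F a (- of_nat n / of_real r) \<noteq> 0}" using assms(3) unfolding elementary_iff .
  interpret A: gpf_ctx p r x a us vs by unfold_locales (fact g inf)+
  obtain rn pn D U V where "gpf_dual_ctx p r x a us vs rn pn D U V"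
    using A.dual_ctx_exists by blast
  then interpret B: gpf_dual_ctx p r x a us vs rn pn D U V .
  \<comment> \<open>The argument is now repeated for the dual, with the parameter lists just found
    for it; this yields \<open>D'\<close>.\<close>
  interpret A': gpf_ctx p r x "dual a" "V @ map (\<lambda>v. v - 2 / of_real r) A.vs'" "U @ map (\<lambda>v. v - 2 / of_real r) A.us'"
    by unfold_locales (fact B.gpf_b B.dual_infinite_poles)+
  obtain rn' pn' D' U' V' where "gpf_dual_ctx p r x (dual a) (V @ map (\<lambda>v. v - 2 / of_real r) A.vs') (U @ map (\<lambda>v. v - 2 / of_real r) A.us') rn' pn' D' U' V'"
    using A'.dual_ctx_exists by blast
  then interpret B': gpf_dual_ctx p r x "dual a" "V @ map (\<lambda>v. v - 2 / of_real r) A.vs'" "U @ map (\<lambda>v. v - 2 / of_real r) A.us'" rn' pn' D' U' V' .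
  obtain s j where s: "r = real s * p" "s \<ge> 2" and j: "real s * a = of_int j" by (rule B.integrality)
  have sp: "r / p = real s" using s p_pos by simp
  have j': "real s * dual a = of_int (int s - 2 - j)"
  proof -
    have "real s * (2 * p / r) = 2" using s p_pos by (simp add: field_simps)
    thus ?thesis using j by (simp add: dual_def algebra_simps)
  qed
  have Db: "1 \<le> D" "D \<le> real s" "1 \<le> D'" "D' \<le> real s"
    using B.D_bounds[OF s j] B'.D_bounds[OF s j'] by auto
  define T where "T = ln (real s - 1) - ln (1 - x)"
  have rp: "(r - p) / p = real s - 1" using s p_pos by (simp add: field_simps)
  \<comment> \<open>\<open>log_eq\<close> is \<open>p\<close> times this expression: the multiples
    of \<open>ln p\<close> have coefficient \<open>(r - p) + p - r = 0\<close>.\<close>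
  have leq: "(real s - 1) * ln (real s - 1) - real s * ln (real s) + real s * ln x - (real s - 1) * ln (1 - x) = 0"
  proof -
    have rps: "r - p = p * (real s - 1)" using s by (simp add: algebra_simps)
    have "ln (r - p) = ln p + ln (real s - 1)" unfolding rps using s(2) p_pos by (simp add: ln_mult)
    moreover have "ln r = ln p + ln (real s)" unfolding s(1) using s(2) p_pos by (simp add: ln_mult)
    ultimately have "log_eq = (r - p) * (ln p + ln (real s - 1)) + p * ln p - r * (ln p + ln (real s)) + r * ln x - (r - p) * ln (1 - x)"
      unfolding log_eq_def by (simp only:)
    also have "\<dots> = p * ((real s - 1) * ln (real s - 1) - real s * ln (real s) + real s * ln x - (real s - 1) * ln (1 - x))"
      unfolding s(1) by (simp add: algebra_simps)
    finally have "log_eq = p * ((real s - 1) * ln (real s - 1) - real s * ln (real s) + real s * ln x - (real s - 1) * ln (1 - x))" .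
    thus ?thesis using B.log_eq_0 p_pos by simp
  qed
  note phi = log_equation_imp[OF s(2) x_pos x_less_1 leq]
  have ratio: "D' / D = exp ((dual a - a) * T)"
  proof -
    \<comment> \<open>The dual of \<open>dual a\<close> is \<open>a\<close>, so \<open>D'\<close> is
      the limit of \<open>E a\<close>.\<close>
    have "(\<lambda>k. E a (0 + of_nat k) / E (dual a) (0 + of_nat k)) \<longlonglongrightarrow> of_real D' / of_real D"
      using B'.E_tendsto_D[of 0] B.E_tendsto_D[of 0] B.D_pos unfolding dd by (intro tendsto_divide) auto
    moreover have "(\<lambda>k. E a (0 + of_nat k) / E (dual a) (0 + of_nat k)) \<longlonglongrightarrow> of_real (exp ((dual a - a) * T))"
      using E_ratio_limit[OF B.pn B.rn, of a "dual a"] unfolding rp T_def by simp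
    ultimately have "complex_of_real D' / of_real D = of_real (exp ((dual a - a) * T))" by (rule LIMSEQ_unique)
    hence "complex_of_real (D' / D) = of_real (exp ((dual a - a) * T))" by simp
    thus ?thesis by (simp only: of_real_eq_iff)
  qed
  have "\<bar>dual a - a\<bar> < 1"
  proof -
    have "D' / D \<le> real s" "D' / D \<ge> 1 / real s"
      using Db s(2) by (auto simp: field_simps intro: order_trans[of _ "real s * 1"] mult_mono order_trans[of _ "1 * real s"])
    hence "ln (D' / D) \<le> ln (real s)" "ln (D' / D) \<ge> ln (1 / real s)"
      using Db s(2) by (auto intro: ln_mono)
    hence "\<bar>(dual a - a) * T\<bar> \<le> ln (real s)" unfolding ratio using s(2) by (simp add: ln_div abs_le_iff)
    moreover have T: "T > ln (real s)" "T > 0"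
    proof -
      show "T > ln (real s)" using phi(2) by (simp only: T_def)
      moreover have "ln (real s) > 0" using s(2) by simp
      ultimately show "T > 0" by linarith
    qed
    moreover have "\<bar>(dual a - a) * T\<bar> = \<bar>dual a - a\<bar> * T" using T(2) by (simp add: abs_mult)
    ultimately have "\<bar>dual a - a\<bar> * T < 1 * T" by linarith
    thus ?thesis by (rule mult_right_less_imp_less) (use T(2) in simp)
  qed
  hence "real s * \<bar>dual a - a\<bar> < real s * 1" using s(2) by (intro mult_strict_left_mono) auto
  moreover have "real s * \<bar>dual a - a\<bar> = \<bar>of_int (int s - 2 - j) - of_int j\<bar>"
  proof -
    have "real s * \<bar>dual a - a\<bar> = \<bar>real s * (dual a - a)\<bar>" by (simp add: abs_mult)
    thus ?thesis by (simp only: right_diff_distrib j j')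
  qed
  ultimately have "\<bar>real_of_int (int s - 2 - j - j)\<bar> < real s" by simp
  \<comment> \<open>The strict inequality is what excludes \<open>j = -1\<close> and
    \<open>j = s - 1\<close>.\<close>
  hence "\<bar>int s - 2 - j - j\<bar> < int s" by linarith
  hence jb: "0 \<le> j" "j \<le> int s - 2" by linarith+
  have a_eq: "a = real (nat j) / real s" using j jb s(2) by (simp add: field_simps)
  have a'_eq: "a' = real (nat (int s - 2 - j)) / real s" unfolding a' using j' jb s(2) by (simp add: field_simps)
  have "is_GPF_solution p 0 r a' (1/2) x" unfolding a' by (rule gpf_imp_GPF[OF hyp B.gpf_b])
  moreover have "\<not> is_elementary p 0 r a' (1/2) x" unfolding a' elementary_iff by (rule B.dual_infinite_poles)
  moreover have "\<exists>P::int. p = of_int P \<and> even (P * (int s - 1))"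
  proof (intro exI conjI)
    show "p = of_int (int pn)" by (simp add: B.pn)
    have "real rn = real (s * pn)" using s(1) B.rn B.pn by simp
    hence "rn = s * pn" by (simp only: of_nat_eq_iff)
    hence "int pn * (int s - 1) = int rn - int pn" by (simp add: algebra_simps)
    \<comment> \<open>Here \<open>p * (s - 1) = r - p\<close>, which is even by the parity of
      \<open>r\<close> and \<open>p\<close>.\<close>
    thus "even (int pn * (int s - 1))" using B.parity by simp
  qed
  moreover have "nat j + nat (int s - 2 - j) = s - 2" using jb by linarith
  moreover have "a \<in> \<rat>" "a' \<in> \<rat>" unfolding a_eq a'_eq by simp_all
  ultimately show ?thesis
    using sp s(2) a_eq a'_eq phi(1) phi_unique_root[OF s(2) x_pos x_less_1 phi(1)] phi_root_algebraic[OF s(2) phi(1)] by blast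
qed

end
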